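(* There is a data structure for Dynamic Interval Scheduling (on one machine) that supports any sequence of $n$ insert/delete operations in $O(\sqrt{n}\log n)$ amortized time per update.
   Context: An interval is a pair $(s_i,f_i)$ of reals with $s_i<f_i$; endpoints of all intervals are assumed pairwise distinct. Two intervals are compatible if they are disjoint. Dynamic Interval Scheduling: maintain a set $S$ of intervals under insertions and deletions and after each update report the maximum size of a subset of $S$ consisting of pairwise compatible intervals. *)

theory Defs
  imports Complex_Main "HOL-Library.Landau_Symbols"
begin

section \<open>Dynamic Interval Scheduling\<close>

type_synonym interval = "real \<times> real"

definition is_interval :: "interval \<Rightarrow> bool" where
  "is_interval i \<longleftrightarrow> fst i < snd i"

definition endpoints :: "interval \<Rightarrow> real set" where
  "endpoints i = {fst i, snd i}"

text \<open>As all endpoints are distinct, it is immaterial whether intervals are closed or open.\<close>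

definition compatible :: "interval \<Rightarrow> interval \<Rightarrow> bool" where
  "compatible i j \<longleftrightarrow> {fst i..snd i} \<inter> {fst j..snd j} = {}"

definition max_compatible :: "interval set \<Rightarrow> nat" where
  "max_compatible S = Max (card ` {T. T \<subseteq> S \<and> pairwise compatible T})"

datatype update = Insert interval | Delete interval

fun apply_update :: "update \<Rightarrow> interval set \<Rightarrow> interval set" where
  "apply_update (Insert i) S = insert i S"
| "apply_update (Delete i) S = S - {i}"

fun valid_update :: "interval set \<Rightarrow> update \<Rightarrow> bool" where
  "valid_update S (Insert i) \<longleftrightarrow>
     is_interval i \<and> (\<forall>j\<in>S. endpoints i \<inter> endpoints j = {})"
| "valid_update S (Delete i) \<longleftrightarrow> i \<in> S"

fun valid_updates :: "interval set \<Rightarrow> update list \<Rightarrow> bool" where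
  "valid_updates S [] \<longleftrightarrow> True"
| "valid_updates S (u # us) \<longleftrightarrow> valid_update S u \<and> valid_updates (apply_update u S) us"

fun correct_answers :: "interval set \<Rightarrow> update list \<Rightarrow> nat list" where
  "correct_answers S [] = []"
| "correct_answers S (u # us) =
     max_compatible (apply_update u S) # correct_answers (apply_update u S) us"


section \<open>A word RAM with comparable reals\<close>

text \<open>
  Programs are structured programs over a memory with integer words and reals.
  Integer words are unsigned and consist of \<open>w\<close> bits; an overflowing computation is stuck.
  Reals can only be copied and compared, as usual for comparison-based algorithms.
  Variables are registers. A program mentions only finitely many array names, so its arrays
  amount to interleaved parts of one random access memory.
\<close>

record memory =
  ivar :: "string \<Rightarrow> nat"
  rvar :: "string \<Rightarrow> real"
  iarr :: "string \<Rightarrow> nat \<Rightarrow> nat"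
  rarr :: "string \<Rightarrow> nat \<Rightarrow> real"

definition empty_memory :: memory where
  "empty_memory = \<lparr>ivar = \<lambda>_. 0, rvar = \<lambda>_. 0, iarr = \<lambda>_ _. 0, rarr = \<lambda>_ _. 0\<rparr>"

datatype iexp =
    Num nat
  | IVar string
  | IArr string iexp
  | Add iexp iexp
  | Sub iexp iexp
  | Mul iexp iexp
  | Div iexp iexp

datatype rexp =
    RVar string
  | RArr string iexp

datatype bexp =
    ILess iexp iexp
  | RLess rexp rexp
  | BNot bexp
  | BAnd bexp bexp

datatype com =
    Skip
  | IAssign string iexp
  | RAssign string rexp
  | IStore string iexp iexp
  | RStore string iexp rexp
  | Seq com com
  | Cond bexp com com
  | While bexp com

text \<open>Subtraction is truncated at zero, and division by zero yields zero.\<close>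

fun ival :: "iexp \<Rightarrow> memory \<Rightarrow> nat" where
  "ival (Num k) m = k"
| "ival (IVar x) m = ivar m x"
| "ival (IArr a e) m = iarr m a (ival e m)"
| "ival (Add e1 e2) m = ival e1 m + ival e2 m"
| "ival (Sub e1 e2) m = ival e1 m - ival e2 m"
| "ival (Mul e1 e2) m = ival e1 m * ival e2 m"
| "ival (Div e1 e2) m = ival e1 m div ival e2 m"

fun rval :: "rexp \<Rightarrow> memory \<Rightarrow> real" where
  "rval (RVar x) m = rvar m x"
| "rval (RArr a e) m = rarr m a (ival e m)"

fun bval :: "bexp \<Rightarrow> memory \<Rightarrow> bool" where
  "bval (ILess e1 e2) m \<longleftrightarrow> ival e1 m < ival e2 m"
| "bval (RLess r1 r2) m \<longleftrightarrow> rval r1 m < rval r2 m"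
| "bval (BNot b) m \<longleftrightarrow> \<not> bval b m"
| "bval (BAnd b1 b2) m \<longleftrightarrow> bval b1 m \<and> bval b2 m"

text \<open>All intermediate integer values, in particular all addresses, fit into \<open>w\<close> bits.\<close>

fun ifits :: "nat \<Rightarrow> iexp \<Rightarrow> memory \<Rightarrow> bool" where
  "ifits w (Num k) m \<longleftrightarrow> k < 2 ^ w"
| "ifits w (IVar x) m \<longleftrightarrow> ivar m x < 2 ^ w"
| "ifits w (IArr a e) m \<longleftrightarrow> ifits w e m \<and> ival (IArr a e) m < 2 ^ w"
| "ifits w (Add e1 e2) m \<longleftrightarrow> ifits w e1 m \<and> ifits w e2 m \<and> ival (Add e1 e2) m < 2 ^ w"
| "ifits w (Sub e1 e2) m \<longleftrightarrow> ifits w e1 m \<and> ifits w e2 m"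
| "ifits w (Mul e1 e2) m \<longleftrightarrow> ifits w e1 m \<and> ifits w e2 m \<and> ival (Mul e1 e2) m < 2 ^ w"
| "ifits w (Div e1 e2) m \<longleftrightarrow> ifits w e1 m \<and> ifits w e2 m"

fun rfits :: "nat \<Rightarrow> rexp \<Rightarrow> memory \<Rightarrow> bool" where
  "rfits w (RVar x) m \<longleftrightarrow> True"
| "rfits w (RArr a e) m \<longleftrightarrow> ifits w e m"

fun bfits :: "nat \<Rightarrow> bexp \<Rightarrow> memory \<Rightarrow> bool" where
  "bfits w (ILess e1 e2) m \<longleftrightarrow> ifits w e1 m \<and> ifits w e2 m"
| "bfits w (RLess r1 r2) m \<longleftrightarrow> rfits w r1 m \<and> rfits w r2 m"
| "bfits w (BNot b) m \<longleftrightarrow> bfits w b m"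
| "bfits w (BAnd b1 b2) m \<longleftrightarrow> bfits w b1 m \<and> bfits w b2 m"

text \<open>Every operation, memory access and constant has unit cost.\<close>

fun icost :: "iexp \<Rightarrow> nat" where
  "icost (Num k) = 1"
| "icost (IVar x) = 1"
| "icost (IArr a e) = icost e + 1"
| "icost (Add e1 e2) = icost e1 + icost e2 + 1"
| "icost (Sub e1 e2) = icost e1 + icost e2 + 1"
| "icost (Mul e1 e2) = icost e1 + icost e2 + 1"
| "icost (Div e1 e2) = icost e1 + icost e2 + 1"

fun rcost :: "rexp \<Rightarrow> nat" where
  "rcost (RVar x) = 1"
| "rcost (RArr a e) = icost e + 1"

fun bcost :: "bexp \<Rightarrow> nat" where
  "bcost (ILess e1 e2) = icost e1 + icost e2 + 1"
| "bcost (RLess r1 r2) = rcost r1 + rcost r2 + 1"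
| "bcost (BNot b) = bcost b + 1"
| "bcost (BAnd b1 b2) = bcost b1 + bcost b2 + 1"

text \<open>
  \<open>exec w c m t m'\<close>: on \<open>w\<close>-bit words, started in memory \<open>m\<close>, program \<open>c\<close> terminates
  in memory \<open>m'\<close> after \<open>t\<close> time steps.
\<close>

inductive exec :: "nat \<Rightarrow> com \<Rightarrow> memory \<Rightarrow> nat \<Rightarrow> memory \<Rightarrow> bool" for w where
  Skip: "exec w Skip m 1 m"
| IAssign: "ifits w e m \<Longrightarrow>
    exec w (IAssign x e) m (icost e + 1) (m\<lparr>ivar := (ivar m)(x := ival e m)\<rparr>)"
| RAssign: "rfits w r m \<Longrightarrow>
    exec w (RAssign x r) m (rcost r + 1) (m\<lparr>rvar := (rvar m)(x := rval r m)\<rparr>)"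
| IStore: "ifits w e m \<Longrightarrow> ifits w e' m \<Longrightarrow>
    exec w (IStore a e e') m (icost e + icost e' + 1)
      (m\<lparr>iarr := (iarr m)(a := (iarr m a)(ival e m := ival e' m))\<rparr>)"
| RStore: "ifits w e m \<Longrightarrow> rfits w r m \<Longrightarrow>
    exec w (RStore a e r) m (icost e + rcost r + 1)
      (m\<lparr>rarr := (rarr m)(a := (rarr m a)(ival e m := rval r m))\<rparr>)"
| Seq: "exec w c1 m t1 m1 \<Longrightarrow> exec w c2 m1 t2 m2 \<Longrightarrow> exec w (Seq c1 c2) m (t1 + t2) m2"
| CondTrue: "bfits w b m \<Longrightarrow> bval b m \<Longrightarrow> exec w c1 m t m' \<Longrightarrow>
    exec w (Cond b c1 c2) m (bcost b + t + 1) m'"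
| CondFalse: "bfits w b m \<Longrightarrow> \<not> bval b m \<Longrightarrow> exec w c2 m t m' \<Longrightarrow>
    exec w (Cond b c1 c2) m (bcost b + t + 1) m'"
| WhileFalse: "bfits w b m \<Longrightarrow> \<not> bval b m \<Longrightarrow> exec w (While b c) m (bcost b + 1) m"
| WhileTrue: "bfits w b m \<Longrightarrow> bval b m \<Longrightarrow> exec w c m t1 m1 \<Longrightarrow>
    exec w (While b c) m1 t2 m2 \<Longrightarrow> exec w (While b c) m (bcost b + t1 + t2 + 1) m2"

inductive_cases SkipE: "exec w Skip m t m'"
inductive_cases IAssignE: "exec w (IAssign x e) m t m'"
inductive_cases RAssignE: "exec w (RAssign x r) m t m'"
inductive_cases IStoreE: "exec w (IStore a e e') m t m'"
inductive_cases RStoreE: "exec w (RStore a e r) m t m'"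
inductive_cases SeqE: "exec w (Seq c1 c2) m t m'"
inductive_cases CondE: "exec w (Cond b c1 c2) m t m'"
inductive_cases WhileE: "exec w (While b c) m t m'"

lemma exec_deterministic:
  "exec w c m t m' \<Longrightarrow> exec w c m u m'' \<Longrightarrow> t = u \<and> m' = m''"
proof (induction arbitrary: u m'' rule: exec.induct)
  case (Seq c1 m t1 m1 c2 t2 m2)
  from Seq.prems show ?case by (rule SeqE) (auto dest!: Seq.IH)
next
  case (CondTrue b m c1 t m' c2)
  from CondTrue.prems show ?case by (rule CondE) (auto simp: CondTrue.hyps(2) dest!: CondTrue.IH)
next
  case (CondFalse b m c2 t m' c1)
  from CondFalse.prems show ?case by (rule CondE) (auto simp: CondFalse.hyps(2) dest!: CondFalse.IH)
next
  case (WhileFalse b m c)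
  from WhileFalse.prems show ?case by (rule WhileE) (simp_all add: WhileFalse.hyps)
next
  case (WhileTrue b m c t1 m1 t2 m2)
  from WhileTrue.prems show ?case by (rule WhileE) (auto simp: WhileTrue.hyps(2) dest!: WhileTrue.IH)
qed (erule SkipE IAssignE RAssignE IStoreE RStoreE, simp)+


section \<open>Data structures and amortized update time\<close>

record data_structure =
  init_prog :: com
  insert_prog :: com
  delete_prog :: com

text \<open>
  The endpoints of the interval to insert or delete are passed in the real registers
  \<open>''start''\<close> and \<open>''finish''\<close>; the answer is reported in the integer register \<open>''answer''\<close>.
\<close>

definition pass_interval :: "interval \<Rightarrow> memory \<Rightarrow> memory" where
  "pass_interval i m =
     m\<lparr>rvar := (rvar m)(''start'' := fst i, ''finish'' := snd i)\<rparr>"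

definition reported :: "memory \<Rightarrow> nat" where
  "reported m = ivar m ''answer''"

fun exec_update ::
  "nat \<Rightarrow> data_structure \<Rightarrow> update \<Rightarrow> memory \<Rightarrow> nat \<Rightarrow> memory \<Rightarrow> bool" where
  "exec_update w D (Insert i) m t m' \<longleftrightarrow> exec w (insert_prog D) (pass_interval i m) t m'"
| "exec_update w D (Delete i) m t m' \<longleftrightarrow> exec w (delete_prog D) (pass_interval i m) t m'"

text \<open>
  \<open>exec_updates w D us m as t\<close>: started in memory \<open>m\<close>, the updates \<open>us\<close> are processed one
  after the other, reporting the answers \<open>as\<close>, in total time \<open>t\<close>.
\<close>

inductive exec_updates ::
  "nat \<Rightarrow> data_structure \<Rightarrow> update list \<Rightarrow> memory \<Rightarrow> nat list \<Rightarrow> nat \<Rightarrow> bool" for w D where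
  Nil: "exec_updates w D [] m [] 0"
| Cons: "exec_update w D u m t1 m' \<Longrightarrow> exec_updates w D us m' as t2 \<Longrightarrow>
    exec_updates w D (u # us) m (reported m' # as) (t1 + t2)"

definition run :: "nat \<Rightarrow> data_structure \<Rightarrow> update list \<Rightarrow> nat list \<Rightarrow> nat \<Rightarrow> bool" where
  "run w D us as t \<longleftrightarrow>
     (\<exists>t0 m0 t1. exec w (init_prog D) empty_memory t0 m0 \<and>
        exec_updates w D us m0 as t1 \<and> t = t0 + t1)"

text \<open>
  \<open>D\<close> solves Dynamic Interval Scheduling, and every sequence of \<open>n\<close> updates, started from the
  empty set, takes total time at most \<open>n * \<tau> n\<close> on words of \<open>\<Omega>(log n)\<close> bits.
  The number \<open>n\<close> of updates is not known to \<open>D\<close>.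
\<close>

definition supports_updates_amortized :: "data_structure \<Rightarrow> (nat \<Rightarrow> real) \<Rightarrow> bool" where
  "supports_updates_amortized D \<tau> \<longleftrightarrow>
     (\<exists>K. \<forall>w us. us \<noteq> [] \<longrightarrow> valid_updates {} us \<longrightarrow>
        K * log 2 (real (length us) + 1) \<le> real w \<longrightarrow>
        (\<exists>t. run w D us (correct_answers {} us) t \<and>
             real t \<le> real (length us) * \<tau> (length us)))"

end

theory Submission
  imports Defs
begin

text \<open>
  The intervals are kept sorted by start and cut into blocks. A scan by increasing start that
  maintains the maximum number of pairwise compatible intervals and the smallest possible last
  finish computes the answer. Once the scan has selected an interval of a block, its
  effect on the rest of the block no longer depends on the past, so it can be tabulated. The first
  selection within a block occurs at the first start after the current finish or at a fixed position,
  whichever comes first; a binary search finds it. An update hence rebuilds the table of one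
  block and skips through all blocks with one binary search each.

  The phase number \<open>J\<close> consists of \<open>J\<close> updates on \<open>J\<close> blocks that hold at most \<open>J\<close>
  intervals initially and thus at most \<open>2 * J\<close> at any time. All blocks are rebuilt in time
  \<open>O(J\<^sup>2)\<close> between phases. After \<open>n\<close> updates, \<open>J\<close> is of order \<open>sqrt n\<close>.
\<close>

section \<open>Timed total correctness\<close>

text \<open>The obstacle is that the finish carried by the scan also changes without a selection,
  whenever an interval with a smaller finish is passed. Up to the first selection in a block this
  merely takes minima, and a minimum lies below a start iff one of its members does. So the first
  selection is caused either by the incoming finish \<open>x\<close>, which a binary search detects
  because starts increase, or by a finish inside the block, at a position that does not depend on
  \<open>x\<close>. Selecting position \<open>p\<close> sets the finish to \<open>f p\<close> and
  thereby erases the past. Ordering by start instead of by finish is what makes this search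
  possible. Since \<open>n\<close> is unknown in advance, the phases grow: those before phase
  \<open>J\<close> comprise 1 + ... + (J - 1) = J * (J - 1) / 2 updates, which keeps
  \<open>J\<close> near sqrt (2 * n), and the rebuild that ends phase \<open>J\<close> is paid for
  by its \<open>J\<close> updates. The sizes fit because a phase that begins with at most J * J
  intervals ends with at most J * J + J, which is less than (J + 1) * (J + 1), the room for
  \<open>J + 1\<close> blocks of \<open>J + 1\<close> intervals.\<close>

definition exec_within :: "nat \<Rightarrow> com \<Rightarrow> memory \<Rightarrow> nat \<Rightarrow> (memory \<Rightarrow> bool) \<Rightarrow> bool" where
  "exec_within w c m T Q \<longleftrightarrow> (\<exists>t m'. exec w c m t m' \<and> t \<le> T \<and> Q m')"

text \<open>Meant for loop-free code. The clause \<open>False\<close> for \<open>While\<close> makes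
  \<open>wp_sound\<close> vacuous on loops, so the value of \<open>cost\<close> there is arbitrary;
  loops go through \<open>exec_within_While\<close>.\<close>

primrec wp :: "nat \<Rightarrow> com \<Rightarrow> (memory \<Rightarrow> bool) \<Rightarrow> memory \<Rightarrow> bool" where
  "wp w Skip Q = Q"
| "wp w (IAssign x e) Q = (\<lambda>m. ifits w e m \<and> Q (m\<lparr>ivar := (ivar m)(x := ival e m)\<rparr>))"
| "wp w (RAssign x r) Q = (\<lambda>m. rfits w r m \<and> Q (m\<lparr>rvar := (rvar m)(x := rval r m)\<rparr>))"
| "wp w (IStore a e e') Q = (\<lambda>m. ifits w e m \<and> ifits w e' m \<and>
     Q (m\<lparr>iarr := (iarr m)(a := (iarr m a)(ival e m := ival e' m))\<rparr>))"
| "wp w (RStore a e r) Q = (\<lambda>m. ifits w e m \<and> rfits w r m \<and>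
     Q (m\<lparr>rarr := (rarr m)(a := (rarr m a)(ival e m := rval r m))\<rparr>))"
| "wp w (Seq c1 c2) Q = wp w c1 (wp w c2 Q)"
| "wp w (Cond b c1 c2) Q = (\<lambda>m. bfits w b m \<and> (if bval b m then wp w c1 Q m else wp w c2 Q m))"
| "wp w (While b c) Q = (\<lambda>m. False)"

primrec cost :: "com \<Rightarrow> nat" where
  "cost Skip = 1"
| "cost (IAssign x e) = icost e + 1"
| "cost (RAssign x r) = rcost r + 1"
| "cost (IStore a e e') = icost e + icost e' + 1"
| "cost (RStore a e r) = icost e + rcost r + 1"
| "cost (Seq c1 c2) = cost c1 + cost c2"
| "cost (Cond b c1 c2) = bcost b + max (cost c1) (cost c2) + 1"
| "cost (While b c) = 0"

lemma wp_sound: "wp w c Q m \<Longrightarrow> exec_within w c m (cost c) Q"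
proof (induction c arbitrary: Q m)
  case (Seq c1 c2)
  then obtain t1 m1 where 1: "exec w c1 m t1 m1" "t1 \<le> cost c1" "wp w c2 Q m1"
    by (fastforce simp: exec_within_def)
  then obtain t2 m2 where "exec w c2 m1 t2 m2" "t2 \<le> cost c2" "Q m2"
    using Seq.IH(2) by (fastforce simp: exec_within_def)
  with 1 show ?case unfolding exec_within_def by (fastforce intro: exec.Seq)
next
  case (Cond b c1 c2)
  show ?case
  proof (cases "bval b m")
    case True
    then obtain t m' where "exec w c1 m t m'" "t \<le> cost c1" "Q m'"
      using Cond by (fastforce simp: exec_within_def)
    with True show ?thesis using Cond.prems exec.CondTrue[of w b m c1 t m' c2]
      by (force simp: exec_within_def)
  next
    case False
    then obtain t m' where "exec w c2 m t m'" "t \<le> cost c2" "Q m'"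
      using Cond by (fastforce simp: exec_within_def)
    with False show ?thesis using Cond.prems exec.CondFalse[of w b m c2 t m' c1]
      by (force simp: exec_within_def)
  qed
next
  case Skip
  then show ?case unfolding exec_within_def using exec.Skip by fastforce
next
  case (IAssign x e)
  then show ?case unfolding exec_within_def using exec.IAssign by fastforce
next
  case (RAssign x r)
  then show ?case unfolding exec_within_def using exec.RAssign by fastforce
next
  case (IStore a e e')
  then show ?case unfolding exec_within_def using exec.IStore by fastforce
next
  case (RStore a e r)
  then show ?case unfolding exec_within_def using exec.RStore by fastforce
next
  case (While b c)
  then show ?case by simp
qed

lemma exec_within_wp: "wp w c Q m \<Longrightarrow> cost c \<le> T \<Longrightarrow> exec_within w c m T Q"
  using wp_sound unfolding exec_within_def by (meson order_trans)

lemma exec_within_mono: "exec_within w c m T Q \<Longrightarrow> (\<And>m'. Q m' \<Longrightarrow> Q' m') \<Longrightarrow> T \<le> T' \<Longrightarrow> exec_within w c m T' Q'"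
  unfolding exec_within_def by (meson order_trans)

lemma exec_within_Seq:
  assumes "exec_within w c1 m T1 P" "\<And>m1. P m1 \<Longrightarrow> exec_within w c2 m1 T2 Q" "T1 + T2 \<le> T"
  shows "exec_within w (Seq c1 c2) m T Q"
proof -
  from assms(1) obtain t1 m1 where 1: "exec w c1 m t1 m1" "t1 \<le> T1" "P m1"
    by (auto simp: exec_within_def)
  from assms(2)[OF 1(3)] obtain t2 m2 where 2: "exec w c2 m1 t2 m2" "t2 \<le> T2" "Q m2"
    by (auto simp: exec_within_def)
  show ?thesis unfolding exec_within_def
    using 1 2 assms(3) by (intro exI[of _ "t1 + t2"] exI[of _ m2]) (auto intro: exec.Seq)
qed

lemma exec_within_Cond:
  assumes "bfits w b m" "bval b m \<Longrightarrow> exec_within w c1 m T1 Q" "\<not> bval b m \<Longrightarrow> exec_within w c2 m T1 Q"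
    "bcost b + T1 + 1 \<le> T"
  shows "exec_within w (Cond b c1 c2) m T Q"
proof (cases "bval b m")
  case True
  with assms(2) obtain t m' where 1: "exec w c1 m t m'" "t \<le> T1" "Q m'" by (auto simp: exec_within_def)
  then show ?thesis unfolding exec_within_def using assms True
    by (intro exI[of _ "bcost b + t + 1"] exI[of _ m'] conjI exec.CondTrue) auto
next
  case False
  with assms(3) obtain t m' where 1: "exec w c2 m t m'" "t \<le> T1" "Q m'" by (auto simp: exec_within_def)
  then show ?thesis unfolding exec_within_def using assms False
    by (intro exI[of _ "bcost b + t + 1"] exI[of _ m'] conjI exec.CondFalse) auto
qed

section \<open>Frame conditions read off the program text\<close>

primrec mod_ivars :: "com \<Rightarrow> string set" where
  "mod_ivars Skip = {}"
| "mod_ivars (IAssign x e) = {x}"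
| "mod_ivars (RAssign x r) = {}"
| "mod_ivars (IStore a e e') = {}"
| "mod_ivars (RStore a e r) = {}"
| "mod_ivars (Seq c1 c2) = mod_ivars c1 \<union> mod_ivars c2"
| "mod_ivars (Cond b c1 c2) = mod_ivars c1 \<union> mod_ivars c2"
| "mod_ivars (While b c) = mod_ivars c"

primrec mod_rvars :: "com \<Rightarrow> string set" where
  "mod_rvars Skip = {}"
| "mod_rvars (IAssign x e) = {}"
| "mod_rvars (RAssign x r) = {x}"
| "mod_rvars (IStore a e e') = {}"
| "mod_rvars (RStore a e r) = {}"
| "mod_rvars (Seq c1 c2) = mod_rvars c1 \<union> mod_rvars c2"
| "mod_rvars (Cond b c1 c2) = mod_rvars c1 \<union> mod_rvars c2"
| "mod_rvars (While b c) = mod_rvars c"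

primrec mod_iarrs :: "com \<Rightarrow> string set" where
  "mod_iarrs Skip = {}"
| "mod_iarrs (IAssign x e) = {}"
| "mod_iarrs (RAssign x r) = {}"
| "mod_iarrs (IStore a e e') = {a}"
| "mod_iarrs (RStore a e r) = {}"
| "mod_iarrs (Seq c1 c2) = mod_iarrs c1 \<union> mod_iarrs c2"
| "mod_iarrs (Cond b c1 c2) = mod_iarrs c1 \<union> mod_iarrs c2"
| "mod_iarrs (While b c) = mod_iarrs c"

primrec mod_rarrs :: "com \<Rightarrow> string set" where
  "mod_rarrs Skip = {}"
| "mod_rarrs (IAssign x e) = {}"
| "mod_rarrs (RAssign x r) = {}"
| "mod_rarrs (IStore a e e') = {}"
| "mod_rarrs (RStore a e r) = {a}"
| "mod_rarrs (Seq c1 c2) = mod_rarrs c1 \<union> mod_rarrs c2"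
| "mod_rarrs (Cond b c1 c2) = mod_rarrs c1 \<union> mod_rarrs c2"
| "mod_rarrs (While b c) = mod_rarrs c"

text \<open>Purely syntactic, hence available for every execution. Loop invariants can thus omit all
  registers and arrays that the body does not assign.\<close>

definition frame :: "com \<Rightarrow> memory \<Rightarrow> memory \<Rightarrow> bool" where
  "frame c m m' \<longleftrightarrow>
     (\<forall>x. x \<notin> mod_ivars c \<longrightarrow> ivar m' x = ivar m x) \<and>
     (\<forall>x. x \<notin> mod_rvars c \<longrightarrow> rvar m' x = rvar m x) \<and>
     (\<forall>a. a \<notin> mod_iarrs c \<longrightarrow> iarr m' a = iarr m a) \<and>
     (\<forall>a. a \<notin> mod_rarrs c \<longrightarrow> rarr m' a = rarr m a)"

lemma frameD:
  assumes "frame c m m'"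
  shows "x \<notin> mod_ivars c \<Longrightarrow> ivar m' x = ivar m x"
    and "x \<notin> mod_rvars c \<Longrightarrow> rvar m' x = rvar m x"
    and "x \<notin> mod_iarrs c \<Longrightarrow> iarr m' x = iarr m x"
    and "x \<notin> mod_rarrs c \<Longrightarrow> rarr m' x = rarr m x"
  using assms by (auto simp: frame_def)

lemma frame_refl: "frame c m m"
  by (simp add: frame_def)

lemma exec_frame: "exec w c m t m' \<Longrightarrow> frame c m m'"
proof (induction rule: exec.induct)
  case (Seq c1 m t1 m1 c2 t2 m2)
  then show ?case unfolding frame_def by simp
next
  case (WhileTrue b m c t1 m1 t2 m2)
  then show ?case unfolding frame_def by simp
qed (simp_all add: frame_def)

lemma exec_within_frame: "exec_within w c m T Q \<Longrightarrow> exec_within w c m T (\<lambda>m'. frame c m m' \<and> Q m')"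
  unfolding exec_within_def by (metis exec_frame)

lemma frame_trans: "frame c m m' \<Longrightarrow> frame c m' m'' \<Longrightarrow> frame c m m''"
  by (simp add: frame_def)

text \<open>The index of the invariant bounds the number of remaining iterations.\<close>

lemma exec_within_While:
  assumes "I r m0"
    and "\<And>r m. I r m \<Longrightarrow> frame c m0 m \<Longrightarrow>
      bfits w b m \<and> (bval b m \<longrightarrow> 0 < r \<and> exec_within w c m C (I (r - 1)))"
    and "r * (C + bcost b + 1) + bcost b + 1 \<le> T"
  shows "exec_within w (While b c) m0 T (\<lambda>m. \<not> bval b m \<and> frame c m0 m \<and> (\<exists>r'. I r' m))"
proof -
  have "exec_within w (While b c) m (r * (C + bcost b + 1) + bcost b + 1)
      (\<lambda>m. \<not> bval b m \<and> frame c m0 m \<and> (\<exists>r'. I r' m))"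
    if "I r m" "frame c m0 m" for m
    using that
  proof (induction r arbitrary: m)
    case 0
    then have "bfits w b m" "\<not> bval b m" using assms(2) by blast+
    then show ?case unfolding exec_within_def using 0
      by (intro exI[of _ "bcost b + 1"] exI[of _ m]) (auto intro: exec.WhileFalse simp del: One_nat_def)
  next
    case (Suc r)
    have fits: "bfits w b m" using assms(2) Suc.prems by blast
    show ?case
    proof (cases "bval b m")
      case False
      then show ?thesis unfolding exec_within_def using Suc.prems fits
        by (intro exI[of _ "bcost b + 1"] exI[of _ m])
          (auto intro: exec.WhileFalse simp del: One_nat_def)
    next
      case True
      then have "exec_within w c m C (I r)" using assms(2) Suc.prems by fastforce
      then obtain t1 m1 where 1: "exec w c m t1 m1" "t1 \<le> C" "I r m1" by (auto simp: exec_within_def)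
      then have "frame c m0 m1" using Suc.prems exec_frame frame_trans by blast
      from Suc.IH[OF 1(3) this] obtain t2 m2 where 2: "exec w (While b c) m1 t2 m2"
        "t2 \<le> r * (C + bcost b + 1) + bcost b + 1"
        "\<not> bval b m2 \<and> frame c m0 m2 \<and> (\<exists>r'. I r' m2)" by (auto simp: exec_within_def)
      have "exec w (While b c) m (bcost b + t1 + t2 + 1) m2"
        by (rule exec.WhileTrue[OF fits True 1(1) 2(1)])
      moreover have "bcost b + t1 + t2 + 1 \<le> Suc r * (C + bcost b + 1) + bcost b + 1"
        using 1(2) 2(2) by simp
      ultimately show ?thesis unfolding exec_within_def using 2(3) by blast
    qed
  qed
  from this[OF assms(1) frame_refl] show ?thesis by (rule exec_within_mono) (use assms(3) in auto)
qed

section \<open>The greedy scan\<close>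

text \<open>The scan visits the intervals by increasing start. Its state consists of the maximum number
  of pairwise compatible intervals seen so far and of the smallest possible last finish of such a
  selection; the latter is meaningless as long as the former is zero.\<close>

fun step :: "interval \<Rightarrow> nat \<times> real \<Rightarrow> nat \<times> real" where
  "step (s, f) (c, x) = (if c = 0 \<or> x < s then (Suc c, f) else (c, min x f))"

text \<open>The last finish of a selection is bounded through its members rather than by a maximum:
  with count zero the selections are empty and both bounds hold for any second component.\<close>

definition scan_optimal :: "interval set \<Rightarrow> nat \<times> real \<Rightarrow> bool" where
  "scan_optimal P st \<longleftrightarrow>
     (\<exists>T\<subseteq>P. pairwise compatible T \<and> card T = fst st \<and> (\<forall>i\<in>T. snd i \<le> snd st)) \<and>
     (\<forall>T\<subseteq>P. pairwise compatible T \<longrightarrow> card T \<le> fst st \<and>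
        (card T = fst st \<longrightarrow> T \<noteq> {} \<longrightarrow> (\<exists>i\<in>T. snd st \<le> snd i)))"

lemma compatible_iff:
  assumes "fst i < snd i" "fst j < snd j"
  shows "compatible i j \<longleftrightarrow> snd i < fst j \<or> snd j < fst i"
  using assms by (auto simp: compatible_def)

text \<open>An exchange argument. If all of an optimal selection ends before \<open>i\<close>
  starts, \<open>i\<close> extends it. Otherwise no optimal selection can be extended by
  \<open>i\<close>, because each ends at or after \<open>x\<close>, which is not below the start of
  \<open>i\<close>; the new interval can then only replace the last one of a selection.\<close>

lemma scan_optimal_step:
  assumes opt: "scan_optimal P st" and fin: "finite P"
    and P: "\<forall>j\<in>P. fst j < snd j \<and> fst j < fst i" and i: "fst i < snd i"
  shows "scan_optimal (insert i P) (step i st)"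
proof -
  obtain c x where st: "st = (c, x)" by force
  obtain s f where i': "i = (s, f)" by force
  have iP: "i \<notin> P" using P by auto
  from opt obtain T where T: "T \<subseteq> P" "pairwise compatible T" "card T = c" "\<forall>j\<in>T. snd j \<le> x"
    by (auto simp: scan_optimal_def st)
  have ub: "card U \<le> c" "card U = c \<Longrightarrow> U \<noteq> {} \<Longrightarrow> \<exists>j\<in>U. x \<le> snd j"
    if "U \<subseteq> P" "pairwise compatible U" for U
    using opt that by (auto simp: scan_optimal_def st)
  have finU: "finite U" if "U \<subseteq> insert i P" for U using fin that finite_subset by auto
  have comp: "compatible i j \<longleftrightarrow> snd j < s" "compatible j i \<longleftrightarrow> snd j < s" if "j \<in> P" for j
    using compatible_iff[of i j] compatible_iff[of j i] P i that by (auto simp: i')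
  have less: "snd j < s" if "U \<subseteq> insert i P" "pairwise compatible U" "i \<in> U" "j \<in> U - {i}" for U j
    using that comp[of j] by (auto simp: pairwise_def)
  have split: "card U = Suc (card (U - {i}))" if "U \<subseteq> insert i P" "i \<in> U" for U
    using that finU by (metis card_Suc_Diff1)
  have sub: "U - {i} \<subseteq> P" "pairwise compatible (U - {i})"
    if "U \<subseteq> insert i P" "pairwise compatible U" for U
    using that by (auto intro: pairwise_subset)
  show ?thesis
  proof (cases "c = 0 \<or> x < s")
    case True
    have fT: "snd j < s" if "j \<in> T" for j
      using True T that finU[of T] by (metis card_gt_0_iff empty_iff le_less_trans less_irrefl
        subset_insertI2)
    have 1: "insert i T \<subseteq> insert i P" using T by auto
    have 2: "pairwise compatible (insert i T)"
      using T comp fT by (auto simp: pairwise_insert)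
    have 3: "card (insert i T) = Suc c"
      using T iP finite_subset[OF T(1) fin] by (metis card_insert_disjoint subsetD)
    have 4: "\<forall>j\<in>insert i T. snd j \<le> f" using fT i by (force simp: i')
    have 5: "card U \<le> Suc c \<and> (card U = Suc c \<longrightarrow> U \<noteq> {} \<longrightarrow> (\<exists>j\<in>U. f \<le> snd j))"
      if U: "U \<subseteq> insert i P" "pairwise compatible U" for U
    proof (cases "i \<in> U")
      case True
      then show ?thesis using split[OF U(1)] ub(1)[OF sub[OF U]] by (auto simp: i' intro!: bexI[of _ i])
    next
      case False
      then show ?thesis using ub(1)[OF sub[OF U]] by auto
    qed
    have "\<exists>U\<subseteq>insert i P. pairwise compatible U \<and> card U = Suc c \<and> (\<forall>j\<in>U. snd j \<le> f)"
      using 1 2 3 4 by blast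
    moreover have "step i st = (Suc c, f)" using True by (auto simp: st i')
    ultimately show ?thesis using 5 unfolding scan_optimal_def by auto
  next
    case False
    have "\<exists>U\<subseteq>insert i P. pairwise compatible U \<and> card U = c \<and> (\<forall>j\<in>U. snd j \<le> min x f)"
    proof (cases "x \<le> f")
      case True
      then show ?thesis using T by (intro exI[of _ T]) auto
    next
      case xf: False
      have "finite T" "T \<noteq> {}" using finU[of T] T False by auto
      then have "Max (snd ` T) \<in> snd ` T" by (intro Max_in) auto
      then obtain l where l: "l \<in> T" "snd l = Max (snd ` T)" by auto
      then have l_max: "\<forall>j\<in>T. snd j \<le> snd l" using \<open>finite T\<close> by auto
      \<comment> \<open>The rest of \<open>T\<close> ends before its last interval \<open>l\<close>
        starts, and \<open>l\<close> starts before \<open>i\<close>. Hence exchanging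
        \<open>l\<close> for \<open>i\<close> keeps the selection compatible.\<close>
      have ls: "snd j < s" if "j \<in> T - {l}" for j
      proof -
        have "compatible j l" using that l T by (auto simp: pairwise_def)
        moreover have "fst j < snd j" "fst l < snd l" using P that l(1) T(1) by auto
        ultimately have "snd j < fst l \<or> snd l < fst j" using compatible_iff by simp
        moreover have "snd j \<le> snd l" "fst j < snd j" "fst l < s" using that l(1) l_max T(1) P
          by (auto simp: i')
        ultimately show ?thesis by auto
      qed
      let ?U = "insert i (T - {l})"
      have "?U \<subseteq> insert i P" using T by auto
      moreover have "pairwise compatible ?U"
        unfolding pairwise_insert using ls comp T pairwise_subset[OF T(2), of "T - {l}"] by auto
      moreover have "card ?U = c"
        using \<open>finite T\<close> l T iP by (metis Diff_iff card_Suc_Diff1 card_insert_disjoint finite_Diff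
          subsetD)
      moreover have "\<forall>j\<in>?U. snd j \<le> min x f"
        using ls i xf False by (fastforce simp: i')
      ultimately show ?thesis by blast
    qed
    moreover have "card U \<le> c \<and> (card U = c \<longrightarrow> U \<noteq> {} \<longrightarrow> (\<exists>j\<in>U. min x f \<le> snd j))"
      if U: "U \<subseteq> insert i P" "pairwise compatible U" for U
    proof (cases "i \<in> U")
      case True
      have "card (U - {i}) \<noteq> c"
      proof
        assume c: "card (U - {i}) = c"
        then have "U - {i} \<noteq> {}" using False by (metis card.empty)
        from ub(2)[OF sub[OF U] c this] obtain j where "j \<in> U - {i}" "x \<le> snd j" by auto
        then have "x < s" using less[OF U True] by (meson le_less_trans)
        then show False using False by simp
      qed
      then have "card U \<le> c" using ub(1)[OF sub[OF U]] split[OF U(1) True] by auto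
      then show ?thesis using True by (auto simp: i' intro!: bexI[of _ i])
    next
      case F: False
      then have "U \<subseteq> P" using U by auto
      then show ?thesis using ub[of U] U(2) by (metis min.coboundedI1)
    qed
    moreover have "step i st = (c, min x f)" using False by (auto simp: st i')
    ultimately show ?thesis unfolding scan_optimal_def by auto
  qed
qed

lemma scan_optimal_fold:
  assumes "sorted_wrt (\<lambda>i j. fst i < fst j) l" "\<forall>i\<in>set l. fst i < snd i"
  shows "scan_optimal (set l) (fold step l (0, x))"
  using assms
proof (induction l rule: rev_induct)
  case Nil
  show ?case by (auto simp: scan_optimal_def)
next
  case (snoc i l)
  then have "scan_optimal (insert i (set l)) (step i (fold step l (0, x)))"
    by (intro scan_optimal_step) (auto simp: sorted_wrt_append)
  then show ?case by simp
qed

text \<open>The initial finish \<open>x\<close> stays arbitrary because a step with count zero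
  ignores it; \<open>compute_answer\<close> starts with whatever its register holds.\<close>

lemma fold_step_max_compatible:
  assumes "sorted_wrt (\<lambda>i j. fst i < fst j) l" "\<forall>i\<in>set l. fst i < snd i"
  shows "fst (fold step l (0, x)) = max_compatible (set l)"
proof -
  let ?F = "{T. T \<subseteq> set l \<and> pairwise compatible T}"
  have opt: "scan_optimal (set l) (fold step l (0, x))" by (rule scan_optimal_fold[OF assms])
  have "Max (card ` ?F) = fst (fold step l (0, x))"
  proof (rule Max_eqI)
    show "finite (card ` ?F)" by auto
  qed (use opt in \<open>auto simp: scan_optimal_def image_iff\<close>)
  then show ?thesis by (simp add: max_compatible_def)
qed

lemma fst_fold_step_le: "fst (fold step l st) \<le> fst st + length l"
proof (induction l arbitrary: st)
  case (Cons i l)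
  have "fst (step i st) \<le> Suc (fst st)" by (cases i; cases st) auto
  then show ?case using Cons[of "step i st"] by simp
qed simp

section \<open>Skipping a block of the scan\<close>

definition scan :: "(nat \<Rightarrow> real) \<Rightarrow> (nat \<Rightarrow> real) \<Rightarrow> nat \<Rightarrow> nat \<Rightarrow> nat \<times> real \<Rightarrow> nat \<times> real" where
  "scan s f a e = fold (\<lambda>k. step (s k, f k)) [a..<e]"

lemma scan_split: "a \<le> d \<Longrightarrow> d \<le> e \<Longrightarrow> scan s f a e st = scan s f d e (scan s f a d st)"
  unfolding scan_def using upt_add_eq_append[of a d "e - d"] by (simp add: fold_append)

lemma scan_first: "a < e \<Longrightarrow> scan s f a e st = scan s f (Suc a) e (step (s a, f a) st)"
  unfolding scan_def by (simp add: upt_conv_Cons)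

lemma fst_scan_le: "fst (scan s f a e st) \<le> fst st + (e - a)"
proof -
  have "scan s f a e st = fold step (map (\<lambda>k. (s k, f k)) [a..<e]) st"
    by (simp add: scan_def fold_map comp_def)
  then show ?thesis using fst_fold_step_le by (metis length_map length_upt)
qed

text \<open>The carried finish is the minimum of \<open>x\<close> and the finishes passed. That no
  start exceeds it can be tested against \<open>x\<close> and against each earlier finish
  separately, which splits quietness into a part about the past and a part about the block
  alone.\<close>

lemma scan_quiet:
  assumes "0 < c" "a \<le> e"
    and "\<And>j. a \<le> j \<Longrightarrow> j < e \<Longrightarrow> \<not> x < s j"
    and "\<And>i j. a \<le> i \<Longrightarrow> i < j \<Longrightarrow> j < e \<Longrightarrow> \<not> f i < s j"
  shows "scan s f a e (c, x) = (c, Min (insert x (f ` {a..<e})))"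
  using assms(2-)
proof (induction e rule: dec_induct)
  case base
  then show ?case by (simp add: scan_def)
next
  case (step e)
  have IH: "scan s f a e (c, x) = (c, Min (insert x (f ` {a..<e})))"
    using step by auto
  have "\<not> Min (insert x (f ` {a..<e})) < s e"
    using step.prems step.hyps by (auto simp: Min_less_iff)
  moreover have "Min (insert x (f ` {a..<Suc e})) = min (Min (insert x (f ` {a..<e}))) (f e)"
    using step.hyps Min_insert[of "insert x (f ` {a..<e})" "f e"]
    by (simp add: atLeastLessThanSuc insert_commute[of x "f e"] min.commute)
  ultimately show ?case using scan_split[of a e "Suc e" s f] IH step.hyps assms(1)
    by (simp add: scan_def[of _ _ e])
qed

text \<open>\<open>N\<close> is the first position at which the scan of a block of length \<open>M\<close> selects an
  interval whatever its initial state is, and \<open>(A p, Y p)\<close> is the effect of the rest of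
  the scan after the selection of the interval at position \<open>p\<close>.\<close>

definition tables ::
  "(nat \<Rightarrow> real) \<Rightarrow> (nat \<Rightarrow> real) \<Rightarrow> nat \<Rightarrow> nat \<Rightarrow> (nat \<Rightarrow> nat) \<Rightarrow> (nat \<Rightarrow> real) \<Rightarrow> bool" where
  "tables s f M N A Y \<longleftrightarrow> (M = 0 \<or> 0 < N) \<and> N \<le> M \<and>
     (\<forall>j<N. \<forall>i<j. \<not> f i < s j) \<and> (N < M \<longrightarrow> (\<exists>i<N. f i < s N)) \<and>
     (\<forall>p<M. \<forall>c>0. scan s f (Suc p) M (c, f p) = (c + A p, Y p))"

text \<open>The selection at \<open>e\<close> overwrites the finish by \<open>f e\<close>; from here
  on the past survives only in the count.\<close>

lemma scan_trigger:
  assumes "0 < c" "a \<le> e" "e < M"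
    and "\<And>j. a \<le> j \<Longrightarrow> j < e \<Longrightarrow> \<not> x < s j"
    and "\<And>i j. a \<le> i \<Longrightarrow> i < j \<Longrightarrow> j < e \<Longrightarrow> \<not> f i < s j"
    and "x < s e \<or> (\<exists>i. a \<le> i \<and> i < e \<and> f i < s e)"
  shows "scan s f a M (c, x) = scan s f (Suc e) M (Suc c, f e)"
proof -
  have "scan s f a M (c, x) = scan s f e M (scan s f a e (c, x))"
    using assms by (intro scan_split) auto
  also have "scan s f a e (c, x) = (c, Min (insert x (f ` {a..<e})))"
    by (rule scan_quiet) (use assms in auto)
  also have "Min (insert x (f ` {a..<e})) < s e"
    using assms(6) by (auto simp: Min_less_iff)
  then have "scan s f e M (c, Min (insert x (f ` {a..<e}))) = scan s f (Suc e) M (Suc c, f e)"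
    using scan_first[OF assms(3)] by simp
  finally show ?thesis .
qed

lemma tables_start: "tables s f M N A Y \<Longrightarrow> 0 < M \<Longrightarrow> scan s f 0 M (0, x) = (Suc (A 0), Y 0)"
  using scan_first[of 0 M s f "(0, x)"] by (simp add: tables_def)

text \<open>The position \<open>p\<close> is what a binary search among the first \<open>N\<close>
  starts returns. At \<open>p = N\<close> a finish inside the block forces the selection, so nothing
  is asked of \<open>x\<close> there.\<close>

lemma tables_select:
  assumes "tables s f M N A Y" "0 < c" "p \<le> N" "p < M" "\<And>j. j < p \<Longrightarrow> \<not> x < s j" "p < N \<Longrightarrow> x < s p"
  shows "scan s f 0 M (c, x) = (Suc c + A p, Y p)"
proof -
  have "x < s p \<or> (\<exists>i<p. f i < s p)"
    using assms by (cases "p < N") (auto simp: tables_def)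
  then have "scan s f 0 M (c, x) = scan s f (Suc p) M (Suc c, f p)"
    using assms by (intro scan_trigger) (auto simp: tables_def)
  then show ?thesis using assms by (auto simp: tables_def)
qed

text \<open>A block without inner selections needs no table of its own for its minimum: after
  position 0 nothing is selected either, so \<open>Y 0\<close> is the least finish of the
  block.\<close>

lemma tables_keep:
  assumes "tables s f M M A Y" "0 < c" "0 < M" "\<And>j. j < M \<Longrightarrow> \<not> x < s j"
  shows "scan s f 0 M (c, x) = (c, min x (Y 0))"
proof -
  have q: "\<not> f i < s j" if "i < j" "j < M" for i j
    using assms(1) that by (auto simp: tables_def)
  have "scan s f (Suc 0) M (c, f 0) = (c, Min (insert (f 0) (f ` {Suc 0..<M})))"
    using assms q by (intro scan_quiet) auto
  moreover have "scan s f (Suc 0) M (c, f 0) = (c + A 0, Y 0)"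
    using assms by (auto simp: tables_def)
  moreover have "insert (f 0) (f ` {Suc 0..<M}) = f ` {0..<M}"
    using assms(3) by (force simp: image_iff Suc_le_eq)
  ultimately have "Y 0 = Min (f ` {0..<M})" by simp
  moreover have "scan s f 0 M (c, x) = (c, Min (insert x (f ` {0..<M})))"
    using assms q by (intro scan_quiet) auto
  ultimately show ?thesis using assms(3) by simp
qed

section \<open>The data structure\<close>

text \<open>Block \<open>b < J\<close> has length \<open>z[b]\<close> and is stored from position \<open>b * W\<close> of the arrays
  \<open>s\<close> of starts and \<open>f\<close> of finishes on; its tables are \<open>N[b]\<close> and the same positions of
  \<open>A\<close> and \<open>Y\<close>. The register \<open>K\<close> counts the updates of the current phase.\<close>

abbreviation V where "V \<equiv> IVar"
abbreviation seq (infixr ";;" 60) where "seq \<equiv> Seq"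
abbreviation oadd where "oadd e \<equiv> Add (V ''o'') e"

definition select_block :: com where
  "select_block = IAssign ''o'' (Mul (V ''b'') (V ''W'')) ;; IAssign ''m'' (IArr ''z'' (V ''b''))"

text \<open>Two pointers that only move down. Before the entry of position \<open>p - 1\<close> is
  computed, \<open>q\<close> is lowered to the first position at which a scan starting from
  \<open>p - 1\<close> selects again; an earlier start can only move that position down. Register
  \<open>y\<close> holds the least finish from \<open>p\<close> on. Each round lowers
  \<open>p\<close> or \<open>q\<close>, so the time is linear in the block length.\<close>

definition tables_body :: com where
  "tables_body =
     Cond (BAnd (ILess (V ''p'') (V ''q''))
                (RLess (RArr ''f'' (oadd (Sub (V ''p'') (Num 1)))) (RArr ''s'' (oadd (Sub (V ''q'')
                  (Num 1))))))
       (IAssign ''q'' (Sub (V ''q'') (Num 1)))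
       (IAssign ''p'' (Sub (V ''p'') (Num 1)) ;;
        Cond (BAnd (ILess (Add (V ''p'') (Num 1)) (V ''m''))
                   (BNot (RLess (RArr ''f'' (oadd (V ''p''))) (RVar ''y''))))
          Skip (RAssign ''y'' (RArr ''f'' (oadd (V ''p'')))) ;;
        Cond (ILess (V ''q'') (V ''m''))
          (IStore ''A'' (oadd (V ''p'')) (Add (IArr ''A'' (oadd (V ''q''))) (Num 1)) ;;
           RStore ''Y'' (oadd (V ''p'')) (RArr ''Y'' (oadd (V ''q''))))
          (IStore ''A'' (oadd (V ''p'')) (Num 0) ;;
           RStore ''Y'' (oadd (V ''p'')) (RVar ''y'')))"

definition tables_loop :: com where
  "tables_loop = While (ILess (Num 0) (V ''p'')) tables_body"

definition make_tables :: com where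
  "make_tables =
     (select_block ;; IAssign ''p'' (V ''m'') ;; IAssign ''q'' (V ''m'')) ;;
     tables_loop ;;
     IStore ''N'' (V ''b'') (V ''q'')"

lemma tables_body_mods [simp]:
  "mod_ivars tables_body = {''p'', ''q''}" "mod_rvars tables_body = {''y''}"
  "mod_iarrs tables_body = {''A''}" "mod_rarrs tables_body = {''Y''}"
  by (auto simp: tables_body_def)

lemma make_tables_mods [simp]:
  "mod_ivars make_tables = {''o'', ''m'', ''p'', ''q''}" "mod_rvars make_tables = {''y''}"
  "mod_iarrs make_tables = {''A'', ''N''}" "mod_rarrs make_tables = {''Y''}"
  by (auto simp: make_tables_def tables_loop_def select_block_def)

text \<open>The condition \<open>p \<le> Suc i\<close> admits \<open>i = p - 1\<close>:
  \<open>q\<close> is lowered because of the pending finish \<open>f (p - 1)\<close> before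
  \<open>p\<close> itself moves. At \<open>p = 0\<close> the clause with \<open>0 < p\<close> says
  that \<open>q\<close> is positive, as \<open>tables\<close> demands of \<open>N\<close> for a
  nonempty block.\<close>

definition tables_inv ::
  "(nat \<Rightarrow> real) \<Rightarrow> (nat \<Rightarrow> real) \<Rightarrow> nat \<Rightarrow> nat \<Rightarrow> nat \<Rightarrow> real \<Rightarrow> (nat \<Rightarrow> nat) \<Rightarrow> (nat \<Rightarrow> real) \<Rightarrow> bool" where
  "tables_inv s f M p q y A Y \<longleftrightarrow> p \<le> q \<and> q \<le> M \<and>
     (\<forall>j<q. \<forall>i<j. p \<le> i \<longrightarrow> \<not> f i < s j) \<and>
     (q < M \<longrightarrow> (\<exists>i<q. p \<le> Suc i \<and> f i < s q)) \<and>
     (p < M \<longrightarrow> p < q \<or> 0 < p) \<and>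
     (p < M \<longrightarrow> y = Min (f ` {p..<M})) \<and>
     (\<forall>i<M. p \<le> i \<longrightarrow> (\<forall>c>0. scan s f (Suc i) M (c, f i) = (c + A i, Y i)))"

lemma tables_inv_init: "tables_inv s f M M M y A Y"
  by (auto simp: tables_inv_def)

text \<open>Each position adds at most one to the count; this is why stored counts fit into a
  word.\<close>

lemma tables_inv_le:
  assumes "tables_inv s f M p q y A Y" "p \<le> i" "i < M"
  shows "A i \<le> M"
proof -
  have "scan s f (Suc i) M (1, f i) = (1 + A i, Y i)" using assms by (auto simp: tables_inv_def)
  then show ?thesis using fst_scan_le[of s f "Suc i" M "(1, f i)"] assms by simp
qed

lemma tables_inv_decr:
  assumes "tables_inv s f M p q y A Y" "0 < p" "p < q" "f (p - 1) < s (q - 1)"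
  shows "tables_inv s f M p (q - 1) y A Y"
  using assms unfolding tables_inv_def
  by (auto intro!: exI[of _ "p - 1"])

lemma tables_inv_next:
  assumes inv: "tables_inv s f M p q y A Y" and p: "0 < p"
    and stop: "\<not> (p < q \<and> f (p - 1) < s (q - 1))"
    and mono: "\<And>i j. i < j \<Longrightarrow> j < M \<Longrightarrow> s i < s j"
    and y': "y' = (if p < M \<and> \<not> f (p - 1) < y then y else f (p - 1))"
    and A': "A' = A(p - 1 := if q < M then A q + 1 else 0)"
    and Y': "Y' = Y(p - 1 := if q < M then Y q else y')"
  shows "tables_inv s f M (p - 1) q y' A' Y'"
proof -
  obtain k where k: "p = Suc k" using p by (cases p) auto
  have pq: "k < q" "q \<le> M" "k < M" using inv k by (auto simp: tables_inv_def)
  \<comment> \<open>The loop compares \<open>f k\<close> with \<open>s (q - 1)\<close> only. As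
    starts increase, that is the largest start before \<open>q\<close>, so the test covers all the
    others.\<close>
  have quiet: "\<not> f i < s j" if "k \<le> i" "i < j" "j < q" for i j
  proof (cases "i = k")
    case True
    have "s j \<le> s (q - 1)" using mono[of j "q - 1"] that pq by (cases "j = q - 1")
      (auto simp: less_imp_le)
    then show ?thesis using stop True that k by auto
  next
    case False
    then show ?thesis using inv that k by (auto simp: tables_inv_def)
  qed
  have y_min: "y' = Min (f ` {k..<M})"
  proof (cases "p < M")
    case True
    then have y: "y = Min (f ` {Suc k..<M})" using inv k by (auto simp: tables_inv_def)
    have "{k..<M} = insert k {Suc k..<M}" using pq by auto
    then have "Min (f ` {k..<M}) = min (f k) y" using True k y by simp
    then show ?thesis using True y' k by auto
  next
    case False
    then have "{k..<M} = {k}" using pq k by auto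
    then show ?thesis using False y' k by simp
  qed
  have trig: "\<exists>i<q. k \<le> i \<and> f i < s q" if "q < M"
    using inv that k by (auto simp: tables_inv_def)
  \<comment> \<open>After position \<open>k\<close> the next selection is at \<open>q\<close>, whose
    entry is already known and counts one less. If \<open>q = M\<close>, the rest is quiet and ends
    in the suffix minimum.\<close>
  have new: "scan s f (Suc k) M (c, f k) = (c + A' k, Y' k)" if "0 < c" for c
  proof (cases "q < M")
    case True
    obtain i where i: "i < q" "k \<le> i" "f i < s q" using trig True by auto
    have "scan s f (Suc k) M (c, f k) = scan s f (Suc q) M (Suc c, f q)"
    proof (rule scan_trigger)
      show "f k < s q \<or> (\<exists>i. Suc k \<le> i \<and> i < q \<and> f i < s q)"
        using i by (cases "i = k") auto
    qed (use that True pq quiet in auto)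
    also have "\<dots> = (Suc c + A q, Y q)" using inv pq k True by (auto simp: tables_inv_def)
    finally show ?thesis using True k by (simp add: A' Y')
  next
    case False
    then have "q = M" using pq by auto
    then have "scan s f (Suc k) M (c, f k) = (c, Min (insert (f k) (f ` {Suc k..<M})))"
      using that pq quiet by (intro scan_quiet) auto
    also have "insert (f k) (f ` {Suc k..<M}) = f ` {k..<M}" using pq
      by (force simp: image_iff Suc_le_eq)
    finally show ?thesis using False k y_min by (simp add: A' Y')
  qed
  have old: "scan s f (Suc i) M (c, f i) = (c + A' i, Y' i)" if "0 < c" "k \<le> i" "i < M" for c i
  proof (cases "i = k")
    case False
    then show ?thesis using inv that k by (auto simp: tables_inv_def A' Y')
  qed (use new that in simp)
  show ?thesis unfolding tables_inv_def
    using pq quiet trig y_min old k by (auto simp: le_Suc_eq)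
qed

lemma tables_inv_done:
  assumes "tables_inv s f M 0 q y A Y"
  shows "tables s f M q A Y"
  using assms by (auto simp: tables_inv_def tables_def)

lemma tables_loop_correct:
  assumes p0: "ivar m0 ''p'' = M" "ivar m0 ''q'' = M" "ivar m0 ''m'' = M" and o0: "ivar m0 ''o'' = o0"
    and mono: "\<And>i j. i < j \<Longrightarrow> j < M \<Longrightarrow> rarr m0 ''s'' (o0 + i) < rarr m0 ''s'' (o0 + j)"
    and fits: "o0 + M + 1 < 2 ^ w"
    and T: "2 * M * (cost tables_body + 4) + 4 \<le> T"
  shows "exec_within w tables_loop m0 T (\<lambda>m. frame tables_body m0 m \<and> ivar m ''q'' \<le> M \<and>
     tables (\<lambda>i. rarr m0 ''s'' (o0 + i)) (\<lambda>i. rarr m0 ''f'' (o0 + i)) M (ivar m ''q'')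
       (\<lambda>i. iarr m ''A'' (o0 + i)) (\<lambda>i. rarr m ''Y'' (o0 + i)) \<and>
     (\<forall>k. k < o0 \<or> o0 + M \<le> k \<longrightarrow> iarr m ''A'' k = iarr m0 ''A'' k \<and> rarr m ''Y'' k = rarr m0 ''Y'' k))"
proof -
  define s where "s = (\<lambda>i. rarr m0 ''s'' (o0 + i))"
  define f where "f = (\<lambda>i. rarr m0 ''f'' (o0 + i))"
  \<comment> \<open>The sum of the two pointers bounds the remaining rounds; it starts at
    \<open>M + M\<close>.\<close>
  define I where "I = (\<lambda>r (m :: memory). r = ivar m ''p'' + ivar m ''q'' \<and>
    tables_inv s f M (ivar m ''p'') (ivar m ''q'') (rvar m ''y'')
       (\<lambda>i. iarr m ''A'' (o0 + i)) (\<lambda>i. rarr m ''Y'' (o0 + i)) \<and>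
    (\<forall>k. k < o0 \<or> o0 + M \<le> k \<longrightarrow> iarr m ''A'' k = iarr m0 ''A'' k \<and> rarr m ''Y'' k = rarr m0 ''Y'' k))"
  have mono': "\<And>i j. i < j \<Longrightarrow> j < M \<Longrightarrow> s i < s j" using mono by (simp add: s_def)
  have "exec_within w tables_loop m0 T (\<lambda>m. \<not> bval (ILess (Num 0) (V ''p'')) m \<and>
    frame tables_body m0 m \<and> (\<exists>r'. I r' m))"
    unfolding tables_loop_def
  proof (rule exec_within_While[where r = "M + M" and C = "cost tables_body"])
    show "I (M + M) m0" using tables_inv_init by (simp add: I_def p0)
  next
    fix r m assume I: "I r m" and fr: "frame tables_body m0 m"
    let ?p = "ivar m ''p''" and ?q = "ivar m ''q''"
    note fr = frameD[OF fr]
    have [simp]: "ivar m ''o'' = o0" "ivar m ''m'' = M" "rarr m ''s'' (o0 + i) = s i"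
      "rarr m ''f'' (o0 + i) = f i" for i
      using fr by (auto simp: o0 p0 s_def f_def)
    have inv: "tables_inv s f M ?p ?q (rvar m ''y'') (\<lambda>i. iarr m ''A'' (o0 + i))
      (\<lambda>i. rarr m ''Y'' (o0 + i))"
      and r: "r = ?p + ?q" using I by (auto simp: I_def)
    have pq: "?p \<le> ?q" "?q \<le> M" using inv by (auto simp: tables_inv_def)
    have "wp w tables_body (I (r - 1)) m" if p: "0 < ?p"
    proof -
      obtain k l where kl: "?p = Suc k" "?q = Suc l" using p pq by (metis gr0_implies_Suc less_le_trans)
      show ?thesis
      proof (cases "?p < ?q \<and> f (?p - 1) < s (?q - 1)")
        case True
        then have "tables_inv s f M ?p (?q - 1) (rvar m ''y'') (\<lambda>i. iarr m ''A'' (o0 + i))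
          (\<lambda>i. rarr m ''Y'' (o0 + i))"
          using tables_inv_decr[OF inv p] by simp
        then show ?thesis using True I r pq fits by (simp add: tables_body_def I_def kl)
      next
        case False
        have qA: "?q < M \<Longrightarrow> iarr m ''A'' (o0 + ?q) \<le> M" using tables_inv_le[OF inv pq(1)] .
        note nx = tables_inv_next[OF inv p False mono' refl refl refl, unfolded fun_upd_def kl]
        have out: "\<forall>j. j < o0 \<or> o0 + M \<le> j \<longrightarrow> j \<noteq> o0 + k" using pq kl by auto
        have F: "\<not> (k < l \<and> f k < s l)" using False kl by simp
        show ?thesis
        proof (cases "Suc l < M")
          case q: True
          show ?thesis
          proof (cases "Suc k < M \<and> \<not> f k < rvar m ''y''")
            case True
            then show ?thesis using I q pq fits qA nx out
              by (simp add: tables_body_def I_def kl r F cong: if_cong)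
          next
            case False
            then show ?thesis using I q pq fits qA nx out
              by (simp add: tables_body_def I_def kl r F cong: if_cong)
          qed
        next
          case q: False
          then have M: "M = Suc l" using pq kl by simp
          show ?thesis
          proof (cases "Suc k < M \<and> \<not> f k < rvar m ''y''")
            case True
            then show ?thesis using F I fits nx out
              by (simp add: tables_body_def I_def kl r F M cong: if_cong)
          next
            case False
            then have yF: "\<not> (k < l \<and> \<not> f k < rvar m ''y'')" and "k \<le> l" using M pq kl by auto
            then show ?thesis using F I fits nx out
              by (simp add: tables_body_def I_def kl r F M yF cong: if_cong)
          qed
        qed
      qed
    qed
    then show "bfits w (ILess (Num 0) (V ''p'')) m \<and>
      (bval (ILess (Num 0) (V ''p'')) m \<longrightarrow> 0 < r \<and>
        exec_within w tables_body m (cost tables_body) (I (r - 1)))"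
      using pq fits r by (auto intro: wp_sound)
  qed (use T in \<open>simp add: algebra_simps\<close>)
  then show ?thesis unfolding s_def[symmetric] f_def[symmetric]
  proof (rule exec_within_mono)
    fix m assume m: "\<not> bval (ILess (Num 0) (V ''p'')) m \<and> frame tables_body m0 m \<and> (\<exists>r'. I r' m)"
    then have "tables_inv s f M 0 (ivar m ''q'') (rvar m ''y'') (\<lambda>i. iarr m ''A'' (o0 + i))
      (\<lambda>i. rarr m ''Y'' (o0 + i))"
      by (auto simp: I_def)
    from tables_inv_done[OF this]
    have "tables s f M (ivar m ''q'') (\<lambda>i. iarr m ''A'' (o0 + i)) (\<lambda>i. rarr m ''Y'' (o0 + i))" .
    moreover from this have "ivar m ''q'' \<le> M" by (simp add: tables_def)
    moreover have "\<forall>k. k < o0 \<or> o0 + M \<le> k \<longrightarrow> iarr m ''A'' k = iarr m0 ''A'' k \<and>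
      rarr m ''Y'' k = rarr m0 ''Y'' k"
      using m by (auto simp: I_def)
    ultimately show "frame tables_body m0 m \<and> ivar m ''q'' \<le> M \<and>
      tables s f M (ivar m ''q'') (\<lambda>i. iarr m ''A'' (o0 + i)) (\<lambda>i. rarr m ''Y'' (o0 + i)) \<and>
      (\<forall>k. k < o0 \<or> o0 + M \<le> k \<longrightarrow> iarr m ''A'' k = iarr m0 ''A'' k \<and> rarr m ''Y'' k = rarr m0 ''Y'' k)"
      using m by blast
  qed simp
qed

lemma cost_tables_body: "cost tables_body = 63"
  by (simp add: tables_body_def)

text \<open>The factor 134 is 2 * (63 + 4): two rounds per position, each with 63 steps for the body
  and 4 for the loop test.\<close>

lemma make_tables_correct:
  assumes b: "ivar m0 ''b'' = b" and W: "ivar m0 ''W'' = W" and M: "iarr m0 ''z'' b = M"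
    and mono: "\<And>i j. i < j \<Longrightarrow> j < M \<Longrightarrow> rarr m0 ''s'' (b * W + i) < rarr m0 ''s'' (b * W + j)"
    and fits: "b * W + M + 1 < 2 ^ w" "b < 2 ^ w" "W < 2 ^ w"
    and T: "134 * M + 30 \<le> T"
  shows "exec_within w make_tables m0 T (\<lambda>m. frame make_tables m0 m \<and>
     tables (\<lambda>i. rarr m0 ''s'' (b * W + i)) (\<lambda>i. rarr m0 ''f'' (b * W + i)) M (iarr m ''N'' b)
       (\<lambda>i. iarr m ''A'' (b * W + i)) (\<lambda>i. rarr m ''Y'' (b * W + i)) \<and>
     (\<forall>b'. b' \<noteq> b \<longrightarrow> iarr m ''N'' b' = iarr m0 ''N'' b') \<and>
     (\<forall>k. k < b * W \<or> b * W + M \<le> k \<longrightarrow>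
        iarr m ''A'' k = iarr m0 ''A'' k \<and> rarr m ''Y'' k = rarr m0 ''Y'' k))"
    (is "exec_within _ _ _ _ (\<lambda>m. frame make_tables m0 m \<and> ?P m)")
proof -
  let ?m = "m0\<lparr>ivar := (ivar m0)(''o'' := b * W, ''m'' := M, ''p'' := M, ''q'' := M)\<rparr>"
  have 1: "exec_within w (select_block ;; IAssign ''p'' (V ''m'') ;;
    IAssign ''q'' (V ''m'')) m0 11 (\<lambda>m. m = ?m)"
    by (rule exec_within_wp) (use fits in \<open>simp_all add: select_block_def b W M\<close>)
  have "exec_within w make_tables m0 T ?P"
    unfolding make_tables_def
  proof (rule exec_within_Seq[OF 1], rule exec_within_Seq)
    fix m assume m: "m = ?m"
    show "exec_within w tables_loop m (134 * M + 4) (\<lambda>m'. frame tables_body m m' \<and> ivar m' ''q'' \<le> M \<and>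
     tables (\<lambda>i. rarr m ''s'' (b * W + i)) (\<lambda>i. rarr m ''f'' (b * W + i)) M (ivar m' ''q'')
       (\<lambda>i. iarr m' ''A'' (b * W + i)) (\<lambda>i. rarr m' ''Y'' (b * W + i)) \<and>
     (\<forall>k. k < b * W \<or> b * W + M \<le> k \<longrightarrow> iarr m' ''A'' k = iarr m ''A'' k \<and>
       rarr m' ''Y'' k = rarr m ''Y'' k))"
      by (rule tables_loop_correct) (use m fits mono in \<open>auto simp: cost_tables_body\<close>)
  next
    fix m m' assume m: "m = ?m" and m': "frame tables_body m m' \<and> ivar m' ''q'' \<le> M \<and>
     tables (\<lambda>i. rarr m ''s'' (b * W + i)) (\<lambda>i. rarr m ''f'' (b * W + i)) M (ivar m' ''q'')
       (\<lambda>i. iarr m' ''A'' (b * W + i)) (\<lambda>i. rarr m' ''Y'' (b * W + i)) \<and>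
     (\<forall>k. k < b * W \<or> b * W + M \<le> k \<longrightarrow> iarr m' ''A'' k = iarr m ''A'' k \<and>
       rarr m' ''Y'' k = rarr m ''Y'' k)"
    then have fr: "frame tables_body m m'" by simp
    have "ivar m' ''b'' = b" "iarr m' ''N'' = iarr m0 ''N''"
      using frameD[OF fr] m b by simp_all
    then show "exec_within w (IStore ''N'' (V ''b'') (V ''q'')) m' 3 ?P"
      by (intro exec_within_wp) (use fits m m' in auto)
  qed (use T in auto)
  then show ?thesis by (rule exec_within_frame)
qed

section \<open>The memory read as lists of intervals\<close>

definition blk :: "nat \<Rightarrow> memory \<Rightarrow> nat \<Rightarrow> interval list" where
  "blk W m b = map (\<lambda>i. (rarr m ''s'' (b * W + i), rarr m ''f'' (b * W + i))) [0..<iarr m ''z'' b]"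

definition contents :: "nat \<Rightarrow> nat \<Rightarrow> memory \<Rightarrow> interval list" where
  "contents W n m = concat (map (blk W m) [0..<n])"

definition block_tables :: "nat \<Rightarrow> memory \<Rightarrow> nat \<Rightarrow> bool" where
  "block_tables W m b \<longleftrightarrow>
     tables (\<lambda>i. rarr m ''s'' (b * W + i)) (\<lambda>i. rarr m ''f'' (b * W + i)) (iarr m ''z'' b)
       (iarr m ''N'' b) (\<lambda>i. iarr m ''A'' (b * W + i)) (\<lambda>i. rarr m ''Y'' (b * W + i))"

abbreviation start_sorted :: "interval list \<Rightarrow> bool" where
  "start_sorted \<equiv> sorted_wrt (\<lambda>i j. fst i < fst j)"

lemma length_blk [simp]: "length (blk W m b) = iarr m ''z'' b"
  by (simp add: blk_def)

lemma contents_0 [simp]: "contents W 0 m = []"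
  by (simp add: contents_def)

lemma contents_Suc: "contents W (Suc n) m = contents W n m @ blk W m n"
  by (simp add: contents_def)

lemma contents_split:
  assumes "b < n"
  shows "contents W n m = contents W b m @ blk W m b @ concat (map (blk W m) [Suc b..<n])"
proof -
  have "[0..<n] = [0..<b] @ b # [Suc b..<n]"
    using assms by (metis le_add1 less_imp_le_nat plus_nat.add_0 upt_add_eq_append upt_conv_Cons
      le_add_diff_inverse)
  then show ?thesis by (simp add: contents_def)
qed

lemma length_contents_le:
  assumes "\<forall>b<n. iarr m ''z'' b \<le> W"
  shows "length (contents W n m) \<le> n * W"
  using assms
proof (induction n)
  case (Suc n)
  then have "length (contents W n m) \<le> n * W" "iarr m ''z'' n \<le> W" by auto
  then show ?case by (simp add: contents_Suc)
qed simp

lemma fold_step_blk: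
  "fold step (blk W m b) = scan (\<lambda>i. rarr m ''s'' (b * W + i))
    (\<lambda>i. rarr m ''f'' (b * W + i)) 0 (iarr m ''z'' b)"
  by (simp add: blk_def scan_def fold_map comp_def fun_eq_iff)

lemma blk_mono:
  assumes "start_sorted (contents W n m)" "b < n" "i < j" "j < iarr m ''z'' b"
  shows "rarr m ''s'' (b * W + i) < rarr m ''s'' (b * W + j)"
proof -
  have "start_sorted (blk W m b)"
    using assms(1) unfolding contents_split[OF assms(2)] by (simp add: sorted_wrt_append)
  then show ?thesis using assms(3,4) by (auto simp: sorted_wrt_iff_nth_less blk_def)
qed

section \<open>Answering by binary search in the blocks\<close>

definition search_body :: com where
  "search_body =
     IAssign ''h'' (Div (Add (V ''i'') (V ''j'')) (Num 2)) ;;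
     Cond (RLess (RVar ''x'') (RArr ''s'' (oadd (V ''h''))))
       (IAssign ''j'' (V ''h''))
       (IAssign ''i'' (Add (V ''h'') (Num 1)))"

definition search_loop :: com where
  "search_loop = While (ILess (V ''i'') (V ''j'')) search_body"

lemma search_body_mods [simp]:
  "mod_ivars search_body = {''h'', ''i'', ''j''}" "mod_rvars search_body = {}"
  "mod_iarrs search_body = {}" "mod_rarrs search_body = {}"
  by (auto simp: search_body_def)

lemma cost_search_body: "cost search_body = 17"
  by (simp add: search_body_def)

text \<open>The remaining range is kept below a power of two whose exponent drops in every round, so
  \<open>L\<close> rounds suffice. The factor 21 is 17 for the body plus 4 for the loop
  test.\<close>

lemma search_loop_correct:
  assumes ij: "ivar m0 ''i'' = 0" "ivar m0 ''j'' = n" "n \<le> M" and o0: "ivar m0 ''o'' = o0"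
    and mono: "\<And>i j. i < j \<Longrightarrow> j < M \<Longrightarrow> rarr m0 ''s'' (o0 + i) < rarr m0 ''s'' (o0 + j)"
    and fits: "o0 + 2 * M + 2 < 2 ^ w"
    and L: "n < 2 ^ L" "21 * L + 4 \<le> T"
  shows "exec_within w search_loop m0 T (\<lambda>m. frame search_body m0 m \<and> ivar m ''i'' \<le> n \<and>
     (\<forall>k<ivar m ''i''. \<not> rvar m0 ''x'' < rarr m0 ''s'' (o0 + k)) \<and>
     (ivar m ''i'' < n \<longrightarrow> rvar m0 ''x'' < rarr m0 ''s'' (o0 + ivar m ''i'')))"
proof -
  define s where "s = (\<lambda>i. rarr m0 ''s'' (o0 + i))"
  define x where "x = rvar m0 ''x''"
  define I where "I = (\<lambda>r (m :: memory). ivar m ''i'' \<le> ivar m ''j'' \<and> ivar m ''j'' \<le> n \<and>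
    (\<forall>k<ivar m ''i''. \<not> x < s k) \<and> (ivar m ''j'' < n \<longrightarrow> x < s (ivar m ''j'')) \<and>
    ivar m ''j'' - ivar m ''i'' < 2 ^ r)"
  have "exec_within w search_loop m0 T
      (\<lambda>m. \<not> bval (ILess (V ''i'') (V ''j'')) m \<and> frame search_body m0 m \<and> (\<exists>r'. I r' m))"
    unfolding search_loop_def
  proof (rule exec_within_While[where r = L and C = "cost search_body"])
    show "I L m0" using L by (simp add: I_def ij)
  next
    fix r m assume I: "I r m" and fr: "frame search_body m0 m"
    let ?i = "ivar m ''i''" and ?j = "ivar m ''j''"
    let ?h = "(?i + ?j) div 2"
    note fr = frameD[OF fr]
    have [simp]: "ivar m ''o'' = o0" "rarr m ''s'' (o0 + i) = s i" "rvar m ''x'' = x" for i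
      using fr by (auto simp: o0 s_def x_def)
    have le: "?i \<le> ?j" "?j \<le> M" using I ij by (auto simp: I_def)
    have "0 < r \<and> wp w search_body (I (r - 1)) m" if lt: "?i < ?j"
    proof -
      have r: "0 < r" using I lt by (cases r) (auto simp: I_def)
      then obtain k where k: "r = Suc k" by (cases r) auto
      have h: "?i \<le> ?h" "?h < ?j" "?j - Suc ?h < 2 ^ k" "?h - ?i < 2 ^ k"
        using I lt by (auto simp: I_def k)
      have "\<not> x < s l" if "\<not> x < s ?h" "l < Suc ?h" for l
        using that mono[of l ?h] h le by (cases "l = ?h") (auto simp: s_def)
      then have "wp w search_body (I (r - 1)) m"
        using I h le fits by (auto simp: search_body_def I_def k)
      with r show ?thesis by simp
    qed
    then show "bfits w (ILess (V ''i'') (V ''j'')) m \<and>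
      (bval (ILess (V ''i'') (V ''j'')) m \<longrightarrow> 0 < r \<and>
        exec_within w search_body m (cost search_body) (I (r - 1)))"
      using le fits by (auto intro: wp_sound)
  qed (use L in \<open>simp add: cost_search_body\<close>)
  then show ?thesis
  proof (rule exec_within_mono)
    fix m assume m: "\<not> bval (ILess (V ''i'') (V ''j'')) m \<and> frame search_body m0 m \<and> (\<exists>r'. I r' m)"
    then have "ivar m ''i'' = ivar m ''j''" by (auto simp: I_def)
    with m show "frame search_body m0 m \<and> ivar m ''i'' \<le> n \<and>
     (\<forall>k<ivar m ''i''. \<not> rvar m0 ''x'' < rarr m0 ''s'' (o0 + k)) \<and>
     (ivar m ''i'' < n \<longrightarrow> rvar m0 ''x'' < rarr m0 ''s'' (o0 + ivar m ''i''))"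
      by (auto simp: I_def s_def x_def)
  qed simp
qed

text \<open>With count zero the search range is made empty, so the search ends at position 0, the
  interval that \<open>step\<close> then selects unconditionally.\<close>

definition skip_block :: com where
  "skip_block =
     (IAssign ''i'' (Num 0) ;;
      Cond (ILess (Num 0) (V ''answer'')) (IAssign ''j'' (IArr ''N'' (V ''b'')))
        (IAssign ''j'' (Num 0))) ;;
     search_loop ;;
     Cond (ILess (V ''i'') (V ''m''))
       (RAssign ''x'' (RArr ''Y'' (oadd (V ''i''))) ;;
        IAssign ''answer'' (Add (Add (V ''answer'') (IArr ''A'' (oadd (V ''i'')))) (Num 1)))
       (Cond (RLess (RArr ''Y'' (V ''o'')) (RVar ''x'')) (RAssign ''x'' (RArr ''Y'' (V ''o''))) Skip)"

text \<open>Empty blocks are passed over since they have no entry \<open>Y 0\<close>, which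
  \<open>skip_block\<close> would otherwise compare with the current finish.\<close>

definition answer_body :: com where
  "answer_body =
     select_block ;;
     Cond (ILess (Num 0) (V ''m'')) skip_block Skip ;;
     IAssign ''b'' (Add (V ''b'') (Num 1))"

definition compute_answer :: com where
  "compute_answer =
     (IAssign ''answer'' (Num 0) ;; IAssign ''b'' (Num 0)) ;;
     While (ILess (V ''b'') (V ''J'')) answer_body"

lemma skip_block_mods [simp]:
  "mod_ivars skip_block = {''h'', ''i'', ''j'', ''answer''}" "mod_rvars skip_block = {''x''}"
  "mod_iarrs skip_block = {}" "mod_rarrs skip_block = {}"
  by (auto simp: skip_block_def search_loop_def)

lemma answer_body_mods [simp]:
  "mod_ivars answer_body = {''o'', ''m'', ''b'', ''h'', ''i'', ''j'', ''answer''}"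
    "mod_rvars answer_body = {''x''}"
  "mod_iarrs answer_body = {}" "mod_rarrs answer_body = {}"
  by (auto simp: answer_body_def select_block_def)

lemma compute_answer_mods [simp]:
  "mod_ivars compute_answer = {''o'', ''m'', ''b'', ''h'', ''i'', ''j'', ''answer''}"
    "mod_rvars compute_answer = {''x''}"
  "mod_iarrs compute_answer = {}" "mod_rarrs compute_answer = {}"
  by (auto simp: compute_answer_def)

lemma skip_block_correct:
  assumes b: "ivar m0 ''b'' = b" "b < 2 ^ w" and m: "ivar m0 ''m'' = M"
    "0 < M" and o0: "ivar m0 ''o'' = o0"
    and mono: "\<And>i j. i < j \<Longrightarrow> j < M \<Longrightarrow> rarr m0 ''s'' (o0 + i) < rarr m0 ''s'' (o0 + j)"
    and tab: "tables (\<lambda>i. rarr m0 ''s'' (o0 + i)) (\<lambda>i. rarr m0 ''f'' (o0 + i)) M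
       (iarr m0 ''N'' b) (\<lambda>i. iarr m0 ''A'' (o0 + i)) (\<lambda>i. rarr m0 ''Y'' (o0 + i))"
    and fits: "o0 + 2 * M + 2 < 2 ^ w" "ivar m0 ''answer'' + M + 2 < 2 ^ w"
    and L: "M < 2 ^ L" "21 * L + 40 \<le> T"
  shows "exec_within w skip_block m0 T (\<lambda>m. (ivar m ''answer'', rvar m ''x'') =
     scan (\<lambda>i. rarr m0 ''s'' (o0 + i))
       (\<lambda>i. rarr m0 ''f'' (o0 + i)) 0 M (ivar m0 ''answer'', rvar m0 ''x''))"
proof -
  define s where "s = (\<lambda>i. rarr m0 ''s'' (o0 + i))"
  define f where "f = (\<lambda>i. rarr m0 ''f'' (o0 + i))"
  define N where "N = iarr m0 ''N'' b"
  define A where "A = (\<lambda>i. iarr m0 ''A'' (o0 + i))"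
  define Y where "Y = (\<lambda>i. rarr m0 ''Y'' (o0 + i))"
  define x where "x = rvar m0 ''x''"
  define c where "c = ivar m0 ''answer''"
  define n where "n = (if 0 < c then N else 0)"
  note defs = s_def f_def N_def A_def Y_def x_def c_def
  have tab: "tables s f M N A Y" using tab by (simp add: defs)
  have nM: "n \<le> M" "N \<le> M" using tab by (auto simp: tables_def n_def)
  have A: "A i \<le> M" if "i < M" for i
  proof -
    have "scan s f (Suc i) M (1, f i) = (1 + A i, Y i)" using tab that by (auto simp: tables_def)
    then show ?thesis using fst_scan_le[of s f "Suc i" M "(1, f i)"] that by simp
  qed
  let ?m = "m0\<lparr>ivar := (ivar m0)(''i'' := 0, ''j'' := n)\<rparr>"
  have 1: "exec_within w (IAssign ''i'' (Num 0) ;;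
      Cond (ILess (Num 0) (V ''answer'')) (IAssign ''j'' (IArr ''N'' (V ''b'')))
        (IAssign ''j'' (Num 0)))
      m0 9 (\<lambda>m. m = ?m)"
    by (rule exec_within_wp) (use fits b nM in \<open>auto simp: n_def N_def c_def\<close>)
  show ?thesis unfolding skip_block_def s_def[symmetric] f_def[symmetric] x_def[symmetric]
    c_def[symmetric]
  proof (rule exec_within_Seq[OF 1], rule exec_within_Seq)
    fix m assume "m = ?m"
    then show "exec_within w search_loop m (21 * L + 4) (\<lambda>m'. frame search_body m m' \<and>
      ivar m' ''i'' \<le> n \<and>
       (\<forall>k<ivar m' ''i''. \<not> rvar m ''x'' < rarr m ''s'' (o0 + k)) \<and>
       (ivar m' ''i'' < n \<longrightarrow> rvar m ''x'' < rarr m ''s'' (o0 + ivar m' ''i'')))"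
      by (intro search_loop_correct[where M = M and L = L]) (use nM mono o0 L fits in auto)
  next
    fix m m' assume m: "m = ?m" and m': "frame search_body m m' \<and> ivar m' ''i'' \<le> n \<and>
       (\<forall>k<ivar m' ''i''. \<not> rvar m ''x'' < rarr m ''s'' (o0 + k)) \<and>
       (ivar m' ''i'' < n \<longrightarrow> rvar m ''x'' < rarr m ''s'' (o0 + ivar m' ''i''))"
    then have fr: "frame search_body m m'" by simp
    let ?p = "ivar m' ''i''"
    have p: "?p \<le> n" "\<And>k. k < ?p \<Longrightarrow> \<not> x < s k" "?p < n \<Longrightarrow> x < s ?p"
      using m m' by (auto simp: x_def s_def)
    have [simp]: "ivar m' ''m'' = M" "ivar m' ''o'' = o0" "ivar m' ''answer'' = c" "rvar m' ''x'' = x"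
      "iarr m' ''A'' (o0 + k) = A k" "rarr m' ''Y'' (o0 + k) = Y k" "rarr m' ''Y'' o0 = Y 0" for k
      using frameD[OF fr] m assms(3,4) o0 by (simp_all add: defs)
    show "exec_within w
      (Cond (ILess (V ''i'') (V ''m''))
       (RAssign ''x'' (RArr ''Y'' (oadd (V ''i''))) ;;
        IAssign ''answer'' (Add (Add (V ''answer'') (IArr ''A'' (oadd (V ''i'')))) (Num 1)))
       (Cond (RLess (RArr ''Y'' (V ''o'')) (RVar ''x'')) (RAssign ''x'' (RArr ''Y'' (V ''o''))) Skip))
      m' 19 (\<lambda>m. (ivar m ''answer'', rvar m ''x'') = scan s f 0 M (c, x))"
    proof (rule exec_within_wp)
      have fits': "c + M + 2 < 2 ^ w" using fits by (simp add: c_def)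
      show "wp w (Cond (ILess (V ''i'') (V ''m''))
       (RAssign ''x'' (RArr ''Y'' (oadd (V ''i''))) ;;
        IAssign ''answer'' (Add (Add (V ''answer'') (IArr ''A'' (oadd (V ''i'')))) (Num 1)))
       (Cond (RLess (RArr ''Y'' (V ''o'')) (RVar ''x'')) (RAssign ''x'' (RArr ''Y'' (V ''o''))) Skip))
       (\<lambda>m. (ivar m ''answer'', rvar m ''x'') = scan s f 0 M (c, x)) m'"
      proof (cases "?p < M")
        case True
        have "scan s f 0 M (c, x) = (Suc (c + A ?p), Y ?p)"
        proof (cases "0 < c")
          case c: True
          then show ?thesis using tables_select[OF tab c _ True] p by (auto simp: n_def)
        next
          case False
          then show ?thesis using tables_start[OF tab assms(4)] p by (auto simp: n_def)
        qed
        then show ?thesis using True fits fits' A[OF True] p nM by auto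
      next
        case False
        \<comment> \<open>The search never goes beyond \<open>N\<close>, so a result outside the
          block means that the block is quiet by itself and also with respect to
          \<open>x\<close>.\<close>
        then have "0 < c" "N = M" "?p = M" using p nM assms(4) by (auto simp: n_def split: if_splits)
        then have "scan s f 0 M (c, x) = (c, min x (Y 0))"
          using tables_keep[of s f M A Y c x] tab p assms(4) by auto
        then show ?thesis using False fits fits' p nM by (auto simp: min_def)
      qed
    qed simp
  qed (use L in auto)
qed

lemma answer_body_correct:
  assumes b: "ivar m0 ''b'' = b" and W: "ivar m0 ''W'' = W" and M: "iarr m0 ''z'' b = M"
    and mono: "\<And>i j. i < j \<Longrightarrow> j < M \<Longrightarrow> rarr m0 ''s'' (b * W + i) < rarr m0 ''s'' (b * W + j)"
    and tab: "block_tables W m0 b"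
    and fits: "b * W + 2 * M + 2 < 2 ^ w" "ivar m0 ''answer'' + M + 2 < 2 ^ w" "b + 1 < 2 ^ w"
      "W < 2 ^ w"
    and L: "M < 2 ^ L" "21 * L + 60 \<le> T"
  shows "exec_within w answer_body m0 T (\<lambda>m. ivar m ''b'' = b + 1 \<and>
     (ivar m ''answer'', rvar m ''x'') = fold step (blk W m0 b) (ivar m0 ''answer'', rvar m0 ''x''))"
proof -
  let ?m = "m0\<lparr>ivar := (ivar m0)(''o'' := b * W, ''m'' := M)\<rparr>"
  let ?r = "fold step (blk W m0 b) (ivar m0 ''answer'', rvar m0 ''x'')"
  have 1: "exec_within w select_block m0 7 (\<lambda>m. m = ?m)"
    by (rule exec_within_wp) (use fits in \<open>auto simp: select_block_def b W M\<close>)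
  show ?thesis unfolding answer_body_def
  proof (rule exec_within_Seq[OF 1], rule exec_within_Seq)
    fix m assume m: "m = ?m"
    show "exec_within w (Cond (ILess (Num 0) (V ''m'')) skip_block Skip) m (21 * L + 44)
       (\<lambda>m'. ivar m' ''b'' = b \<and> (ivar m' ''answer'', rvar m' ''x'') = ?r)"
    proof (rule exec_within_Cond)
      assume "bval (ILess (Num 0) (V ''m'')) m"
      then have M0: "0 < M" using m by simp
      have "exec_within w skip_block m (21 * L + 40) (\<lambda>m'. (ivar m' ''answer'', rvar m' ''x'') =
        scan (\<lambda>i. rarr m ''s'' (b * W + i))
          (\<lambda>i. rarr m ''f'' (b * W + i)) 0 M (ivar m ''answer'', rvar m ''x''))"
        by (rule skip_block_correct[where b = b and L = L])
          (use m b M0 mono fits L tab[unfolded block_tables_def M] in auto)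
      from exec_within_frame[OF this] show "exec_within w skip_block m (21 * L + 40)
         (\<lambda>m'. ivar m' ''b'' = b \<and> (ivar m' ''answer'', rvar m' ''x'') = ?r)"
        by (rule exec_within_mono) (auto simp: m b M fold_step_blk dest: frameD(1)[where x = "''b''"])
    next
      assume "\<not> bval (ILess (Num 0) (V ''m'')) m"
      then have "blk W m0 b = []" using m M by (simp add: blk_def)
      then show "exec_within w Skip m (21 * L + 40)
         (\<lambda>m'. ivar m' ''b'' = b \<and> (ivar m' ''answer'', rvar m' ''x'') = ?r)"
        by (intro exec_within_wp) (use m b in auto)
    qed (use m fits in auto)
  next
    fix m :: memory assume "ivar m ''b'' = b \<and> (ivar m ''answer'', rvar m ''x'') = ?r"
    then show "exec_within w (IAssign ''b'' (Add (V ''b'') (Num 1))) m 4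
        (\<lambda>m. ivar m ''b'' = b + 1 \<and> (ivar m ''answer'', rvar m ''x'') = ?r)"
      by (intro exec_within_wp) (use fits in auto)
  qed (use L in auto)
qed

lemma compute_answer_correct:
  assumes J: "ivar m0 ''J'' = J" and W: "ivar m0 ''W'' = W"
    and sorted: "start_sorted (contents W J m0)"
    and tab: "\<And>b. b < J \<Longrightarrow> block_tables W m0 b"
    and z: "\<And>b. b < J \<Longrightarrow> iarr m0 ''z'' b \<le> W"
    and fits: "J * W + 2 * W + 2 < 2 ^ w" "J + 1 < 2 ^ w"
    and L: "W < 2 ^ L" "J * (21 * L + 64) + 10 \<le> T"
  shows "exec_within w compute_answer m0 T (\<lambda>m. frame compute_answer m0 m \<and>
     ivar m ''answer'' = fst (fold step (contents W J m0) (0, rvar m0 ''x'')))"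
proof -
  define I where "I = (\<lambda>r (m :: memory). ivar m ''b'' + r = J \<and>
    (ivar m ''answer'', rvar m ''x'') = fold step (contents W (ivar m ''b'') m0) (0, rvar m0 ''x''))"
  have 1: "exec_within w (IAssign ''answer'' (Num 0) ;; IAssign ''b'' (Num 0)) m0 4
      (\<lambda>m. m = m0\<lparr>ivar := (ivar m0)(''answer'' := 0, ''b'' := 0)\<rparr>)"
    by (rule exec_within_wp) auto
  have "exec_within w compute_answer m0 T (\<lambda>m. ivar m ''answer'' = fst (fold step (contents W J m0)
    (0, rvar m0 ''x'')))"
    unfolding compute_answer_def
  proof (rule exec_within_Seq[OF 1])
    fix m1 assume m1: "m1 = m0\<lparr>ivar := (ivar m0)(''answer'' := 0, ''b'' := 0)\<rparr>"
    have "exec_within w (While (ILess (V ''b'') (V ''J'')) answer_body) m1 (J * (21 * L + 64) + 4)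
        (\<lambda>m. \<not> bval (ILess (V ''b'') (V ''J'')) m \<and> frame answer_body m1 m \<and> (\<exists>r'. I r' m))"
    proof (rule exec_within_While[where r = J and C = "21 * L + 60"])
      show "I J m1" by (simp add: I_def m1)
    next
      fix r m assume I: "I r m" and fr: "frame answer_body m1 m"
      note fr = frameD[OF fr]
      have [simp]: "ivar m ''J'' = J" "ivar m ''W'' = W" "iarr m a = iarr m0 a" "rarr m a =
        rarr m0 a" for a
        using fr by (auto simp: m1 J W)
      have blk: "blk W m b = blk W m0 b" for b by (simp add: blk_def)
      let ?b = "ivar m ''b''"
      have bJ: "?b \<le> J" using I by (auto simp: I_def)
      have "exec_within w answer_body m (21 * L + 60) (I (r - 1))" if b: "?b < J"
      proof -
        \<comment> \<open>The count never exceeds the number of intervals visited, hence adding a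
          table entry to it does not overflow.\<close>
        have "ivar m ''answer'' = fst (fold step (contents W ?b m0) (0, rvar m0 ''x''))"
          using I by (metis I_def fst_conv)
        also have "\<dots> \<le> length (contents W ?b m0)"
          using fst_fold_step_le[of "contents W ?b m0" "(0, rvar m0 ''x'')"] by simp
        also have "\<dots> \<le> ?b * W" using z b by (intro length_contents_le) auto
        finally have ans: "ivar m ''answer'' \<le> ?b * W" .
        have bW: "?b * W + W \<le> J * W" using b mult_le_mono1[of "Suc ?b" J W] by simp
        have "exec_within w answer_body m (21 * L + 60) (\<lambda>m'. ivar m' ''b'' = ?b + 1 \<and>
          (ivar m' ''answer'', rvar m' ''x'') = fold step (blk W m ?b)
            (ivar m ''answer'', rvar m ''x''))"
        proof (rule answer_body_correct[where M = "iarr m0 ''z'' ?b" and L = L])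
          show "rarr m ''s'' (?b * W + i) < rarr m ''s'' (?b * W + j)"
            if "i < j" "j < iarr m0 ''z'' ?b" for i j
            using blk_mono[OF sorted b] that by simp
          show "block_tables W m ?b" using tab[OF b] by (simp add: block_tables_def)
        qed (use z[OF b] bW ans fits L b in auto)
        then show ?thesis
          by (rule exec_within_mono) (use I b in \<open>auto simp: I_def contents_Suc blk\<close>)
      qed
      then show "bfits w (ILess (V ''b'') (V ''J'')) m \<and> (bval (ILess (V ''b'') (V ''J'')) m \<longrightarrow>
          0 < r \<and> exec_within w answer_body m (21 * L + 60) (I (r - 1)))"
        using bJ fits I by (auto simp: I_def)
    qed simp
    then show "exec_within w (While (ILess (V ''b'') (V ''J'')) answer_body) m1 (J * (21 * L + 64) + 4)
        (\<lambda>m. ivar m ''answer'' = fst (fold step (contents W J m0) (0, rvar m0 ''x'')))"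
    proof (rule exec_within_mono)
      fix m assume m: "\<not> bval (ILess (V ''b'') (V ''J'')) m \<and> frame answer_body m1 m \<and> (\<exists>r'. I r' m)"
      then have "ivar m ''J'' = J" using frameD(1)[of answer_body m1 m "''J''"] by (simp add: m1 J)
      then have "ivar m ''b'' = J" using m by (auto simp: I_def)
      then show "ivar m ''answer'' = fst (fold step (contents W J m0) (0, rvar m0 ''x''))"
        using m by (metis I_def fst_conv)
    qed simp
  qed (use L in simp)
  then show ?thesis by (rule exec_within_frame)
qed

section \<open>Updating a block\<close>

lemma scan_cong:
  assumes "\<forall>i<e. s i = s' i \<and> f i = f' i"
  shows "scan s f a e st = scan s' f' a e st"
  unfolding scan_def using assms by (intro fold_cong) auto

lemma tables_cong:
  assumes "tables s f M N A Y"
    and "\<forall>i<M. s i = s' i \<and> f i = f' i \<and> A i = A' i \<and> Y i = Y' i"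
  shows "tables s' f' M N A' Y'"
proof -
  have "scan s f a M st = scan s' f' a M st" for a st
    using assms(2) by (intro scan_cong) auto
  moreover have "s' i = s i" "f' i = f i" "A' i = A i" "Y' i = Y i" if "i < M" for i
    using assms(2) that by auto
  ultimately show ?thesis using assms(1) unfolding tables_def by (simp cong: conj_cong)
qed

text \<open>Only the first \<open>z[b]\<close> cells are compared: the remaining cells of a block
  may hold stale data.\<close>

definition same_block :: "nat \<Rightarrow> memory \<Rightarrow> memory \<Rightarrow> nat \<Rightarrow> bool" where
  "same_block W m m' b \<longleftrightarrow> iarr m' ''z'' b = iarr m ''z'' b \<and> iarr m' ''N'' b = iarr m ''N'' b \<and>
     (\<forall>i<iarr m ''z'' b. rarr m' ''s'' (b * W + i) = rarr m ''s'' (b * W + i) \<and>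
        rarr m' ''f'' (b * W + i) = rarr m ''f'' (b * W + i) \<and>
        rarr m' ''Y'' (b * W + i) = rarr m ''Y'' (b * W + i) \<and>
        iarr m' ''A'' (b * W + i) = iarr m ''A'' (b * W + i))"

lemma same_block_blk: "same_block W m m' b \<Longrightarrow> blk W m' b = blk W m b"
  by (simp add: same_block_def blk_def)

lemma same_block_tables: "same_block W m m' b \<Longrightarrow> block_tables W m b \<Longrightarrow> block_tables W m' b"
  unfolding block_tables_def same_block_def by (auto elim!: tables_cong)

lemma block_outside:
  fixes b b' W i :: nat
  assumes "b' \<noteq> b" "i < W"
  shows "b' * W + i < b * W \<or> b * W + W \<le> b' * W + i"
proof (cases "b' < b")
  case True
  then have "Suc b' * W \<le> b * W" by (intro mult_le_mono1) simp
  then show ?thesis using assms by simp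
next
  case False
  then have "Suc b * W \<le> b' * W" using assms by (intro mult_le_mono1) simp
  then show ?thesis by simp
qed

lemma contents_cong:
  assumes "\<And>b. b < n \<Longrightarrow> blk W m' b = blk W m b"
  shows "contents W n m' = contents W n m"
  unfolding contents_def using assms by (intro arg_cong[where f = concat] map_cong) auto

section \<open>Locating the block for a given start\<close>

definition find_cond :: bexp where
  "find_cond = BAnd (ILess (Add (V ''b'') (Num 1)) (V ''J''))
     (BNot (BAnd (ILess (Num 0) (IArr ''z'' (V ''b'')))
       (BNot (RLess (RArr ''s'' (Add (Mul (V ''b'') (V ''W'')) (Sub (IArr ''z'' (V ''b'')) (Num 1))))
          (RVar ''start'')))))"

definition find_block :: com where
  "find_block = IAssign ''b'' (Num 0) ;; While find_cond (IAssign ''b'' (Add (V ''b'') (Num 1)))"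

text \<open>Both bounds are strict. Hence an interval with the given start, if there is one, lies in
  the block found, and the same search serves insertion and deletion. The loop stops at the last
  block at the latest, where the second bound is vacuous.\<close>

lemma find_block_correct:
  assumes J: "ivar m0 ''J'' = J" "0 < J" and W: "ivar m0 ''W'' = W"
    and sorted: "start_sorted (contents W J m0)"
    and z: "\<And>b. b < J \<Longrightarrow> iarr m0 ''z'' b \<le> W"
    and fits: "J * W + 2 * W + 2 < 2 ^ w" "J + 1 < 2 ^ w"
    and T: "J * 30 + 30 \<le> T"
  shows "exec_within w find_block m0 T (\<lambda>m. frame find_block m0 m \<and> ivar m ''b'' < J \<and>
     (\<forall>i\<in>set (contents W (ivar m ''b'') m0). fst i < rvar m0 ''start'') \<and>
     (\<forall>i\<in>set (concat (map (blk W m0) [Suc (ivar m ''b'')..<J])). rvar m0 ''start'' < fst i))"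
    (is "exec_within _ _ _ _ (\<lambda>m. frame find_block m0 m \<and> ?P m)")
proof -
  let ?c = "IAssign ''b'' (Add (V ''b'') (Num 1))"
  define x where "x = rvar m0 ''start''"
  define I where "I = (\<lambda>r (m :: memory). Suc (ivar m ''b'') + r = J \<and>
    (\<forall>i\<in>set (contents W (ivar m ''b'') m0). fst i < x))"
  have 1: "exec_within w (IAssign ''b'' (Num 0)) m0 2 (\<lambda>m. m = m0\<lparr>ivar := (ivar m0)(''b'' := 0)\<rparr>)"
    by (rule exec_within_wp) auto
  have "exec_within w find_block m0 T ?P"
    unfolding find_block_def
  proof (rule exec_within_Seq[OF 1])
    fix m1 assume m1: "m1 = m0\<lparr>ivar := (ivar m0)(''b'' := 0)\<rparr>"
    have ev: "bfits w find_cond m \<and> (bval find_cond m \<longleftrightarrow> Suc (ivar m ''b'') < J \<and>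
        \<not> (0 < iarr m0 ''z'' (ivar m ''b'') \<and>
           \<not> rarr m0 ''s'' (ivar m ''b'' * W + (iarr m0 ''z'' (ivar m ''b'') - 1)) < x))"
      if I: "I r m" and fr: "frame ?c m1 m" for r m
    proof -
      let ?b = "ivar m ''b''"
      note fr = frameD[OF fr]
      have [simp]: "ivar m ''J'' = J" "ivar m ''W'' = W" "iarr m a = iarr m0 a" "rarr m a = rarr m0 a"
        "rvar m ''start'' = x" for a
        using fr by (auto simp: m1 J W x_def)
      have b: "?b < J" using I by (auto simp: I_def)
      have bW: "?b * W + W \<le> J * W" using b mult_le_mono1[of "Suc ?b" J W] by simp
      \<comment> \<open>Conjunctions evaluate both sides. In an empty block truncated subtraction
        turns the address of the last interval into \<open>b * W\<close>, so the access stays within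
        the word bound.\<close>
      show ?thesis using b bW z[OF b] fits by (auto simp: find_cond_def)
    qed
    have "exec_within w (While find_cond ?c) m1 (J * 30 + 24)
        (\<lambda>m. \<not> bval find_cond m \<and> frame ?c m1 m \<and> (\<exists>r'. I r' m))"
    proof (rule exec_within_While[where r = "J - 1" and C = 4])
      show "I (J - 1) m1" using J by (simp add: I_def m1)
    next
      fix r m assume I: "I r m" and fr: "frame ?c m1 m"
      let ?b = "ivar m ''b''"
      have "0 < r \<and> exec_within w ?c m 4 (I (r - 1))" if "bval find_cond m"
      proof -
        have c: "Suc ?b < J" "0 < iarr m0 ''z'' ?b \<Longrightarrow> rarr m0 ''s'' (?b * W + (iarr m0 ''z'' ?b - 1))
          < x"
          using ev[OF I fr] that by auto
        have "fst i < x" if "i \<in> set (blk W m0 ?b)" for i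
        proof -
          obtain k where k: "k < iarr m0 ''z'' ?b" "fst i = rarr m0 ''s'' (?b * W + k)"
            using \<open>i \<in> _\<close> by (auto simp: blk_def)
          obtain n where n: "iarr m0 ''z'' ?b = Suc n" using k by (cases "iarr m0 ''z'' ?b") auto
          then have "k = n \<or> rarr m0 ''s'' (?b * W + k) < rarr m0 ''s'' (?b * W + n)"
            using blk_mono[OF sorted, of ?b k n] c(1) k by (cases "k = n") auto
          then show ?thesis using c(2) k n by auto
        qed
        then have "wp w ?c (I (r - 1)) m"
          using I c(1) fits by (auto simp: I_def contents_Suc)
        then show ?thesis using I c(1) by (auto simp: I_def intro: exec_within_wp)
      qed
      then show "bfits w find_cond m \<and> (bval find_cond m \<longrightarrow> 0 < r \<and> exec_within w ?c m 4 (I (r - 1)))"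
        using ev[OF I fr] by auto
    qed (use J in \<open>simp add: find_cond_def algebra_simps\<close>)
    then show "exec_within w (While find_cond ?c) m1 (J * 30 + 24) ?P"
    proof (rule exec_within_mono)
      fix m assume m: "\<not> bval find_cond m \<and> frame ?c m1 m \<and> (\<exists>r'. I r' m)"
      let ?b = "ivar m ''b''"
      from m obtain r where I: "I r m" and fr: "frame ?c m1 m" by auto
      have b: "?b < J" using I by (auto simp: I_def)
      have "x < fst i" if i: "i \<in> set (concat (map (blk W m0) [Suc ?b..<J]))" for i
      proof -
        have "Suc ?b < J" using i by (cases "Suc ?b < J") auto
        then have c: "0 < iarr m0 ''z'' ?b" "\<not> rarr m0 ''s'' (?b * W + (iarr m0 ''z'' ?b - 1)) < x"
          using ev[OF I fr] m by auto
        obtain n where n: "iarr m0 ''z'' ?b = Suc n" using c by (cases "iarr m0 ''z'' ?b") auto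
        define l where "l = (rarr m0 ''s'' (?b * W + n), rarr m0 ''f'' (?b * W + n))"
        have "l \<in> set (blk W m0 ?b)" by (auto simp: blk_def l_def n)
        then have "fst l < fst i"
          using sorted i unfolding contents_split[OF b] sorted_wrt_append by blast
        then show ?thesis using c n by (simp add: l_def)
      qed
      then show "?P m" using I b by (auto simp: I_def x_def)
    qed simp
  qed (use T in auto)
  then show ?thesis by (rule exec_within_frame)
qed

section \<open>Insertion into a block\<close>

definition insert_cond :: bexp where
  "insert_cond = BAnd (ILess (Num 0) (V ''i'')) (RLess (RVar ''start'')
    (RArr ''s'' (oadd (Sub (V ''i'') (Num 1)))))"

definition insert_body :: com where
  "insert_body =
     RStore ''s'' (oadd (V ''i'')) (RArr ''s'' (oadd (Sub (V ''i'') (Num 1)))) ;;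
     RStore ''f'' (oadd (V ''i'')) (RArr ''f'' (oadd (Sub (V ''i'') (Num 1)))) ;;
     IAssign ''i'' (Sub (V ''i'') (Num 1))"

definition insert_block :: com where
  "insert_block =
     (select_block ;; IAssign ''i'' (V ''m'')) ;;
     While insert_cond insert_body ;;
     (RStore ''s'' (oadd (V ''i'')) (RVar ''start'') ;;
      RStore ''f'' (oadd (V ''i'')) (RVar ''finish'') ;;
      IStore ''z'' (V ''b'') (Add (V ''m'') (Num 1)))"

lemma insert_block_mods [simp]:
  "mod_ivars insert_block = {''o'', ''m'', ''i''}" "mod_rvars insert_block = {}"
  "mod_iarrs insert_block = {''z''}" "mod_rarrs insert_block = {''s'', ''f''}"
  by (auto simp: insert_block_def insert_body_def select_block_def)

lemma insert_body_mods [simp]: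
  "mod_ivars insert_body = {''i''}" "mod_rvars insert_body = {}" "mod_iarrs insert_body = {}"
    "mod_rarrs insert_body = {''s'', ''f''}"
  by (auto simp: insert_body_def)

text \<open>A round of insertion sort. The position \<open>p\<close> is described by the comparisons
  made; that the result is sorted follows in \<open>start_sorted_insert\<close>, where the new start
  is known to differ from all others.\<close>

lemma insert_block_correct:
  assumes b: "ivar m0 ''b'' = b" and W: "ivar m0 ''W'' = W" and M: "iarr m0 ''z'' b = M"
    and fits: "b * W + M + 2 < 2 ^ w" "b < 2 ^ w" "W < 2 ^ w"
    and T: "M * 40 + 50 \<le> T"
  shows "exec_within w insert_block m0 T (\<lambda>m. frame insert_block m0 m \<and>
     (\<exists>p\<le>M. blk W m b = take p (blk W m0 b) @ (rvar m0 ''start'', rvar m0 ''finish'') # drop p (blk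
       W m0 b) \<and>
        (0 < p \<longrightarrow> \<not> rvar m0 ''start'' < rarr m0 ''s'' (b * W + (p - 1))) \<and>
        (\<forall>i\<in>set (drop p (blk W m0 b)). rvar m0 ''start'' < fst i)) \<and>
     iarr m ''z'' = (iarr m0 ''z'')(b := Suc M) \<and>
     (\<forall>k. k < b * W \<or> b * W + M < k \<longrightarrow>
        rarr m ''s'' k = rarr m0 ''s'' k \<and> rarr m ''f'' k = rarr m0 ''f'' k))"
    (is "exec_within _ _ _ _ (\<lambda>m. frame insert_block m0 m \<and> ?P m)")
proof -
  define x where "x = rvar m0 ''start''"
  define s where "s = (\<lambda>i. rarr m0 ''s'' (b * W + i))"
  define f where "f = (\<lambda>i. rarr m0 ''f'' (b * W + i))"
  \<comment> \<open>Cell \<open>r\<close> is the gap: its old value is still in place, but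
    everything from \<open>r\<close> on has already been copied one cell up.\<close>
  define I where "I = (\<lambda>r (m :: memory). r = ivar m ''i'' \<and> r \<le> M \<and>
    (\<forall>k\<le>r. rarr m ''s'' (b * W + k) = s k \<and> rarr m ''f'' (b * W + k) = f k) \<and>
    (\<forall>k<M. r \<le> k \<longrightarrow> x < s k \<and> rarr m ''s'' (b * W + Suc k) = s k \<and> rarr m ''f'' (b * W + Suc k) = f k) \<and>
    (\<forall>k. k < b * W \<or> b * W + M < k \<longrightarrow>
        rarr m ''s'' k = rarr m0 ''s'' k \<and> rarr m ''f'' k = rarr m0 ''f'' k))"
  let ?m = "m0\<lparr>ivar := (ivar m0)(''o'' := b * W, ''m'' := M, ''i'' := M)\<rparr>"
  have 1: "exec_within w (select_block ;; IAssign ''i'' (V ''m'')) m0 9 (\<lambda>m. m = ?m)"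
    by (rule exec_within_wp) (use fits in \<open>auto simp: select_block_def b W M\<close>)
  have "exec_within w insert_block m0 T ?P"
    unfolding insert_block_def
  proof (rule exec_within_Seq[OF 1], rule exec_within_Seq)
    fix m1 assume m1: "m1 = ?m"
    show "exec_within w (While insert_cond insert_body) m1 (M * 40 + 20)
      (\<lambda>m. \<not> bval insert_cond m \<and> frame insert_body m1 m \<and> (\<exists>r'. I r' m))"
    proof (rule exec_within_While[where r = M and C = "cost insert_body"])
      show "I M m1" by (auto simp: I_def m1 s_def f_def)
    next
      fix r m assume I: "I r m" and fr: "frame insert_body m1 m"
      note fr = frameD[OF fr]
      have [simp]: "ivar m ''o'' = b * W" "rvar m ''start'' = x" "ivar m ''i'' = r"
        using fr I by (auto simp: m1 x_def I_def)
      have rM: "r \<le> M" using I by (simp add: I_def)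
      have "0 < r \<and> wp w insert_body (I (r - 1)) m" if c: "bval insert_cond m"
      proof -
        obtain l where l: "r = Suc l" using c by (cases r) (auto simp: insert_cond_def)
        have [simp]: "rarr m ''s'' (b * W + l) = s l" "rarr m ''f'' (b * W + l) = f l"
          using I l by (auto simp: I_def)
        have xl: "x < s l" using c l by (simp add: insert_cond_def)
        have "x < s k" if "l \<le> k" "k < M" for k using I xl that l by (cases "k = l") (auto simp: I_def)
        moreover have "rarr m ''s'' (Suc (b * W + k)) = s k" "rarr m ''f'' (Suc (b * W + k)) = f k"
          if "l < k" "k < M" for k using I that l by (auto simp: I_def)
        ultimately show ?thesis using I rM fits l by (auto simp: insert_body_def I_def)
      qed
      then show "bfits w insert_cond m \<and> (bval insert_cond m \<longrightarrow>
          0 < r \<and> exec_within w insert_body m (cost insert_body) (I (r - 1)))"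
        using rM fits by (auto simp: insert_cond_def intro: wp_sound)
    qed (simp add: insert_body_def insert_cond_def)
  next
    fix m1 m assume m1: "m1 = ?m" and m: "\<not> bval insert_cond m \<and> frame insert_body m1 m \<and> (\<exists>r'. I r' m)"
    then obtain p where I: "I p m" and fr: "frame insert_body m1 m" by auto
    note fr = frameD[OF fr]
    have [simp]: "ivar m ''o'' = b * W" "ivar m ''m'' = M" "ivar m ''b'' = b" "rvar m ''start'' = x"
        "rvar m ''finish'' = rvar m0 ''finish''" "iarr m ''z'' = iarr m0 ''z''" "ivar m ''i'' = p"
      using fr I b by (auto simp: m1 x_def I_def)
    have pM: "p \<le> M" using I by (simp add: I_def)
    have stop: "\<not> x < rarr m0 ''s'' (b * W + (p - 1))" if p: "0 < p"
    proof -
      obtain l where l: "p = Suc l" using p by (cases p) auto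
      then have "rarr m ''s'' (b * W + l) = rarr m0 ''s'' (b * W + l)" using I
        by (simp add: I_def s_def)
      then show ?thesis using m l by (simp add: insert_cond_def)
    qed
    have after: "x < fst i" if i: "i \<in> set (drop p (blk W m0 b))" for i
    proof -
      obtain k where "k < length (drop p (blk W m0 b))" "drop p (blk W m0 b) ! k = i"
        using i by (meson in_set_conv_nth)
      then have "k < M - p" "i = blk W m0 b ! (p + k)" using pM by (auto simp: M)
      then have "p + k < M" "fst i = s (p + k)" by (auto simp: blk_def M s_def)
      then show ?thesis using I by (auto simp: I_def)
    qed
    let ?m' = "m\<lparr>rarr := (rarr m)(''s'' := (rarr m ''s'')(b * W + p := x), ''f'' :=
      (rarr m ''f'')(b * W + p := rvar m0 ''finish'')),
        iarr := (iarr m)(''z'' := (iarr m0 ''z'')(b := Suc M))\<rparr>"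
    have "blk W ?m' b = take p (blk W m0 b) @ (x, rvar m0 ''finish'') # drop p (blk W m0 b)"
    proof (rule nth_equalityI)
      fix k assume "k < length (blk W ?m' b)"
      then have k: "k < Suc M" by simp
      consider "k < p" | "k = p" | l where "k = Suc l" "p \<le> l" by (cases k) fastforce+
      then show "blk W ?m' b ! k = (take p (blk W m0 b) @ (x, rvar m0 ''finish'') # drop p (blk W m0
        b)) ! k"
      proof cases
        case 1
        then show ?thesis using I k pM by (simp add: blk_def M nth_append I_def s_def f_def del:
          upt_Suc)
      next
        case 2
        then show ?thesis using k pM by (simp add: blk_def M nth_append del: upt_Suc)
      next
        case 3
        then show ?thesis using I k pM
          by (simp add: blk_def M nth_append I_def s_def f_def Suc_diff_le del: upt_Suc)
      qed
    qed (use pM in \<open>simp add: M\<close>)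
    then have "?P ?m'"
      using pM stop after I by (auto simp: x_def[symmetric] I_def)
    then show "exec_within w (RStore ''s'' (oadd (V ''i'')) (RVar ''start'') ;;
      RStore ''f'' (oadd (V ''i'')) (RVar ''finish'') ;;
      IStore ''z'' (V ''b'') (Add (V ''m'') (Num 1))) m 20 ?P"
      by (intro exec_within_wp) (use fits pM in \<open>simp_all add: fun_upd_twist\<close>)
  qed (use T in auto)
  then show ?thesis by (rule exec_within_frame)
qed

section \<open>Deletion from a block\<close>

definition delete_body :: com where
  "delete_body =
     Cond (BAnd (BNot (RLess (RArr ''s'' (oadd (V ''i''))) (RVar ''start'')))
                (BNot (RLess (RVar ''start'') (RArr ''s'' (oadd (V ''i''))))))
       Skip
       (RStore ''s'' (oadd (V ''k'')) (RArr ''s'' (oadd (V ''i''))) ;;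
        RStore ''f'' (oadd (V ''k'')) (RArr ''f'' (oadd (V ''i''))) ;;
        IAssign ''k'' (Add (V ''k'') (Num 1))) ;;
     IAssign ''i'' (Add (V ''i'') (Num 1))"

definition delete_block :: com where
  "delete_block =
     (select_block ;; IAssign ''i'' (Num 0) ;; IAssign ''k'' (Num 0)) ;;
     While (ILess (V ''i'') (V ''m'')) delete_body ;;
     IStore ''z'' (V ''b'') (V ''k'')"

lemma delete_body_mods [simp]:
  "mod_ivars delete_body = {''i'', ''k''}" "mod_rvars delete_body = {}" "mod_iarrs delete_body =
    {}" "mod_rarrs delete_body = {''s'', ''f''}"
  by (auto simp: delete_body_def)

lemma delete_block_mods [simp]:
  "mod_ivars delete_block = {''o'', ''m'', ''i'', ''k''}" "mod_rvars delete_block = {}"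
  "mod_iarrs delete_block = {''z''}" "mod_rarrs delete_block = {''s'', ''f''}"
  by (auto simp: delete_block_def select_block_def)

text \<open>Equality of reals is tested as the failure of both strict comparisons. The block is
  compacted in place, which is safe because the write position \<open>k\<close> never passes the
  read position \<open>i\<close>. Filtering by start identifies the interval because starts are
  distinct.\<close>

lemma delete_block_correct:
  assumes b: "ivar m0 ''b'' = b" and W: "ivar m0 ''W'' = W" and M: "iarr m0 ''z'' b = M"
    and fits: "b * W + M + 2 < 2 ^ w" "b < 2 ^ w" "W < 2 ^ w"
    and T: "M * 60 + 50 \<le> T"
  shows "exec_within w delete_block m0 T (\<lambda>m. frame delete_block m0 m \<and>
     blk W m b = filter (\<lambda>i. fst i \<noteq> rvar m0 ''start'') (blk W m0 b) \<and>
     (\<forall>b'. b' \<noteq> b \<longrightarrow> iarr m ''z'' b' = iarr m0 ''z'' b') \<and>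
     (\<forall>k. k < b * W \<or> b * W + M \<le> k \<longrightarrow>
        rarr m ''s'' k = rarr m0 ''s'' k \<and> rarr m ''f'' k = rarr m0 ''f'' k))"
    (is "exec_within _ _ _ _ (\<lambda>m. frame delete_block m0 m \<and> ?P m)")
proof -
  define x where "x = rvar m0 ''start''"
  define seg where "seg = (\<lambda>(m :: memory) n. map (\<lambda>i. (rarr m ''s'' (b * W + i), rarr m ''f'' (b * W
    + i))) [0..<n])"
  define I where "I = (\<lambda>r (m :: memory). ivar m ''i'' + r = M \<and> ivar m ''k'' \<le> ivar m ''i'' \<and>
    seg m (ivar m ''k'') = filter (\<lambda>i. fst i \<noteq> x) (seg m0 (ivar m ''i'')) \<and>
    (\<forall>k. k < b * W \<or> b * W + ivar m ''i'' \<le> k \<longrightarrow>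
        rarr m ''s'' k = rarr m0 ''s'' k \<and> rarr m ''f'' k = rarr m0 ''f'' k))"
  let ?m = "m0\<lparr>ivar := (ivar m0)(''o'' := b * W, ''m'' := M, ''i'' := 0, ''k'' := 0)\<rparr>"
  have 1: "exec_within w (select_block ;; IAssign ''i'' (Num 0) ;;
    IAssign ''k'' (Num 0)) m0 11 (\<lambda>m. m = ?m)"
    by (rule exec_within_wp) (use fits in \<open>auto simp: select_block_def b W M\<close>)
  have "exec_within w delete_block m0 T ?P"
    unfolding delete_block_def
  proof (rule exec_within_Seq[OF 1], rule exec_within_Seq)
    fix m1 assume m1: "m1 = ?m"
    show "exec_within w (While (ILess (V ''i'') (V ''m'')) delete_body) m1 (M * 60 + 20)
      (\<lambda>m. \<not> bval (ILess (V ''i'') (V ''m'')) m \<and> frame delete_body m1 m \<and> (\<exists>r'. I r' m))"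
    proof (rule exec_within_While[where r = M and C = "cost delete_body"])
      show "I M m1" by (auto simp: I_def m1 seg_def)
    next
      fix r m assume I: "I r m" and fr: "frame delete_body m1 m"
      note fr = frameD[OF fr]
      have [simp]: "ivar m ''o'' = b * W" "rvar m ''start'' = x" "ivar m ''m'' = M"
        using fr by (auto simp: m1 x_def)
      obtain i k where ik: "ivar m ''i'' = i" "ivar m ''k'' = k" by auto
      have le: "i \<le> M" "k \<le> i" using I ik by (auto simp: I_def)
      have sg: "seg m k = filter (\<lambda>i. fst i \<noteq> x) (seg m0 i)"
        and out: "\<And>k. k < b * W \<or> b * W + i \<le> k \<Longrightarrow>
           rarr m ''s'' k = rarr m0 ''s'' k \<and> rarr m ''f'' k = rarr m0 ''f'' k"
        using I ik by (auto simp: I_def)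
      have cur: "rarr m ''s'' (b * W + i) = rarr m0 ''s'' (b * W + i)"
        "rarr m ''f'' (b * W + i) = rarr m0 ''f'' (b * W + i)" using out by auto
      have "0 < r \<and> wp w delete_body (I (r - 1)) m" if lt: "i < M"
      proof -
        have r: "r = Suc (r - 1)" "i + r = M" using I ik lt by (auto simp: I_def)
        show ?thesis
        proof (cases "rarr m0 ''s'' (b * W + i) = x")
          case True
          then have "filter (\<lambda>i. fst i \<noteq> x) (seg m0 (Suc i)) = seg m k"
            by (simp add: seg_def sg[unfolded seg_def])
          then show ?thesis using True r ik le lt out fits cur
            by (auto simp: delete_body_def I_def seg_def)
        next
          case False
          let ?m' = "m\<lparr>rarr := (rarr m)(''s'' := (rarr m ''s'')(b * W + k := rarr m0 ''s'' (b * W + i)),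
             ''f'' := (rarr m ''f'')(b * W + k := rarr m0 ''f'' (b * W + i))),
             ivar := (ivar m)(''k'' := Suc k, ''i'' := Suc i)\<rparr>"
          have "seg ?m' k = seg m k" by (simp add: seg_def)
          moreover have "seg ?m' (Suc k) = seg ?m' k @ [(rarr m0 ''s'' (b * W + i), rarr m0 ''f'' (b
            * W + i))]"
            by (simp add: seg_def)
          moreover have "seg m0 (Suc i) = seg m0 i @ [(rarr m0 ''s'' (b * W + i), rarr m0 ''f'' (b *
            W + i))]"
            by (simp add: seg_def)
          ultimately have "seg ?m' (Suc k) = filter (\<lambda>i. fst i \<noteq> x) (seg m0 (Suc i))"
            using False sg by simp
          then have "I (r - 1) ?m'" using r le lt out ik by (auto simp: I_def)
          then show ?thesis using False r ik le lt fits cur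
            by (simp add: delete_body_def fun_upd_twist) (auto simp: linorder_neq_iff)
        qed
      qed
      then show "bfits w (ILess (V ''i'') (V ''m'')) m \<and> (bval (ILess (V ''i'') (V ''m'')) m \<longrightarrow>
          0 < r \<and> exec_within w delete_body m (cost delete_body) (I (r - 1)))"
        using le fits ik by (auto intro: wp_sound)
    qed (simp add: delete_body_def)
  next
    fix m1 m assume m1: "m1 = ?m"
      and m: "\<not> bval (ILess (V ''i'') (V ''m'')) m \<and> frame delete_body m1 m \<and> (\<exists>r'. I r' m)"
    then obtain r where I: "I r m" and fr: "frame delete_body m1 m" by auto
    note fr = frameD[OF fr]
    have [simp]: "ivar m ''m'' = M" "ivar m ''b'' = b" "iarr m ''z'' = iarr m0 ''z''"
      using fr b by (auto simp: m1)
    have i: "ivar m ''i'' = M" "ivar m ''k'' \<le> M" using m I by (auto simp: I_def)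
    show "exec_within w (IStore ''z'' (V ''b'') (V ''k'')) m 3 ?P"
      by (intro exec_within_wp) (use I i fits in \<open>auto simp: I_def blk_def seg_def x_def M\<close>)
  qed (use T in auto)
  then show ?thesis by (rule exec_within_frame)
qed

section \<open>Rebuilding all blocks\<close>

definition seg :: "string \<Rightarrow> string \<Rightarrow> memory \<Rightarrow> nat \<Rightarrow> nat \<Rightarrow> interval list" where
  "seg a a' m o0 n = map (\<lambda>i. (rarr m a (o0 + i), rarr m a' (o0 + i))) [0..<n]"

lemma seg_0 [simp]: "seg a a' m o0 0 = []"
  by (simp add: seg_def)

lemma seg_Suc: "seg a a' m o0 (Suc n) = seg a a' m o0 n @ [(rarr m a (o0 + n), rarr m a' (o0 + n))]"
  by (simp add: seg_def)

lemma length_seg [simp]: "length (seg a a' m o0 n) = n"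
  by (simp add: seg_def)

lemma blk_seg: "blk W m b = seg ''s'' ''f'' m (b * W) (iarr m ''z'' b)"
  by (simp add: blk_def seg_def)

lemma seg_cong:
  assumes "\<And>i. i < n \<Longrightarrow> rarr m' a (o0 + i) = rarr m a (o0 + i) \<and>
    rarr m' a' (o0 + i) = rarr m a' (o0 + i)"
  shows "seg a a' m' o0 n = seg a a' m o0 n"
  using assms by (simp add: seg_def)

section \<open>Collecting all intervals in one array\<close>

definition flatten_body :: com where
  "flatten_body =
     Cond (ILess (V ''i'') (IArr ''z'' (V ''b'')))
       (RStore ''u'' (V ''k'') (RArr ''s'' (Add (Mul (V ''b'') (V ''W'')) (V ''i''))) ;;
        RStore ''v'' (V ''k'') (RArr ''f'' (Add (Mul (V ''b'') (V ''W'')) (V ''i''))) ;;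
        IAssign ''k'' (Add (V ''k'') (Num 1)) ;;
        IAssign ''i'' (Add (V ''i'') (Num 1)))
       (IAssign ''b'' (Add (V ''b'') (Num 1)) ;; IAssign ''i'' (Num 0))"

definition flatten :: com where
  "flatten =
     (IAssign ''b'' (Num 0) ;; IAssign ''i'' (Num 0) ;; IAssign ''k'' (Num 0)) ;;
     While (ILess (V ''b'') (V ''J'')) flatten_body"

lemma flatten_body_mods [simp]:
  "mod_ivars flatten_body = {''b'', ''i'', ''k''}" "mod_rvars flatten_body = {}"
  "mod_iarrs flatten_body = {}" "mod_rarrs flatten_body = {''u'', ''v''}"
  by (auto simp: flatten_body_def)

lemma flatten_mods [simp]:
  "mod_ivars flatten = {''b'', ''i'', ''k''}" "mod_rvars flatten = {}"
  "mod_iarrs flatten = {}" "mod_rarrs flatten = {''u'', ''v''}"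
  by (auto simp: flatten_def)

text \<open>The loops over blocks and over positions are merged: each round raises either
  \<open>b\<close> or \<open>k\<close>, which gives the number of blocks plus the number of
  intervals as a bound on the rounds, empty blocks included. The copy goes to separate arrays since
  redistribution overwrites \<open>s\<close> and \<open>f\<close> under another block width.\<close>

lemma flatten_correct:
  assumes J: "ivar m0 ''J'' = J" and W: "ivar m0 ''W'' = W"
    and z: "\<And>b. b < J \<Longrightarrow> iarr m0 ''z'' b \<le> W"
    and fits: "J * W + 2 * W + 2 < 2 ^ w" "J + 1 < 2 ^ w"
    and T: "(J + length (contents W J m0)) * 40 + 20 \<le> T"
  shows "exec_within w flatten m0 T (\<lambda>m. frame flatten m0 m \<and>
     ivar m ''k'' = length (contents W J m0) \<and> seg ''u'' ''v'' m 0 (ivar m ''k'') = contents W J m0)"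
    (is "exec_within _ _ _ _ (\<lambda>m. frame flatten m0 m \<and> ?P m)")
proof -
  define n where "n = length (contents W J m0)"
  define I where "I = (\<lambda>r (m :: memory). ivar m ''b'' \<le> J \<and> r + ivar m ''b'' + ivar m ''k'' = J + n \<and>
    (if ivar m ''b'' = J then ivar m ''i'' = 0 else ivar m ''i'' \<le> iarr m0 ''z'' (ivar m ''b'')) \<and>
    ivar m ''k'' = length (contents W (ivar m ''b'') m0) + ivar m ''i'' \<and>
    seg ''u'' ''v'' m 0 (ivar m ''k'') =
      contents W (ivar m ''b'') m0 @ seg ''s'' ''f'' m0 (ivar m ''b'' * W) (ivar m ''i''))"
  have nW: "n \<le> J * W" unfolding n_def using z by (intro length_contents_le) auto
  let ?m = "m0\<lparr>ivar := (ivar m0)(''b'' := 0, ''i'' := 0, ''k'' := 0)\<rparr>"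
  have 1: "exec_within w (IAssign ''b'' (Num 0) ;; IAssign ''i'' (Num 0) ;;
    IAssign ''k'' (Num 0)) m0 6 (\<lambda>m. m = ?m)"
    by (rule exec_within_wp) auto
  have "exec_within w flatten m0 T ?P"
    unfolding flatten_def
  proof (rule exec_within_Seq[OF 1])
    fix m1 assume m1: "m1 = ?m"
    have "exec_within w (While (ILess (V ''b'') (V ''J'')) flatten_body) m1 ((J + n) * 40 + 4)
      (\<lambda>m. \<not> bval (ILess (V ''b'') (V ''J'')) m \<and> frame flatten_body m1 m \<and> (\<exists>r'. I r' m))"
    proof (rule exec_within_While[where r = "J + n" and C = "cost flatten_body"])
      show "I (J + n) m1" by (auto simp: I_def m1)
    next
      fix r m assume I: "I r m" and fr: "frame flatten_body m1 m"
      note fr = frameD[OF fr]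
      have [simp]: "ivar m ''J'' = J" "ivar m ''W'' = W" "iarr m ''z'' = iarr m0 ''z''"
        "rarr m ''s'' = rarr m0 ''s''" "rarr m ''f'' = rarr m0 ''f''"
        using fr by (auto simp: m1 J W)
      obtain b i k where v: "ivar m ''b'' = b" "ivar m ''i'' = i" "ivar m ''k'' = k" by auto
      have bJ: "b \<le> J" and rk: "r + b + k = J + n" and k: "k = length (contents W b m0) + i"
        and sg: "seg ''u'' ''v'' m 0 k = contents W b m0 @ seg ''s'' ''f'' m0 (b * W) i"
        using I by (auto simp: I_def v)
      have "0 < r \<and> wp w flatten_body (I (r - 1)) m" if lt: "b < J"
      proof -
        have i: "i \<le> iarr m0 ''z'' b" using I lt by (auto simp: I_def v)
        have bW: "b * W + W \<le> J * W" using lt mult_le_mono1[of "Suc b" J W] by simp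
        have "length (contents W (Suc b) m0) \<le> n"
          unfolding n_def using contents_split[OF lt, of W m0] by (simp add: contents_Suc)
        then have kn: "k + (iarr m0 ''z'' b - i) \<le> n" using k i by (simp add: contents_Suc)
        have r0: "0 < r" using rk lt kn by auto
        show ?thesis
        proof (cases "i < iarr m0 ''z'' b")
          case True
          let ?m' = "m\<lparr>rarr := (rarr m)(''u'' := (rarr m ''u'')(k := rarr m0 ''s'' (b * W + i)),
              ''v'' := (rarr m ''v'')(k := rarr m0 ''f'' (b * W + i))),
              ivar := (ivar m)(''k'' := Suc k, ''i'' := Suc i)\<rparr>"
          have "seg ''u'' ''v'' ?m' 0 k = seg ''u'' ''v'' m 0 k" by (rule seg_cong) simp
          then have "I (r - 1) ?m'"
            using sg rk r0 True lt k v by (simp add: I_def seg_Suc)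
          moreover have "Suc k \<le> n" using kn True by auto
          ultimately show ?thesis using r0 v True lt i bW kn nW fits z[OF lt]
            by (simp add: flatten_body_def fun_upd_twist)
        next
          case False
          let ?m' = "m\<lparr>ivar := (ivar m)(''b'' := Suc b, ''i'' := 0)\<rparr>"
          have "seg ''u'' ''v'' ?m' 0 k = seg ''u'' ''v'' m 0 k" by (rule seg_cong) simp
          then have "I (r - 1) ?m'"
            using sg rk r0 False lt k i v by (simp add: I_def contents_Suc blk_seg)
          then show ?thesis using r0 v False lt i bW kn nW fits z[OF lt]
            by (simp add: flatten_body_def fun_upd_twist)
        qed
      qed
      then show "bfits w (ILess (V ''b'') (V ''J'')) m \<and> (bval (ILess (V ''b'') (V ''J'')) m \<longrightarrow>
          0 < r \<and> exec_within w flatten_body m (cost flatten_body) (I (r - 1)))"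
        using bJ fits by (auto simp: v intro: wp_sound)
    qed (simp add: flatten_body_def)
    then show "exec_within w (While (ILess (V ''b'') (V ''J'')) flatten_body) m1 ((J + n) * 40 + 4) ?P"
    proof (rule exec_within_mono)
      fix m assume m: "\<not> bval (ILess (V ''b'') (V ''J'')) m \<and> frame flatten_body m1 m \<and> (\<exists>r'. I r' m)"
      then have "ivar m ''J'' = J" using frameD(1)[of flatten_body m1 m "''J''"] by (simp add: m1 J)
      then have "ivar m ''b'' = J" using m by (auto simp: I_def)
      then show "?P m" using m by (auto simp: I_def)
    qed simp
  qed (use T in \<open>simp add: n_def\<close>)
  then show ?thesis by (rule exec_within_frame)
qed

section \<open>Redistributing the intervals evenly\<close>

definition spread_body :: com where
  "spread_body =
     Cond (BAnd (ILess (V ''i'') (V ''J'')) (ILess (V ''q'') (V ''k'')))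
       (RStore ''s'' (Add (Mul (V ''b'') (V ''W'')) (V ''i'')) (RArr ''u'' (V ''q'')) ;;
        RStore ''f'' (Add (Mul (V ''b'') (V ''W'')) (V ''i'')) (RArr ''v'' (V ''q'')) ;;
        IAssign ''i'' (Add (V ''i'') (Num 1)) ;;
        IAssign ''q'' (Add (V ''q'') (Num 1)))
       (IStore ''z'' (V ''b'') (V ''i'') ;;
        IAssign ''b'' (Add (V ''b'') (Num 1)) ;; IAssign ''i'' (Num 0))"

definition spread :: com where
  "spread =
     (IAssign ''b'' (Num 0) ;; IAssign ''i'' (Num 0) ;; IAssign ''q'' (Num 0)) ;;
     While (ILess (V ''b'') (V ''J'')) spread_body"

lemma spread_body_mods [simp]:
  "mod_ivars spread_body = {''b'', ''i'', ''q''}" "mod_rvars spread_body = {}"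
  "mod_iarrs spread_body = {''z''}" "mod_rarrs spread_body = {''s'', ''f''}"
  by (auto simp: spread_body_def)

lemma spread_mods [simp]:
  "mod_ivars spread = {''b'', ''i'', ''q''}" "mod_rvars spread = {}"
  "mod_iarrs spread = {''z''}" "mod_rarrs spread = {''s'', ''f''}"
  by (auto simp: spread_def)

lemma spread_correct:
  assumes J: "ivar m0 ''J'' = J" and W: "ivar m0 ''W'' = W" "J \<le> W"
    and n: "ivar m0 ''k'' = n" "n \<le> J * J"
    and fits: "J * W + 2 * W + 2 < 2 ^ w" "J + 1 < 2 ^ w"
    and T: "(J + n) * 40 + 20 \<le> T"
  shows "exec_within w spread m0 T (\<lambda>m. frame spread m0 m \<and>
     contents W J m = seg ''u'' ''v'' m0 0 n \<and> (\<forall>b<J. iarr m ''z'' b \<le> J))"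
    (is "exec_within _ _ _ _ (\<lambda>m. frame spread m0 m \<and> ?P m)")
proof -
  \<comment> \<open>The disjunction about \<open>q\<close> says that all blocks closed so far
    received \<open>J\<close> intervals unless the source ran out.\<close>
  define I where "I = (\<lambda>r (m :: memory). ivar m ''b'' \<le> J \<and> r + ivar m ''b'' + ivar m ''q'' = J + n \<and>
    ivar m ''i'' \<le> J \<and> ivar m ''q'' \<le> n \<and> (ivar m ''b'' = J \<longrightarrow> ivar m ''i'' = 0) \<and>
    (ivar m ''q'' = ivar m ''b'' * J + ivar m ''i'' \<or> ivar m ''q'' = n) \<and>
    (\<forall>b<ivar m ''b''. iarr m ''z'' b \<le> J) \<and>
    contents W (ivar m ''b'') m @ seg ''s'' ''f'' m (ivar m ''b'' * W) (ivar m ''i'') =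
      seg ''u'' ''v'' m0 0 (ivar m ''q''))"
  have nW: "n \<le> J * W" by (rule le_trans[OF n(2) mult_le_mono2[OF W(2)]])
  let ?m = "m0\<lparr>ivar := (ivar m0)(''b'' := 0, ''i'' := 0, ''q'' := 0)\<rparr>"
  have 1: "exec_within w (IAssign ''b'' (Num 0) ;; IAssign ''i'' (Num 0) ;;
    IAssign ''q'' (Num 0)) m0 6 (\<lambda>m. m = ?m)"
    by (rule exec_within_wp) auto
  have "exec_within w spread m0 T ?P"
    unfolding spread_def
  proof (rule exec_within_Seq[OF 1])
    fix m1 assume m1: "m1 = ?m"
    have "exec_within w (While (ILess (V ''b'') (V ''J'')) spread_body) m1 ((J + n) * 40 + 4)
      (\<lambda>m. \<not> bval (ILess (V ''b'') (V ''J'')) m \<and> frame spread_body m1 m \<and> (\<exists>r'. I r' m))"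
    proof (rule exec_within_While[where r = "J + n" and C = "cost spread_body"])
      show "I (J + n) m1" by (auto simp: I_def m1)
    next
      fix r m assume I: "I r m" and fr: "frame spread_body m1 m"
      note fr = frameD[OF fr]
      have [simp]: "ivar m ''J'' = J" "ivar m ''W'' = W" "ivar m ''k'' = n"
        "rarr m ''u'' = rarr m0 ''u''" "rarr m ''v'' = rarr m0 ''v''"
        using fr by (auto simp: m1 J W n)
      obtain b i q where v: "ivar m ''b'' = b" "ivar m ''i'' = i" "ivar m ''q'' = q" by auto
      have bJ: "b \<le> J" and rk: "r + b + q = J + n" and iJ: "i \<le> J" and qn: "q \<le> n"
        and q: "q = b * J + i \<or> q = n" and z: "\<And>b'. b' < b \<Longrightarrow> iarr m ''z'' b' \<le> J"
        and sg: "contents W b m @ seg ''s'' ''f'' m (b * W) i = seg ''u'' ''v'' m0 0 q"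
        using I by (auto simp: I_def v)
      have "0 < r \<and> wp w spread_body (I (r - 1)) m" if lt: "b < J"
      proof -
        have bW: "b * W + W \<le> J * W" using lt mult_le_mono1[of "Suc b" J W] by simp
        have r0: "0 < r" using rk lt qn by auto
        show ?thesis
        proof (cases "i < J \<and> q < n")
          case True
          let ?m' = "m\<lparr>rarr := (rarr m)(''s'' := (rarr m ''s'')(b * W + i := rarr m0 ''u'' q),
              ''f'' := (rarr m ''f'')(b * W + i := rarr m0 ''v'' q)),
              ivar := (ivar m)(''i'' := Suc i, ''q'' := Suc q)\<rparr>"
          have "contents W b ?m' = contents W b m"
          proof (rule contents_cong)
            fix b' assume b': "b' < b"
            \<comment> \<open>Earlier blocks hold at most \<open>J\<close> intervals, and
              \<open>J \<le> W\<close>, so they end before block \<open>b\<close> begins.\<close>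
            have "b' * W + j \<noteq> b * W + i" if "j < iarr m ''z'' b'" for j
              using block_outside[of b' b j W] b' z[OF b'] that W(2) True by auto
            then show "blk W ?m' b' = blk W m b'" by (simp add: blk_def)
          qed
          moreover have "seg ''s'' ''f'' ?m' (b * W) i = seg ''s'' ''f'' m (b * W) i"
            by (rule seg_cong) simp
          ultimately have "contents W b ?m' @ seg ''s'' ''f'' ?m' (b * W) (Suc i) =
            seg ''u'' ''v'' m0 0 (Suc q)"
            using sg[symmetric] by (simp add: seg_Suc)
          then have "I (r - 1) ?m'"
            using rk r0 True lt v z q by (auto simp: I_def)
          then show ?thesis using r0 v True lt bW nW fits W(2)
            by (simp add: spread_body_def fun_upd_twist)
        next
          case False
          let ?m' = "m\<lparr>iarr := (iarr m)(''z'' := (iarr m ''z'')(b := i)), ivar := (ivar m)(''b'' :=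
            Suc b, ''i'' := 0)\<rparr>"
          have "contents W b ?m' = contents W b m"
            by (rule contents_cong) (simp add: blk_def)
          moreover have "blk W ?m' b = seg ''s'' ''f'' m (b * W) i"
            by (simp add: blk_def seg_def)
          ultimately have "contents W (Suc b) ?m' = seg ''u'' ''v'' m0 0 q"
            using sg by (simp add: contents_Suc)
          moreover have "q = Suc b * J \<or> q = n" using False q iJ qn by auto
          ultimately have "I (r - 1) ?m'"
            using rk r0 lt v z qn iJ by (auto simp: I_def less_Suc_eq)
          then show ?thesis using r0 v False lt iJ qn bW nW fits W(2)
            by (auto simp: spread_body_def fun_upd_twist)
        qed
      qed
      then show "bfits w (ILess (V ''b'') (V ''J'')) m \<and> (bval (ILess (V ''b'') (V ''J'')) m \<longrightarrow>
          0 < r \<and> exec_within w spread_body m (cost spread_body) (I (r - 1)))"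
        using bJ fits by (auto simp: v intro: wp_sound)
    qed (simp add: spread_body_def)
    then show "exec_within w (While (ILess (V ''b'') (V ''J'')) spread_body) m1 ((J + n) * 40 + 4) ?P"
    proof (rule exec_within_mono)
      fix m assume m: "\<not> bval (ILess (V ''b'') (V ''J'')) m \<and> frame spread_body m1 m \<and> (\<exists>r'. I r' m)"
      then have "ivar m ''J'' = J" using frameD(1)[of spread_body m1 m "''J''"] by (simp add: m1 J)
      then have "ivar m ''b'' = J" using m by (auto simp: I_def)
      \<comment> \<open>After the last block \<open>q = J * J\<close> or \<open>q = n\<close>; as
        \<open>q \<le> n \<le> J * J\<close>, nothing has been left over in either case.\<close>
      moreover from this have "ivar m ''i'' = 0" "ivar m ''q'' = n" using m n(2) by (auto simp: I_def)
      ultimately show "?P m" using m by (auto simp: I_def)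
    qed simp
  qed (use T in simp)
  then show ?thesis by (rule exec_within_frame)
qed

section \<open>Recomputing the tables of all blocks\<close>

definition retable :: com where
  "retable = IAssign ''b'' (Num 0) ;;
     While (ILess (V ''b'') (V ''J'')) (make_tables ;; IAssign ''b'' (Add (V ''b'') (Num 1)))"

lemma retable_mods [simp]:
  "mod_ivars retable = {''b'', ''o'', ''m'', ''p'', ''q''}" "mod_rvars retable = {''y''}"
  "mod_iarrs retable = {''A'', ''N''}" "mod_rarrs retable = {''Y''}"
  by (auto simp: retable_def)

text \<open>Serves twice: for each block during a rebuild, and after an update for the only block
  whose tables may be stale.\<close>

lemma make_tables_block:
  assumes b: "ivar m0 ''b'' = b" "b < J" and W: "ivar m0 ''W'' = W"
    and sorted: "start_sorted (contents W J m0)"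
    and z: "\<And>b. b < J \<Longrightarrow> iarr m0 ''z'' b \<le> W"
    and fits: "J * W + 2 * W + 2 < 2 ^ w" "J + 1 < 2 ^ w"
    and T: "134 * W + 30 \<le> T"
  shows "exec_within w make_tables m0 T (\<lambda>m. frame make_tables m0 m \<and>
     block_tables W m b \<and> (\<forall>b'<J. b' \<noteq> b \<longrightarrow> same_block W m0 m b'))"
proof -
  let ?M = "iarr m0 ''z'' b"
  have bW: "b * W + W \<le> J * W" using b(2) mult_le_mono1[of "Suc b" J W] by simp
  have "exec_within w make_tables m0 T (\<lambda>m. frame make_tables m0 m \<and>
     tables (\<lambda>i. rarr m0 ''s'' (b * W + i)) (\<lambda>i. rarr m0 ''f'' (b * W + i)) ?M (iarr m ''N'' b)
       (\<lambda>i. iarr m ''A'' (b * W + i)) (\<lambda>i. rarr m ''Y'' (b * W + i)) \<and>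
     (\<forall>b'. b' \<noteq> b \<longrightarrow> iarr m ''N'' b' = iarr m0 ''N'' b') \<and>
     (\<forall>k. k < b * W \<or> b * W + ?M \<le> k \<longrightarrow>
        iarr m ''A'' k = iarr m0 ''A'' k \<and> rarr m ''Y'' k = rarr m0 ''Y'' k))"
    by (rule make_tables_correct)
      (use b W z[OF b(2)] bW fits T blk_mono[OF sorted b(2)] in auto)
  then show ?thesis
  proof (rule exec_within_mono)
    fix m assume m: "frame make_tables m0 m \<and>
     tables (\<lambda>i. rarr m0 ''s'' (b * W + i)) (\<lambda>i. rarr m0 ''f'' (b * W + i)) ?M (iarr m ''N'' b)
       (\<lambda>i. iarr m ''A'' (b * W + i)) (\<lambda>i. rarr m ''Y'' (b * W + i)) \<and>
     (\<forall>b'. b' \<noteq> b \<longrightarrow> iarr m ''N'' b' = iarr m0 ''N'' b') \<and>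
     (\<forall>k. k < b * W \<or> b * W + ?M \<le> k \<longrightarrow>
        iarr m ''A'' k = iarr m0 ''A'' k \<and> rarr m ''Y'' k = rarr m0 ''Y'' k)"
    then have fr: "frame make_tables m0 m" by simp
    note fr' = frameD[OF fr]
    have [simp]: "iarr m ''z'' = iarr m0 ''z''" "rarr m ''s'' = rarr m0 ''s''" "rarr m ''f'' =
      rarr m0 ''f''"
      using fr' by auto
    have "same_block W m0 m b'" if b': "b' < J" "b' \<noteq> b" for b'
    proof -
      have "b' * W + i < b * W \<or> b * W + ?M \<le> b' * W + i" if "i < iarr m0 ''z'' b'" for i
        using block_outside[OF b'(2), of i W] z[OF b'(1)] z[OF b(2)] that by auto
      then have "iarr m ''A'' (b' * W + i) = iarr m0 ''A'' (b' * W + i)"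
        "rarr m ''Y'' (b' * W + i) = rarr m0 ''Y'' (b' * W + i)" if "i < iarr m0 ''z'' b'" for i
        using m that by blast+
      then show ?thesis using m b' by (simp add: same_block_def)
    qed
    then show "frame make_tables m0 m \<and> block_tables W m b \<and> (\<forall>b'<J. b' \<noteq> b \<longrightarrow> same_block W m0 m b')"
      using m by (auto simp: block_tables_def)
  qed simp
qed

lemma retable_correct:
  assumes J: "ivar m0 ''J'' = J" and W: "ivar m0 ''W'' = W"
    and sorted: "start_sorted (contents W J m0)"
    and z: "\<And>b. b < J \<Longrightarrow> iarr m0 ''z'' b \<le> W"
    and fits: "J * W + 2 * W + 2 < 2 ^ w" "J + 1 < 2 ^ w"
    and T: "J * (134 * W + 50) + 10 \<le> T"
  shows "exec_within w retable m0 T (\<lambda>m. frame retable m0 m \<and> (\<forall>b<J. block_tables W m b))"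
proof -
  let ?c = "make_tables ;; IAssign ''b'' (Add (V ''b'') (Num 1))"
  define I where "I = (\<lambda>r (m :: memory). ivar m ''b'' + r = J \<and> (\<forall>b<ivar m ''b''. block_tables W m b))"
  let ?m = "m0\<lparr>ivar := (ivar m0)(''b'' := 0)\<rparr>"
  have 1: "exec_within w (IAssign ''b'' (Num 0)) m0 2 (\<lambda>m. m = ?m)"
    by (rule exec_within_wp) auto
  have "exec_within w retable m0 T (\<lambda>m. \<forall>b<J. block_tables W m b)"
    unfolding retable_def
  proof (rule exec_within_Seq[OF 1])
    fix m1 assume m1: "m1 = ?m"
    have "exec_within w (While (ILess (V ''b'') (V ''J'')) ?c) m1 (J * (134 * W + 50) + 4)
      (\<lambda>m. \<not> bval (ILess (V ''b'') (V ''J'')) m \<and> frame ?c m1 m \<and> (\<exists>r'. I r' m))"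
    proof (rule exec_within_While[where r = J and C = "134 * W + 40"])
      show "I J m1" by (auto simp: I_def m1)
    next
      fix r m assume I: "I r m" and fr: "frame ?c m1 m"
      note fr = frameD[OF fr]
      have [simp]: "ivar m ''J'' = J" "ivar m ''W'' = W" "iarr m ''z'' = iarr m0 ''z''"
        "rarr m ''s'' = rarr m0 ''s''" "rarr m ''f'' = rarr m0 ''f''"
        using fr by (auto simp: m1 J W)
      have blk: "blk W m b = blk W m0 b" for b by (simp add: blk_def)
      then have sorted': "start_sorted (contents W J m)" using sorted contents_cong[of J W m m0] by simp
      let ?b = "ivar m ''b''"
      have "exec_within w ?c m (134 * W + 40) (I (r - 1))" if b: "?b < J"
      proof (rule exec_within_Seq)
        show "exec_within w make_tables m (134 * W + 30) (\<lambda>m'. frame make_tables m m' \<and>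
          block_tables W m' ?b \<and> (\<forall>b'<J. b' \<noteq> ?b \<longrightarrow> same_block W m m' b'))"
          by (rule make_tables_block[OF refl b]) (use sorted' z fits in auto)
      next
        fix m' assume m': "frame make_tables m m' \<and>
          block_tables W m' ?b \<and> (\<forall>b'<J. b' \<noteq> ?b \<longrightarrow> same_block W m m' b')"
        then have b': "ivar m' ''b'' = ?b" using frameD(1)[of make_tables m m' "''b''"] by simp
        have "block_tables W m' b'" if "b' < Suc ?b" for b'
          using m' I b that same_block_tables[of W m m' b'] by (cases "b' = ?b") (auto simp: I_def)
        then show "exec_within w (IAssign ''b'' (Add (V ''b'') (Num 1))) m' 4 (I (r - 1))"
          by (intro exec_within_wp) (use I b b' fits in \<open>auto simp: I_def block_tables_def\<close>)
      qed simp
      then show "bfits w (ILess (V ''b'') (V ''J'')) m \<and> (bval (ILess (V ''b'') (V ''J'')) m \<longrightarrow>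
          0 < r \<and> exec_within w ?c m (134 * W + 40) (I (r - 1)))"
        using I fits by (auto simp: I_def)
    qed simp
    then show "exec_within w (While (ILess (V ''b'') (V ''J'')) ?c) m1 (J * (134 * W + 50) + 4)
        (\<lambda>m. \<forall>b<J. block_tables W m b)"
    proof (rule exec_within_mono)
      fix m assume m: "\<not> bval (ILess (V ''b'') (V ''J'')) m \<and> frame ?c m1 m \<and> (\<exists>r'. I r' m)"
      then have "ivar m ''J'' = J" using frameD(1)[of ?c m1 m "''J''"] by (simp add: m1 J)
      then show "\<forall>b<J. block_tables W m b" using m by (auto simp: I_def)
    qed simp
  qed (use T in simp)
  then show ?thesis by (rule exec_within_frame)
qed

definition rebuild :: com where
  "rebuild =
     flatten ;;
     (IAssign ''J'' (Add (V ''J'') (Num 1)) ;; IAssign ''W'' (Mul (Num 2) (V ''J'')) ;;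
       IAssign ''K'' (Num 0)) ;;
     spread ;; retable"

lemma rebuild_mods [simp]:
  "mod_ivars rebuild = {''J'', ''W'', ''K'', ''b'', ''i'', ''k'', ''q'', ''o'', ''m'', ''p''}"
    "mod_rvars rebuild = {''y''}"
  "mod_iarrs rebuild = {''A'', ''N'', ''z''}" "mod_rarrs rebuild = {''Y'', ''u'', ''v'', ''s'', ''f''}"
  by (auto simp: rebuild_def)

lemma rebuild_correct:
  assumes J: "ivar m0 ''J'' = J" "ivar m0 ''W'' = 2 * J"
    and sorted: "start_sorted (contents (2 * J) J m0)"
    and z: "\<And>b. b < J \<Longrightarrow> iarr m0 ''z'' b \<le> 2 * J"
    and len: "length (contents (2 * J) J m0) \<le> (J + 1) * (J + 1)"
    and fits: "(J + 1) * (2 * (J + 1)) + 2 * (2 * (J + 1)) + 2 < 2 ^ w"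
    and T: "600 * ((J + 1) * (J + 1)) \<le> T"
  shows "exec_within w rebuild m0 T (\<lambda>m. frame rebuild m0 m \<and> ivar m ''J'' = J + 1 \<and>
    ivar m ''W'' = 2 * (J + 1) \<and> ivar m ''K'' = 0 \<and>
     contents (2 * (J + 1)) (J + 1) m = contents (2 * J) J m0 \<and>
     (\<forall>b<J + 1. iarr m ''z'' b \<le> J + 1) \<and> (\<forall>b<J + 1. block_tables (2 * (J + 1)) m b))"
    (is "exec_within _ _ _ _ (\<lambda>m. frame rebuild m0 m \<and> ?P m)")
proof -
  let ?n = "length (contents (2 * J) J m0)"
  have fits1: "J * (2 * J) + 2 * (2 * J) + 2 < 2 ^ w" "J + 1 < 2 ^ w" "J + 1 + 1 < 2 ^ w"
    using fits by (auto simp: algebra_simps)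
  have sq: "J + 1 \<le> (J + 1) * (J + 1)" by simp
  let ?T1 = "(J + ?n) * 40 + 20" and ?T2 = "(J + 1 + ?n) * 40 + 20"
  let ?T3 = "(J + 1) * (134 * (2 * (J + 1)) + 50) + 10"
  \<comment> \<open>Each block costs 134 per cell of its doubled width and 50 more, and 318 = 2 *
    134 + 50.\<close>
  have T3: "?T3 \<le> 318 * ((J + 1) * (J + 1)) + 10" by (simp add: algebra_simps)
  have T': "?T1 + (12 + (?T2 + ?T3)) \<le> T"
  proof -
    \<comment> \<open>Writing \<open>x\<close> for the square leaves linear arithmetic: the two
      copying passes take at most 80 * x + 20 each, so the total is at most 478 * x + 62, below 600
      * x because \<open>x\<close> is positive.\<close>
    have "?T1 + (12 + (?T2 + t)) \<le> T" if "600 * x \<le> T" "t \<le> 318 * x + 10" "?n \<le> x" "J + 1 \<le> x" for x t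
      using that by simp
    from this[OF T T3 len sq] show ?thesis .
  qed
  have "exec_within w rebuild m0 T ?P"
    unfolding rebuild_def
  proof (rule exec_within_Seq[OF _ _ T'])
    show "exec_within w flatten m0 ?T1 (\<lambda>m. frame flatten m0 m \<and> ivar m ''k'' = ?n \<and>
       seg ''u'' ''v'' m 0 (ivar m ''k'') = contents (2 * J) J m0)"
      by (rule flatten_correct) (use J z fits1 in auto)
  next
    fix m1 assume m1: "frame flatten m0 m1 \<and> ivar m1 ''k'' = ?n \<and>
       seg ''u'' ''v'' m1 0 (ivar m1 ''k'') = contents (2 * J) J m0"
    have [simp]: "ivar m1 ''J'' = J"
      using m1 frameD(1)[of flatten m0 m1 "''J''"] J by simp
    let ?m = "m1\<lparr>ivar := (ivar m1)(''J'' := J + 1, ''W'' := 2 * (J + 1), ''K'' := 0)\<rparr>"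
    show "exec_within w ((IAssign ''J'' (Add (V ''J'') (Num 1)) ;;
      IAssign ''W'' (Mul (Num 2) (V ''J'')) ;;
       IAssign ''K'' (Num 0)) ;; spread ;; retable) m1 (12 + (?T2 + ?T3)) ?P"
    proof (rule exec_within_Seq)
      show "exec_within w (IAssign ''J'' (Add (V ''J'') (Num 1)) ;;
        IAssign ''W'' (Mul (Num 2) (V ''J'')) ;;
         IAssign ''K'' (Num 0)) m1 12 (\<lambda>m. m = ?m)"
        by (rule exec_within_wp) (use fits fits1 in auto)
    next
      fix m2 assume m2: "m2 = ?m"
      have "seg ''u'' ''v'' m2 0 ?n = seg ''u'' ''v'' m1 0 (ivar m1 ''k'')"
        using m1 m2 by (simp add: seg_def)
      then have sg: "seg ''u'' ''v'' m2 0 ?n = contents (2 * J) J m0" using m1 by metis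
      show "exec_within w (spread ;; retable) m2 (?T2 + ?T3) ?P"
      proof (rule exec_within_Seq)
        show "exec_within w spread m2 ?T2 (\<lambda>m. frame spread m2 m \<and>
          contents (2 * (J + 1)) (J + 1) m = seg ''u'' ''v'' m2 0 ?n \<and>
            (\<forall>b<J + 1. iarr m ''z'' b \<le> J + 1))"
          by (rule spread_correct) (use m1 m2 len fits fits1 in auto)
      next
        fix m3 assume m3: "frame spread m2 m3 \<and>
          contents (2 * (J + 1)) (J + 1) m3 = seg ''u'' ''v'' m2 0 ?n \<and>
            (\<forall>b<J + 1. iarr m3 ''z'' b \<le> J + 1)"
        then have fr: "frame spread m2 m3" by simp
        have v: "ivar m3 ''J'' = J + 1" "ivar m3 ''W'' = 2 * (J + 1)" "ivar m3 ''K'' = 0"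
          using frameD(1)[OF fr] m2 by simp_all
        have "exec_within w retable m3 ?T3 (\<lambda>m. frame retable m3 m \<and>
          (\<forall>b<J + 1. block_tables (2 * (J + 1)) m b))"
          by (rule retable_correct[OF v(1,2)]) (use m3 sg sorted fits fits1 in auto)
        then show "exec_within w retable m3 ?T3 ?P"
        proof (rule exec_within_mono)
          fix m assume m: "frame retable m3 m \<and> (\<forall>b<J + 1. block_tables (2 * (J + 1)) m b)"
          note fr' = frameD[OF conjunct1[OF m]]
          have "blk (2 * (J + 1)) m b = blk (2 * (J + 1)) m3 b" for b
            using fr' by (simp add: blk_def)
          then have "contents (2 * (J + 1)) (J + 1) m = contents (2 * (J + 1)) (J + 1) m3"
            by (intro contents_cong)
          then show "?P m" using m m3 sg v fr' by simp
        qed simp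
      qed simp
    qed simp
  qed
  then show ?thesis by (rule exec_within_frame)
qed

section \<open>Amortized update time\<close>

definition finish_update :: com where
  "finish_update =
     make_tables ;; compute_answer ;; IAssign ''K'' (Add (V ''K'') (Num 1)) ;;
     Cond (ILess (V ''K'') (V ''J'')) Skip rebuild"

definition interval_scheduler :: data_structure where
  "interval_scheduler = \<lparr>
     init_prog = IAssign ''J'' (Num 1) ;; IAssign ''W'' (Num 2),
     insert_prog = find_block ;; insert_block ;; finish_update,
     delete_prog = find_block ;; delete_block ;; finish_update\<rparr>"

text \<open>Each update of the phase can add one interval, hence the summands \<open>K\<close>.
  While \<open>K \<le> J\<close>, no block outgrows its \<open>2 * J\<close> cells.\<close>

definition layout :: "nat \<Rightarrow> nat \<Rightarrow> interval set \<Rightarrow> memory \<Rightarrow> bool" where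
  "layout J K S m \<longleftrightarrow> ivar m ''J'' = J \<and> ivar m ''W'' = 2 * J \<and>
     start_sorted (contents (2 * J) J m) \<and> set (contents (2 * J) J m) = S \<and> (\<forall>i\<in>S. fst i < snd i) \<and>
     length (contents (2 * J) J m) \<le> J * J + K \<and> (\<forall>b<J. iarr m ''z'' b \<le> J + K)"

definition clean :: "nat \<Rightarrow> nat \<Rightarrow> interval set \<Rightarrow> memory \<Rightarrow> bool" where
  "clean J K S m \<longleftrightarrow> K < J \<and> ivar m ''K'' = K \<and> layout J K S m \<and> (\<forall>b<J. block_tables (2 * J) m b)"

text \<open>The state between changing a block and recomputing its tables. The layout already counts
  the update in progress whereas the register still holds \<open>K\<close>.\<close>

definition dirty :: "nat \<Rightarrow> nat \<Rightarrow> interval set \<Rightarrow> memory \<Rightarrow> bool" where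
  "dirty J K S m \<longleftrightarrow> K < J \<and> ivar m ''K'' = K \<and> layout J (Suc K) S m \<and> ivar m ''b'' < J \<and>
     (\<forall>b<J. b \<noteq> ivar m ''b'' \<longrightarrow> block_tables (2 * J) m b)"

definition clean_next :: "nat \<Rightarrow> nat \<Rightarrow> interval set \<Rightarrow> memory \<Rightarrow> bool" where
  "clean_next J K = (if Suc K < J then clean J (Suc K) else clean (Suc J) 0)"

text \<open>Phrased with \<open>J + 1\<close> because an update in phase \<open>J\<close> may end
  with a rebuild into the larger layout of the next phase.\<close>

definition word_fits :: "nat \<Rightarrow> nat \<Rightarrow> bool" where
  "word_fits J w \<longleftrightarrow> (J + 1) * (2 * (J + 1)) + 2 * (2 * (J + 1)) + 2 < 2 ^ w"

lemma word_fitsD: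
  assumes "word_fits J w"
  shows "J * (2 * J) + 2 * (2 * J) + 2 < 2 ^ w" "J + 1 < 2 ^ w" "2 * J < 2 ^ w"
  using assms by (auto simp: word_fits_def algebra_simps)

lemma start_sorted_inj:
  "start_sorted l \<Longrightarrow> i \<in> set l \<Longrightarrow> j \<in> set l \<Longrightarrow> fst i = fst j \<Longrightarrow> i = j"
  by (induction l) fastforce+

text \<open>The comparison at \<open>p - 1\<close> only shows that the preceding start is not
  larger. It becomes strict because the new start differs from all starts in the block, which comes
  from the distinctness of endpoints.\<close>

lemma start_sorted_insert:
  assumes l: "start_sorted (pre @ l @ post)" "p \<le> length l"
    and pre: "\<forall>i\<in>set pre. fst i < fst x" and post: "\<forall>i\<in>set post. fst x < fst i"
    and p: "0 < p \<Longrightarrow> \<not> fst x < fst (l ! (p - 1))" "\<forall>i\<in>set (drop p l). fst x < fst i"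
    and new: "\<forall>i\<in>set l. fst i \<noteq> fst x"
  shows "start_sorted (pre @ (take p l @ x # drop p l) @ post)"
proof -
  have before: "fst i < fst x" if i: "i \<in> set (take p l)" for i
  proof -
    obtain k where k: "k < length (take p l)" "take p l ! k = i" using i by (meson in_set_conv_nth)
    then have k': "k < p" "l ! k = i" using l by auto
    have srt: "start_sorted l" using l(1) by (simp add: sorted_wrt_append)
    have "fst (l ! k) \<le> fst (l ! (p - 1))"
      using sorted_wrt_nth_less[OF srt, of k "p - 1"] k' l(2) by (cases "k = p - 1")
        (auto simp: less_imp_le)
    then have "fst i \<le> fst x" using p(1) k' by auto
    moreover have "i \<in> set l" using i by (meson in_set_takeD)
    ultimately show ?thesis using new by fastforce
  qed
  have "start_sorted (pre @ (take p l @ drop p l) @ post)" using l(1) by simp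
  then show ?thesis using pre post p(2) before
    by (auto simp: sorted_wrt_append simp del: append_take_drop_id)
qed

lemma finish_update_correct:
  assumes d: "dirty J K S m0" and fits: "word_fits J w" and L: "2 * J < 2 ^ L"
    and T: "J * (21 * L + 332) + 70 + (if Suc K < J then 0 else 2400 * J * J) \<le> T"
  shows "exec_within w finish_update m0 T (\<lambda>m. reported m = max_compatible S \<and> clean_next J K S m)"
proof -
  let ?W = "2 * J"
  let ?b = "ivar m0 ''b''"
  let ?R = "if Suc K < J then 1 else 600 * ((J + 1) * (J + 1))"
  note fits' = word_fitsD[OF fits]
  have KJ: "K < J" "ivar m0 ''K'' = K" and b: "?b < J" and lay: "layout J (Suc K) S m0"
    and tab: "\<And>b. b < J \<Longrightarrow> b \<noteq> ?b \<Longrightarrow> block_tables ?W m0 b"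
    using d by (auto simp: dirty_def)
  have v: "ivar m0 ''J'' = J" "ivar m0 ''W'' = ?W" and sorted: "start_sorted (contents ?W J m0)"
    and S: "set (contents ?W J m0) = S" "\<forall>i\<in>S. fst i < snd i"
    and len: "length (contents ?W J m0) \<le> J * J + Suc K"
    and z: "\<And>b. b < J \<Longrightarrow> iarr m0 ''z'' b \<le> J + Suc K"
    using lay by (auto simp: layout_def)
  have z': "iarr m0 ''z'' b \<le> ?W" if "b < J" for b using z[OF that] KJ by simp
  \<comment> \<open>Phases have \<open>1 \<le> J\<close>, so the rebuild bound 600 * (J + 1) * (J +
    1) turns into 2400 * J * J.\<close>
  have sq: "(J + 1) * (J + 1) \<le> 4 * (J * J)"
  proof -
    have "J + 1 \<le> 2 * J" using KJ by simp
    from mult_le_mono[OF this this] show ?thesis by simp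
  qed
  \<comment> \<open>Here 332 = 2 * 134 + 64: the tables of one block of width \<open>2 * J\<close>,
    and the part of the pass over \<open>J\<close> blocks outside the search loops' factor
    \<open>L\<close>.\<close>
  have T': "(134 * ?W + 30) + ((J * (21 * L + 64) + 10) + (4 + (5 + ?R))) \<le> T"
    using T sq by (auto simp: algebra_simps split: if_splits)
  show ?thesis unfolding finish_update_def
  proof (rule exec_within_Seq[OF _ _ T'])
    show "exec_within w make_tables m0 (134 * ?W + 30) (\<lambda>m. frame make_tables m0 m \<and>
        block_tables ?W m ?b \<and> (\<forall>b'<J. b' \<noteq> ?b \<longrightarrow> same_block ?W m0 m b'))"
      by (rule make_tables_block[OF refl b v(2) sorted z' fits'(1,2)]) simp_all
  next
    fix m1 assume m1: "frame make_tables m0 m1 \<and>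
        block_tables ?W m1 ?b \<and> (\<forall>b'<J. b' \<noteq> ?b \<longrightarrow> same_block ?W m0 m1 b')"
    note fr = frameD[OF conjunct1[OF m1]]
    have v1 [simp]: "ivar m1 ''J'' = J" "ivar m1 ''W'' = ?W" "ivar m1 ''K'' = K"
      "iarr m1 ''z'' = iarr m0 ''z''"
      using fr v KJ by simp_all
    have "blk ?W m1 b = blk ?W m0 b" for b using fr by (simp add: blk_def)
    then have c1: "contents ?W J m1 = contents ?W J m0" by (intro contents_cong)
    have tab1: "block_tables ?W m1 b" if "b < J" for b
      using m1 tab[OF that] that same_block_tables by (cases "b = ?b") auto
    show "exec_within w (compute_answer ;; IAssign ''K'' (Add (V ''K'') (Num 1)) ;;
       Cond (ILess (V ''K'') (V ''J'')) Skip rebuild) m1 ((J * (21 * L + 64) + 10) + (4 + (5 + ?R)))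
       (\<lambda>m. reported m = max_compatible S \<and> clean_next J K S m)"
    proof (rule exec_within_Seq)
      show "exec_within w compute_answer m1 (J * (21 * L + 64) + 10) (\<lambda>m. frame compute_answer m1 m \<and>
         ivar m ''answer'' = fst (fold step (contents ?W J m1) (0, rvar m1 ''x'')))"
        by (rule compute_answer_correct[where L = L]) (use c1 sorted z' tab1 fits' L in auto)
    next
      fix m2 assume m2: "frame compute_answer m1 m2 \<and>
         ivar m2 ''answer'' = fst (fold step (contents ?W J m1) (0, rvar m1 ''x''))"
      note fr2 = frameD[OF conjunct1[OF m2]]
      have ans: "ivar m2 ''answer'' = max_compatible S"
        using m2 fold_step_max_compatible[OF sorted] S c1 by simp
      let ?m3 = "m2\<lparr>ivar := (ivar m2)(''K'' := Suc K)\<rparr>"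
      have v3 [simp]: "ivar m2 ''J'' = J" "ivar m2 ''W'' = ?W" "ivar m2 ''K'' = K"
        "iarr m2 a = iarr m1 a" "rarr m2 a = rarr m1 a" for a
        using fr2 by simp_all
      have "blk ?W ?m3 b = blk ?W m1 b" for b by (simp add: blk_def)
      then have c3: "contents ?W J ?m3 = contents ?W J m0"
        using c1 contents_cong[of J ?W ?m3 m1] by simp
      have tab3: "block_tables ?W ?m3 b" if "b < J" for b
        using tab1[OF that] by (simp add: block_tables_def)
      show "exec_within w (IAssign ''K'' (Add (V ''K'') (Num 1)) ;;
        Cond (ILess (V ''K'') (V ''J'')) Skip rebuild) m2 (4 + (5 + ?R))
        (\<lambda>m. reported m = max_compatible S \<and> clean_next J K S m)"
      proof (rule exec_within_Seq)
        show "exec_within w (IAssign ''K'' (Add (V ''K'') (Num 1))) m2 4 (\<lambda>m. m = ?m3)"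
          by (rule exec_within_wp) (use KJ fits' in auto)
      next
        fix m3 assume m3: "m3 = ?m3"
        have [simp]: "ivar m3 ''J'' = J" "ivar m3 ''W'' = ?W" "ivar m3 ''K'' = Suc K"
          "ivar m3 ''answer'' = max_compatible S" "iarr m3 ''z'' = iarr m0 ''z''"
          using ans by (simp_all add: m3)
        note c3 = c3[folded m3] and tab3 = tab3[folded m3]
        show "exec_within w (Cond (ILess (V ''K'') (V ''J'')) Skip rebuild) m3 (5 + ?R)
          (\<lambda>m. reported m = max_compatible S \<and> clean_next J K S m)"
        proof (rule exec_within_Cond[where ?T1.0 = ?R])
          assume "bval (ILess (V ''K'') (V ''J'')) m3"
          then have lt: "Suc K < J" by simp
          have "clean J (Suc K) S m3"
            using lt c3 tab3 lay by (simp add: clean_def layout_def)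
          then show "exec_within w Skip m3 ?R (\<lambda>m. reported m = max_compatible S \<and> clean_next J K S m)"
            by (intro exec_within_wp) (use lt in \<open>simp_all add: clean_next_def reported_def\<close>)
        next
          assume "\<not> bval (ILess (V ''K'') (V ''J'')) m3"
          then have KJ': "J = Suc K" using KJ by simp
          have len': "length (contents ?W J m3) \<le> (J + 1) * (J + 1)"
            using len KJ' c3 by simp
          have "exec_within w rebuild m3 ?R (\<lambda>m. frame rebuild m3 m \<and> ivar m ''J'' = J + 1 \<and>
             ivar m ''W'' = 2 * (J + 1) \<and> ivar m ''K'' = 0 \<and>
             contents (2 * (J + 1)) (J + 1) m = contents (2 * J) J m3 \<and>
             (\<forall>b<J + 1. iarr m ''z'' b \<le> J + 1) \<and> (\<forall>b<J + 1. block_tables (2 * (J + 1)) m b))"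
            by (rule rebuild_correct[OF _ _ _ _ len' fits[unfolded word_fits_def]])
              (use c3 sorted z' KJ' in auto)
          then show "exec_within w rebuild m3 ?R (\<lambda>m. reported m = max_compatible S \<and>
            clean_next J K S m)"
          proof (rule exec_within_mono)
            fix m assume m: "frame rebuild m3 m \<and> ivar m ''J'' = J + 1 \<and>
             ivar m ''W'' = 2 * (J + 1) \<and> ivar m ''K'' = 0 \<and>
             contents (2 * (J + 1)) (J + 1) m = contents (2 * J) J m3 \<and>
             (\<forall>b<J + 1. iarr m ''z'' b \<le> J + 1) \<and> (\<forall>b<J + 1. block_tables (2 * (J + 1)) m b)"
            have "reported m = max_compatible S"
              using frameD(1)[OF conjunct1[OF m], of "''answer''"] by (simp add: reported_def)
            moreover have "clean (J + 1) 0 S m"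
              using m c3 sorted S len' by (simp add: clean_def layout_def)
            ultimately show "reported m = max_compatible S \<and> clean_next J K S m"
              using KJ' by (simp add: clean_next_def)
          qed simp
        qed (use KJ fits' in auto)
      qed simp
    qed simp
  qed
qed

lemma find_block_mods [simp]:
  "mod_ivars find_block = {''b''}" "mod_rvars find_block = {}" "mod_iarrs find_block = {}"
    "mod_rarrs find_block = {}"
  by (auto simp: find_block_def)

lemma clean_pass_interval: "clean J K S m \<Longrightarrow> clean J K S (pass_interval i m)"
proof -
  assume "clean J K S m"
  moreover have "contents W n (pass_interval i m) = contents W n m" for W n
    by (rule contents_cong) (simp add: blk_def pass_interval_def)
  moreover have "block_tables W (pass_interval i m) b = block_tables W m b" for W b
    by (simp add: block_tables_def pass_interval_def)
  ultimately show ?thesis by (simp add: clean_def layout_def) (simp add: pass_interval_def)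
qed

lemma find_block_clean:
  assumes inv: "clean J K S m0" and fits: "word_fits J w"
  shows "exec_within w find_block m0 (J * 30 + 30) (\<lambda>m. clean J K S m \<and> rvar m = rvar m0 \<and>
    ivar m ''b'' < J \<and>
     (\<forall>i\<in>set (contents (2 * J) (ivar m ''b'') m). fst i < rvar m ''start'') \<and>
     (\<forall>i\<in>set (concat (map (blk (2 * J) m) [Suc (ivar m ''b'')..<J])). rvar m ''start'' < fst i))"
proof -
  have "exec_within w find_block m0 (J * 30 + 30) (\<lambda>m. frame find_block m0 m \<and> ivar m ''b'' < J \<and>
     (\<forall>i\<in>set (contents (2 * J) (ivar m ''b'') m0). fst i < rvar m0 ''start'') \<and>
     (\<forall>i\<in>set (concat (map (blk (2 * J) m0) [Suc (ivar m ''b'')..<J])). rvar m0 ''start'' < fst i))"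
  proof (rule find_block_correct)
    show "iarr m0 ''z'' b \<le> 2 * J" if "b < J" for b
    proof -
      have "iarr m0 ''z'' b \<le> J + K" "K < J" using inv that by (auto simp: clean_def layout_def)
      then show ?thesis by simp
    qed
  qed (use inv word_fitsD[OF fits] in \<open>auto simp: clean_def layout_def\<close>)
  then show ?thesis
  proof (rule exec_within_mono)
    fix m assume m: "frame find_block m0 m \<and> ivar m ''b'' < J \<and>
     (\<forall>i\<in>set (contents (2 * J) (ivar m ''b'') m0). fst i < rvar m0 ''start'') \<and>
     (\<forall>i\<in>set (concat (map (blk (2 * J) m0) [Suc (ivar m ''b'')..<J])). rvar m0 ''start'' < fst i)"
    note fr = frameD[OF conjunct1[OF m]]
    have rv: "rvar m = rvar m0" using fr by (simp add: fun_eq_iff)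
    have blk: "blk W m = blk W m0" for W using fr by (simp add: blk_def fun_eq_iff)
    then have cont: "contents W n m = contents W n m0" for W n by (simp add: contents_def)
    have tabs: "block_tables W m b = block_tables W m0 b" for W b using fr
      by (simp add: block_tables_def)
    have "clean J K S m" using inv fr cont tabs by (simp add: clean_def layout_def)
    then show "clean J K S m \<and> rvar m = rvar m0 \<and> ivar m ''b'' < J \<and>
     (\<forall>i\<in>set (contents (2 * J) (ivar m ''b'') m). fst i < rvar m ''start'') \<and>
     (\<forall>i\<in>set (concat (map (blk (2 * J) m) [Suc (ivar m ''b'')..<J])). rvar m ''start'' < fst i)"
      using m rv blk cont by simp
  qed simp
qed

text \<open>The common part of insertion and deletion. Both write only within the cells of one
  block, so the other blocks keep lists and tables; what remains is the new list of that block
  between its unchanged neighbours.\<close>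

lemma dirtyI:
  assumes inv: "clean J K S m0" and b: "ivar m0 ''b'' = b" "b < J" and fr: "frame c m0 m"
    and c: "''J'' \<notin> mod_ivars c" "''W'' \<notin> mod_ivars c" "''K'' \<notin> mod_ivars c" "''b'' \<notin> mod_ivars c"
      "mod_iarrs c = {''z''}" "mod_rarrs c = {''s'', ''f''}"
    and z: "\<And>b'. b' \<noteq> b \<Longrightarrow> iarr m ''z'' b' = iarr m0 ''z'' b'"
    and out: "\<And>k. k < b * (2 * J) \<or> b * (2 * J) + 2 * J \<le> k \<Longrightarrow>
        rarr m ''s'' k = rarr m0 ''s'' k \<and> rarr m ''f'' k = rarr m0 ''f'' k"
    and len: "length (blk (2 * J) m b) \<le> Suc (length (blk (2 * J) m0 b))"
    and sorted: "start_sorted (contents (2 * J) b m0 @ blk (2 * J) m b @ concat (map (blk (2 * J)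
      m0) [Suc b..<J]))"
    and S': "set (contents (2 * J) b m0 @ blk (2 * J) m b @ concat (map (blk (2 * J) m0) [Suc
      b..<J])) = S'"
      "\<forall>i\<in>S'. fst i < snd i"
  shows "dirty J K S' m"
proof -
  let ?W = "2 * J"
  have KJ: "K < J" and v: "ivar m0 ''J'' = J" "ivar m0 ''W'' = ?W" "ivar m0 ''K'' = K"
    and l0: "length (contents ?W J m0) \<le> J * J + K"
    and z0: "\<And>b. b < J \<Longrightarrow> iarr m0 ''z'' b \<le> J + K"
    and tab: "\<And>b. b < J \<Longrightarrow> block_tables ?W m0 b"
    using inv by (auto simp: clean_def layout_def)
  note fr = frameD[OF fr]
  have same: "same_block ?W m0 m b'" if b': "b' < J" "b' \<noteq> b" for b'
  proof -
    have "rarr m ''s'' (b' * ?W + i) = rarr m0 ''s'' (b' * ?W + i) \<and>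
        rarr m ''f'' (b' * ?W + i) = rarr m0 ''f'' (b' * ?W + i)" if "i < iarr m0 ''z'' b'" for i
      using block_outside[OF b'(2), of i ?W] z0[OF b'(1)] KJ that by (intro out) auto
    then show ?thesis using z[OF b'(2)] fr c by (simp add: same_block_def)
  qed
  have "contents ?W b m = contents ?W b m0"
    using same b same_block_blk by (intro contents_cong) auto
  moreover have "map (blk ?W m) [Suc b..<J] = map (blk ?W m0) [Suc b..<J]"
    using same same_block_blk by (intro map_cong) auto
  ultimately have cont: "contents ?W J m = contents ?W b m0 @ blk ?W m b @ concat (map (blk ?W m0)
    [Suc b..<J])"
    using contents_split[OF b(2), of ?W m] by metis
  have l: "length (contents ?W J m) \<le> J * J + Suc K"
    using l0 len unfolding cont contents_split[OF b(2), of ?W m0] by simp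
  have "iarr m ''z'' b' \<le> J + Suc K" if "b' < J" for b'
    using z0[OF that] len z[of b'] by (cases "b' = b") auto
  then have "layout J (Suc K) S' m"
    using v fr c l sorted S' unfolding layout_def cont by simp
  moreover have "block_tables ?W m b'" if "b' < J" "b' \<noteq> b" for b'
    using same_block_tables[OF same[OF that] tab] that by simp
  moreover have "ivar m ''b'' = b" "ivar m ''K'' = K" using fr c b v by auto
  ultimately show ?thesis using KJ b by (simp add: dirty_def)
qed

lemma insert_dirty:
  assumes inv: "clean J K S m0" and fits: "word_fits J w"
    and i: "rvar m0 ''start'' = fst i" "rvar m0 ''finish'' =
      snd i" and valid: "valid_update S (Insert i)"
  shows "exec_within w (find_block ;; insert_block) m0 (J * 110 + 80) (dirty J K (insert i S))"
proof (rule exec_within_Seq[OF find_block_clean[OF inv fits]])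
  let ?W = "2 * J"
  fix m assume m: "clean J K S m \<and> rvar m = rvar m0 \<and> ivar m ''b'' < J \<and>
     (\<forall>i\<in>set (contents (2 * J) (ivar m ''b'') m). fst i < rvar m ''start'') \<and>
     (\<forall>i\<in>set (concat (map (blk (2 * J) m) [Suc (ivar m ''b'')..<J])). rvar m ''start'' < fst i)"
  let ?b = "ivar m ''b''"
  let ?M = "iarr m ''z'' ?b"
  have b: "?b < J" and inv: "clean J K S m" using m by auto
  have M: "?M \<le> J + K" "K < J" "ivar m ''W'' = ?W" "start_sorted (contents ?W J m)"
    "set (contents ?W J m) = S" "\<forall>i\<in>S. fst i < snd i"
    using inv b by (auto simp: clean_def layout_def)
  have bW: "?b * ?W + ?W \<le> J * ?W" using b mult_le_mono1[of "Suc ?b" J ?W] by simp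
  have xi: "rvar m ''start'' = fst i" "rvar m ''finish'' = snd i" using m i by auto
  have "exec_within w insert_block m (J * 80 + 50) (\<lambda>m'. frame insert_block m m' \<and>
     (\<exists>p\<le>?M. blk ?W m' ?b = take p (blk ?W m ?b) @ (rvar m ''start'', rvar m ''finish'') # drop p
       (blk ?W m ?b) \<and>
        (0 < p \<longrightarrow> \<not> rvar m ''start'' < rarr m ''s'' (?b * ?W + (p - 1))) \<and>
        (\<forall>i\<in>set (drop p (blk ?W m ?b)). rvar m ''start'' < fst i)) \<and>
     iarr m' ''z'' = (iarr m ''z'')(?b := Suc ?M) \<and>
     (\<forall>k. k < ?b * ?W \<or> ?b * ?W + ?M < k \<longrightarrow>
        rarr m' ''s'' k = rarr m ''s'' k \<and> rarr m' ''f'' k = rarr m ''f'' k))"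
    by (rule insert_block_correct) (use M bW word_fitsD[OF fits] b in auto)
  then show "exec_within w insert_block m (J * 80 + 50) (dirty J K (insert i S))"
  proof (rule exec_within_mono)
    fix m' assume m': "frame insert_block m m' \<and>
     (\<exists>p\<le>?M. blk ?W m' ?b = take p (blk ?W m ?b) @ (rvar m ''start'', rvar m ''finish'') # drop p
       (blk ?W m ?b) \<and>
        (0 < p \<longrightarrow> \<not> rvar m ''start'' < rarr m ''s'' (?b * ?W + (p - 1))) \<and>
        (\<forall>i\<in>set (drop p (blk ?W m ?b)). rvar m ''start'' < fst i)) \<and>
     iarr m' ''z'' = (iarr m ''z'')(?b := Suc ?M) \<and>
     (\<forall>k. k < ?b * ?W \<or> ?b * ?W + ?M < k \<longrightarrow>
        rarr m' ''s'' k = rarr m ''s'' k \<and> rarr m' ''f'' k = rarr m ''f'' k)"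
    let ?l = "blk ?W m ?b"
    obtain p where p: "p \<le> ?M" "blk ?W m' ?b = take p ?l @ i # drop p ?l"
      "0 < p \<Longrightarrow> \<not> fst i < rarr m ''s'' (?b * ?W + (p - 1))" "\<forall>j\<in>set (drop p ?l). fst i < fst j"
      using m' by (auto simp: xi)
    have nth: "fst (?l ! (p - 1)) = rarr m ''s'' (?b * ?W + (p - 1))" if "0 < p"
      using p(1) that by (cases p) (simp_all add: blk_def)
    have new: "fst j \<noteq> fst i" if "j \<in> S" for j
      using valid that by (fastforce simp: endpoints_def)
    have l_S: "set ?l \<subseteq> S" unfolding M(5)[symmetric] contents_split[OF b, of ?W m] by auto
    have srt: "start_sorted (contents ?W ?b m @ blk ?W m' ?b @ concat (map (blk ?W m) [Suc ?b..<J]))"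
      unfolding p(2)
    proof (rule start_sorted_insert)
      show "start_sorted (contents ?W ?b m @ ?l @ concat (map (blk ?W m) [Suc ?b..<J]))"
        using M(4) unfolding contents_split[OF b, of ?W m] .
    qed (use p m xi nth new l_S in auto)
    have "set ?l = set (take p ?l) \<union> set (drop p ?l)"
      by (metis append_take_drop_id set_append)
    then have st: "set (contents ?W ?b m @ blk ?W m' ?b @ concat (map (blk ?W m) [Suc ?b..<J])) =
      insert i S"
      unfolding M(5)[symmetric] contents_split[OF b, of ?W m] p(2) by auto
    \<comment> \<open>Strict, since insertion also writes the cell just behind the block's
      intervals. It exists because \<open>?M \<le> J + K\<close> and \<open>K < J\<close>.\<close>
    have "?b * ?W + ?M < ?b * ?W + ?W" using M by simp
    then show "dirty J K (insert i S) m'"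
      using m' valid M(6)
      by (intro dirtyI[OF inv refl b, of insert_block m']) (use srt st in \<open>auto simp: is_interval_def\<close>)
  qed simp
qed simp

lemma delete_dirty:
  assumes inv: "clean J K S m0" and fits: "word_fits J w"
    and i: "rvar m0 ''start'' = fst i" and valid: "i \<in> S"
  shows "exec_within w (find_block ;; delete_block) m0 (J * 150 + 80) (dirty J K (S - {i}))"
proof (rule exec_within_Seq[OF find_block_clean[OF inv fits]])
  let ?W = "2 * J"
  fix m assume m: "clean J K S m \<and> rvar m = rvar m0 \<and> ivar m ''b'' < J \<and>
     (\<forall>i\<in>set (contents (2 * J) (ivar m ''b'') m). fst i < rvar m ''start'') \<and>
     (\<forall>i\<in>set (concat (map (blk (2 * J) m) [Suc (ivar m ''b'')..<J])). rvar m ''start'' < fst i)"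
  let ?b = "ivar m ''b''"
  let ?M = "iarr m ''z'' ?b"
  have b: "?b < J" and inv: "clean J K S m" using m by auto
  have M: "?M \<le> J + K" "K < J" "ivar m ''W'' = ?W" "start_sorted (contents ?W J m)"
    "set (contents ?W J m) = S" "\<forall>i\<in>S. fst i < snd i"
    using inv b by (auto simp: clean_def layout_def)
  have bW: "?b * ?W + ?W \<le> J * ?W" using b mult_le_mono1[of "Suc ?b" J ?W] by simp
  have xi: "rvar m ''start'' = fst i" using m i by auto
  have "exec_within w delete_block m (J * 120 + 50) (\<lambda>m'. frame delete_block m m' \<and>
     blk ?W m' ?b = filter (\<lambda>i. fst i \<noteq> rvar m ''start'') (blk ?W m ?b) \<and>
     (\<forall>b'. b' \<noteq> ?b \<longrightarrow> iarr m' ''z'' b' = iarr m ''z'' b') \<and>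
     (\<forall>k. k < ?b * ?W \<or> ?b * ?W + ?M \<le> k \<longrightarrow>
        rarr m' ''s'' k = rarr m ''s'' k \<and> rarr m' ''f'' k = rarr m ''f'' k))"
    by (rule delete_block_correct) (use M bW word_fitsD[OF fits] b in auto)
  then show "exec_within w delete_block m (J * 120 + 50) (dirty J K (S - {i}))"
  proof (rule exec_within_mono)
    fix m' assume m': "frame delete_block m m' \<and>
     blk ?W m' ?b = filter (\<lambda>i. fst i \<noteq> rvar m ''start'') (blk ?W m ?b) \<and>
     (\<forall>b'. b' \<noteq> ?b \<longrightarrow> iarr m' ''z'' b' = iarr m ''z'' b') \<and>
     (\<forall>k. k < ?b * ?W \<or> ?b * ?W + ?M \<le> k \<longrightarrow>
        rarr m' ''s'' k = rarr m ''s'' k \<and> rarr m' ''f'' k = rarr m ''f'' k)"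
    let ?P = "\<lambda>j. fst j \<noteq> fst i"
    let ?post = "concat (map (blk ?W m) [Suc ?b..<J])"
    have blk': "blk ?W m' ?b = filter ?P (blk ?W m ?b)" using m' xi by simp
    \<comment> \<open>The other blocks contain no interval with this start, so filtering one block
      equals filtering the whole list. Order and set of the result then follow at once.\<close>
    have "filter ?P (contents ?W ?b m) = contents ?W ?b m" "filter ?P ?post = ?post"
      using m xi by (intro filter_True; force)+
    then have flt: "contents ?W ?b m @ blk ?W m' ?b @ ?post = filter ?P (contents ?W J m)"
      unfolding contents_split[OF b, of ?W m] blk' by simp
    have srt: "start_sorted (contents ?W ?b m @ blk ?W m' ?b @ ?post)"
      unfolding flt using M(4) by (rule sorted_wrt_filter)
    have st: "set (contents ?W ?b m @ blk ?W m' ?b @ ?post) = S - {i}"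
    proof -
      have "j = i" if "j \<in> S" "fst j = fst i" for j
        using start_sorted_inj[OF M(4), of j i] M(5) valid that by simp
      then show ?thesis unfolding flt using M(5) by auto
    qed
    have "?b * ?W + ?M \<le> ?b * ?W + ?W" using M by simp
    moreover have "length (blk ?W m' ?b) \<le> Suc (length (blk ?W m ?b))"
      unfolding blk' using length_filter_le le_SucI by blast
    ultimately show "dirty J K (S - {i}) m'"
      using m' M(6) by (intro dirtyI[OF inv refl b, of delete_block m']) (use srt st in auto)
  qed simp
qed simp

lemma update_correct:
  assumes inv: "clean J K S m" and fits: "word_fits J w" and L: "2 * J < 2 ^ L"
    and valid: "valid_update S u"
  shows "\<exists>t m'. exec_update w interval_scheduler u m t m' \<and>
    t \<le> J * (21 * L + 700) + (if Suc K < J then 0 else 2400 * J * J) \<and>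
    reported m' = max_compatible (apply_update u S) \<and> clean_next J K (apply_update u S) m'"
proof -
  have J: "0 < J" using inv by (auto simp: clean_def)
  let ?R = "if Suc K < J then 0 else 2400 * J * J"
  let ?T = "J * (21 * L + 332) + 70 + ?R"
  \<comment> \<open>Sequences associate to the right, so the run of \<open>c ;; d\<close> is taken
    apart and regrouped. The constants add up to 482 * J + 150 besides the search term, which is
    below 700 * J since \<open>J\<close> is positive.\<close>
  have fin: "exec_within w (c ;; d ;; finish_update) m' (J * (21 * L + 700) + ?R) Q"
    if cd: "exec_within w (c ;; d) m' (J * 150 + 80) (dirty J K S')"
      and Q: "Q = (\<lambda>m. reported m = max_compatible S' \<and> clean_next J K S' m)" for c d m' S' Q
  proof -
    from cd obtain t m1 where 1: "exec w (c ;; d) m' t m1" "t \<le> J * 150 + 80" "dirty J K S' m1"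
      by (auto simp: exec_within_def)
    from 1(1) obtain t1 t2 m0 where 2: "exec w c m' t1 m0" "exec w d m0 t2 m1" "t = t1 + t2"
      by (auto elim: SeqE)
    have "exec_within w finish_update m1 ?T Q"
      unfolding Q by (rule finish_update_correct[OF 1(3) fits L]) simp
    then obtain t3 m2 where 3: "exec w finish_update m1 t3 m2" "t3 \<le> ?T" "Q m2"
      by (auto simp: exec_within_def)
    have "exec w (c ;; d ;; finish_update) m' (t1 + (t2 + t3)) m2"
      by (intro exec.Seq[OF 2(1)] exec.Seq[OF 2(2)] 3(1))
    moreover have "t1 + (t2 + t3) \<le> J * (21 * L + 700) + ?R"
    proof -
      have "t1 + (t2 + t3) \<le> J * 150 + 80 + ?T" using 1(2) 2(3) 3(2) by simp
      also have "\<dots> \<le> J * (21 * L + 700) + ?R" using J by (simp add: distrib_left)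
      finally show ?thesis .
    qed
    ultimately show ?thesis using 3(3) unfolding exec_within_def by blast
  qed
  let ?Q = "\<lambda>m. reported m = max_compatible (apply_update u S) \<and> clean_next J K (apply_update u S) m"
  show ?thesis
  proof (cases u)
    case (Insert i)
    have "exec_within w (find_block ;; insert_block) (pass_interval i m) (J * 110 + 80)
      (dirty J K (insert i S))"
      by (rule insert_dirty[OF clean_pass_interval[OF inv] fits])
        (use valid Insert in \<open>auto simp: pass_interval_def\<close>)
    then have "exec_within w (find_block ;; insert_block) (pass_interval i m) (J * 150 + 80)
      (dirty J K (insert i S))"
      by (rule exec_within_mono) auto
    from fin[OF this, of ?Q] show ?thesis
      by (auto simp: Insert exec_within_def interval_scheduler_def)
  next
    case (Delete i)
    have "exec_within w (find_block ;; delete_block) (pass_interval i m) (J * 150 + 80)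
      (dirty J K (S - {i}))"
      by (rule delete_dirty[OF clean_pass_interval[OF inv] fits])
        (use valid Delete in \<open>auto simp: pass_interval_def\<close>)
    from fin[OF this, of ?Q] show ?thesis
      by (auto simp: Delete exec_within_def interval_scheduler_def)
  qed
qed

section \<open>Amortization over growing phases\<close>

lemma word_fits_mono: "word_fits J w \<Longrightarrow> J' \<le> J \<Longrightarrow> word_fits J' w"
  unfolding word_fits_def
  by (meson add_le_mono le_less_trans le_refl mult_le_mono)

text \<open>A rebuild costs time proportional to \<open>J\<^sup>2\<close> after \<open>J\<close> updates; every update
  saves \<open>2400 * B\<close> for it, so that a phase with \<open>K\<close> updates done has a credit of
  \<open>K * (2400 * B)\<close>.\<close>

lemma updates_correct:
  assumes "clean J K S m" "valid_updates S us" "J * (J - 1) + 2 * K + 2 * length us \<le> 2 * n"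
    and B: "\<And>J. J * (J - 1) \<le> 2 * n \<Longrightarrow> J \<le> B" and fits: "word_fits B w" and L: "2 * B < 2 ^ L"
  shows "\<exists>t. exec_updates w interval_scheduler us m (correct_answers S us) t \<and>
    t \<le> length us * (B * (21 * L + 3100)) + K * (2400 * B)"
  using assms(1-3)
proof (induction us arbitrary: J K S m)
  case Nil
  then show ?case by (auto intro: exec_updates.Nil)
next
  case (Cons u us)
  let ?S = "apply_update u S"
  \<comment> \<open>The term \<open>J * (J - 1) + 2 * K\<close> is twice the number of updates that
    the complete phases and the current one comprise so far. The third premise therefore bounds all
    updates by \<open>n\<close>, and it persists when a phase ends, as (J + 1) * J = J * (J - 1) + 2
    * J.\<close>
  have JB: "J \<le> B" using Cons.prems(3) by (intro B) simp
  have KJ: "K < J" using Cons.prems(1) by (simp add: clean_def)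
  have LJ: "2 * J < 2 ^ L" using L JB by simp
  have valid: "valid_update S u" "valid_updates ?S us" using Cons.prems(2) by auto
  obtain t1 m' where 1: "exec_update w interval_scheduler u m t1 m'"
    "t1 \<le> J * (21 * L + 700) + (if Suc K < J then 0 else 2400 * J * J)"
    "reported m' = max_compatible ?S" "clean_next J K ?S m'"
    using update_correct[OF Cons.prems(1) word_fits_mono[OF fits JB] LJ valid(1)] by blast
  have "J * (21 * L + 700) \<le> B * (21 * L + 700)" using JB by (rule mult_le_mono1)
  then have c: "t1 \<le> B * (21 * L + 700) + (if Suc K < J then 0 else 2400 * J * J)"
    using 1(2) by linarith
  have split: "B * (21 * L + 3100) = B * (21 * L + 700) + 2400 * B" by (simp add: algebra_simps)
  have "\<exists>t2. exec_updates w interval_scheduler us m' (correct_answers ?S us) t2 \<and>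
     t1 + t2 \<le> Suc (length us) * (B * (21 * L + 3100)) + K * (2400 * B)"
  proof (cases "Suc K < J")
    case True
    then have "clean J (Suc K) ?S m'" using 1(4) by (simp add: clean_next_def)
    from Cons.IH[OF this valid(2)] Cons.prems(3)
    obtain t2 where "exec_updates w interval_scheduler us m' (correct_answers ?S us) t2"
      "t2 \<le> length us * (B * (21 * L + 3100)) + Suc K * (2400 * B)" by auto
    then show ?thesis using True c split by (intro exI[of _ t2]) simp
  next
    case False
    then have J: "J = Suc K" using KJ by simp
    have "clean (Suc J) 0 ?S m'" using 1(4) False by (simp add: clean_next_def)
    from Cons.IH[OF this valid(2)] Cons.prems(3)
    obtain t2 where "exec_updates w interval_scheduler us m' (correct_answers ?S us) t2"
      "t2 \<le> length us * (B * (21 * L + 3100))" by (auto simp: J)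
    \<comment> \<open>With the saving of the present update, \<open>Suc K = J\<close> savings are at
      hand, and \<open>J \<le> B\<close> makes them cover the rebuild.\<close>
    moreover have "2400 * J * J \<le> Suc K * (2400 * B)"
      using mult_le_mono2[OF JB, of "2400 * J"] by (simp only: J mult_ac)
    ultimately show ?thesis using False c split by (intro exI[of _ t2]) simp
  qed
  then obtain t2 where "exec_updates w interval_scheduler us m' (correct_answers ?S us) t2"
     "t1 + t2 \<le> Suc (length us) * (B * (21 * L + 3100)) + K * (2400 * B)" by blast
  with exec_updates.Cons[OF 1(1) this(1)] 1(3) show ?case by auto
qed

lemma run_correct:
  assumes "valid_updates {} us"
    and B: "\<And>J. J * (J - 1) \<le> 2 * length us \<Longrightarrow> J \<le> B" and fits: "word_fits B w" and L: "2 * B < 2 ^ L"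
  shows "\<exists>t. run w interval_scheduler us (correct_answers {} us) t \<and>
    t \<le> length us * (B * (21 * L + 3100)) + 4"
proof -
  let ?m = "empty_memory\<lparr>ivar := (ivar empty_memory)(''J'' := 1, ''W'' := 2)\<rparr>"
  have "B \<ge> 1" by (rule B) simp
  have "2 < (2 :: nat) ^ w" using fits by (simp add: word_fits_def)
  then have "exec_within w (init_prog interval_scheduler) empty_memory 4 (\<lambda>m. m = ?m)"
    by (intro exec_within_wp) (auto simp: interval_scheduler_def)
  then obtain t0 where 0: "exec w (init_prog interval_scheduler) empty_memory t0 ?m" "t0 \<le> 4"
    by (auto simp: exec_within_def)
  \<comment> \<open>The zero memory is already a valid phase of one empty block, whose tables with
    \<open>N = 0\<close> satisfy all conditions vacuously.\<close>
  have "clean 1 0 {} ?m"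
    by (simp add: clean_def layout_def contents_def blk_def block_tables_def tables_def
      empty_memory_def)
  from updates_correct[OF this assms(1), of "length us" B w L] B fits L
  obtain t1 where "exec_updates w interval_scheduler us ?m (correct_answers {} us) t1"
    "t1 \<le> length us * (B * (21 * L + 3100))" by auto
  with 0 show ?thesis unfolding run_def by (intro exI[of _ "t0 + t1"]) auto
qed

lemma block_bounds:
  assumes "0 < n"
  obtains B L :: nat where "\<And>J. J * (J - 1) \<le> 2 * n \<Longrightarrow> J \<le> B" "2 * B < 2 ^ L"
    "real B \<le> 3 * sqrt (real n)" "real L \<le> 4 + 2 * ln (real n)" "B \<le> 2 * n + 1"
proof
  define r where "r = sqrt (real (2 * n))"
  \<comment> \<open>From (J - 1) * (J - 1) \<le> J * (J - 1) \<le> 2 * n follows J - 1 \<le> sqrt (2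
    * n); hence the summand 1.\<close>
  define B where "B = nat \<lfloor>r\<rfloor> + 1"
  define L where "L = nat \<lfloor>log 2 (real (2 * B))\<rfloor> + 1"
  have r0: "0 \<le> r" by (simp add: r_def)
  show "J \<le> B" if "J * (J - 1) \<le> 2 * n" for J
  proof -
    have "(J - 1) * (J - 1) \<le> J * (J - 1)" by (rule mult_le_mono1) simp
    from le_trans[OF this that] have "(J - 1)\<^sup>2 \<le> 2 * n" by (simp add: power2_eq_square)
    then have "(real (J - 1))\<^sup>2 \<le> real (2 * n)" by (metis of_nat_le_iff of_nat_power)
    then have "real (J - 1) \<le> r" unfolding r_def by (rule real_le_rsqrt)
    then have "J - 1 \<le> nat \<lfloor>r\<rfloor>" by (simp add: le_nat_floor)
    then show ?thesis by (simp add: B_def)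
  qed
  have n1: "1 \<le> sqrt (real n)" "sqrt (real n) \<le> real n"
    using assms by (simp_all add: real_sqrt_le_iff sqrt_le_D real_le_lsqrt power2_eq_square)
  \<comment> \<open>Rounding sqrt 2 up to 2 leaves 2 * sqrt n + 1 for \<open>B\<close>, and 1 \<le>
    sqrt n absorbs the last summand.\<close>
  have "r \<le> sqrt (4 * real n)" unfolding r_def by (rule real_sqrt_le_mono) simp
  also have "\<dots> = 2 * sqrt (real n)" by (simp add: real_sqrt_mult)
  finally have r2: "r \<le> 2 * sqrt (real n)" .
  have Br: "real B \<le> r + 1" using r0 by (simp add: B_def)
  then show B3: "real B \<le> 3 * sqrt (real n)" using r2 n1 by linarith
  have "real B \<le> real (2 * n + 1)" using Br r2 n1 by linarith
  then show "B \<le> 2 * n + 1" by (simp only: of_nat_le_iff)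
  have B0: "0 < B" by (simp add: B_def)
  have l0: "0 \<le> log 2 (real (2 * B))" using B0 by simp
  have "real (2 * B) = 2 powr (log 2 (real (2 * B)))" using B0 by simp
  also have "\<dots> < 2 powr (real L)"
    by (rule powr_less_mono) (use l0 in \<open>simp_all add: L_def\<close>, linarith)
  also have "\<dots> = real (2 ^ L)" by (simp add: powr_realpow)
  finally show "2 * B < 2 ^ L" by (simp only: of_nat_less_iff)
  have "real L \<le> log 2 (real (2 * B)) + 1" using l0 by (simp add: L_def)
  also have "log 2 (real (2 * B)) \<le> log 2 (8 * real n)"
  proof -
    \<comment> \<open>The factor 6 would do; 8 is chosen for its integral logarithm 3.\<close>
    have "real (2 * B) \<le> 8 * real n" using B3 n1 by linarith
    then show ?thesis using B0 assms by (subst log_le_cancel_iff) auto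
  qed
  also have "log 2 (8 * real n) = 3 + ln (real n) / ln 2"
  proof -
    have "log 2 (8 :: real) = 3" using log_pow_cancel[of "2::real" 3] by simp
    then show ?thesis using assms by (simp add: log_mult log_def[of 2 "real n"])
  qed
  also have "ln (real n) / ln 2 \<le> 2 * ln (real n)"
  proof -
    \<comment> \<open>As exp 1 \<le> 3 \<le> 4, the factor 1 / ln 2 between the two logarithms is at
      most 2.\<close>
    have "1 \<le> ln ((2 :: real) ^ 2)" using exp_le by (subst ln_ge_iff) auto
    then have "1 \<le> 2 * ln (2 :: real)" by (subst (asm) ln_realpow) auto
    then have "ln (real n) * 1 \<le> ln (real n) * (2 * ln 2)" using assms by (intro mult_left_mono) auto
    then show ?thesis by (simp add: divide_le_eq algebra_simps)
  qed
  finally show "real L \<le> 4 + 2 * ln (real n)" by simp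
qed

text \<open>The exponent 7 is 2 + 5: with \<open>?x = n + 1\<close> the required size is quadratic,
  below 32 times the square of \<open>?x\<close>, and 32 is at most the fifth power of
  \<open>?x\<close> because \<open>?x\<close> is at least 2. The factor of the logarithm becomes
  this exponent.\<close>

lemma word_fits_poly:
  assumes "0 < n" "B \<le> 2 * n + 1" "7 * log 2 (real n + 1) \<le> real w"
  shows "word_fits B w"
proof -
  let ?x = "n + 1"
  have "real ?x ^ 7 = 2 powr (7 * log 2 (real n + 1))"
  proof -
    have "real ?x ^ 7 = (real n + 1) powr 7" using powr_realpow[of "real n + 1" 7]
      by (simp add: add.commute)
    also have "\<dots> = (2 powr log 2 (real n + 1)) powr 7" by (subst powr_log_cancel) auto
    also have "\<dots> = 2 powr (log 2 (real n + 1) * 7)" by (rule powr_powr)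
    finally show ?thesis by (simp only: mult.commute)
  qed
  also have "\<dots> \<le> 2 powr (real w)" using assms(3) by (intro powr_mono) auto
  also have "\<dots> = real (2 ^ w)" by (simp add: powr_realpow)
  finally have x: "?x ^ 7 \<le> 2 ^ w" by (metis of_nat_le_iff of_nat_power)
  have "(B + 1) * (2 * (B + 1)) + 2 * (2 * (B + 1)) + 2 \<le> (2 * ?x) * (2 * (2 * ?x)) + 2 * (2 * (2 *
    ?x)) + 2"
    using assms(2) by (intro add_le_mono mult_le_mono) auto
  also have "\<dots> = 8 * ?x\<^sup>2 + 8 * ?x + 2" by (simp add: power2_eq_square)
  also have "\<dots> < ?x ^ 7"
  proof -
    have 2: "2 ^ k \<le> ?x ^ k" for k using assms(1) by (intro power_mono) auto
    have "8 * ?x\<^sup>2 + 8 * ?x + 2 < 32 * ?x\<^sup>2"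
      using assms(1) by (simp add: power2_eq_square algebra_simps)
    also have "\<dots> \<le> ?x ^ 5 * ?x\<^sup>2" using 2[of 5] by (intro mult_le_mono1) simp
    finally show ?thesis by (simp flip: power_add)
  qed
  finally show ?thesis using x unfolding word_fits_def by simp
qed

theorem theorem24:
  shows "\<exists>D \<tau>. supports_updates_amortized D \<tau> \<and>
           \<tau> \<in> O(\<lambda>n. sqrt (real n) * ln (real n))"
proof -
  \<comment> \<open>The summand 1 keeps the bound positive at \<open>n = 1\<close>, where the
    logarithm vanishes but an update still takes time.\<close>
  define \<tau> :: "nat \<Rightarrow> real" where "\<tau> = (\<lambda>n. 10000 * sqrt (real n) * (ln (real n) + 1))"
  have "supports_updates_amortized interval_scheduler \<tau>"
    unfolding supports_updates_amortized_def
  proof (rule exI[of _ 7], intro allI impI)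
    fix w us
    assume us: "us \<noteq> []" "valid_updates {} us" and w: "7 * log 2 (real (length us) + 1) \<le> real w"
    define n where "n = length us"
    have n0: "0 < n" using us by (simp add: n_def)
    obtain B L where BL: "\<And>J. J * (J - 1) \<le> 2 * n \<Longrightarrow> J \<le> B" "2 * B < 2 ^ L"
      "real B \<le> 3 * sqrt (real n)" "real L \<le> 4 + 2 * ln (real n)" "B \<le> 2 * n + 1"
      using block_bounds[OF n0] by blast
    have "word_fits B w" using word_fits_poly[OF n0 BL(5)] w by (simp add: n_def)
    from run_correct[OF us(2) _ this BL(2)] BL(1) obtain t where
      t: "run w interval_scheduler us (correct_answers {} us) t" "t \<le> n * (B * (21 * L + 3100)) + 4"
      by (auto simp: n_def)
    have sq: "1 \<le> sqrt (real n)" and ln: "0 \<le> ln (real n)" using n0 by auto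
    have "real t \<le> real (n * (B * (21 * L + 3100)) + 4)" using t(2) by (simp only: of_nat_le_iff)
    also have "\<dots> = real n * (real B * (21 * real L + 3100)) + 4" by simp
    also have "real B * (21 * real L + 3100) \<le> (3 * sqrt (real n)) * (21 * (4 + 2 * ln (real n)) +
      3100)"
      using BL(3,4) ln by (intro mult_mono) auto
    \<comment> \<open>Here 9552 = 3 * (21 * 4 + 3100) and 126 = 3 * 21 * 2.\<close>
    also have "\<dots> = sqrt (real n) * (9552 + 126 * ln (real n))" by (simp add: algebra_simps)
    \<comment> \<open>The one-time cost 4 of the initialization is charged to the updates, of which
      there is at least one.\<close>
    also have "4 \<le> real n * (sqrt (real n) * 4)"
    proof -
      have "1 * 1 \<le> real n * sqrt (real n)" using n0 sq by (intro mult_mono) linarith+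
      then show ?thesis by simp
    qed
    finally have "real t \<le> real n * (sqrt (real n) * (9552 + 126 * ln (real n))) + real n * (sqrt
      (real n) * 4)"
      using n0 by simp
    also have "\<dots> = real n * (sqrt (real n) * (9556 + 126 * ln (real n)))" by (simp add: algebra_simps)
    also have "\<dots> \<le> real n * (sqrt (real n) * (10000 * (ln (real n) + 1)))"
      using ln by (intro mult_left_mono) auto
    finally have "real t \<le> real n * \<tau> n" by (simp add: \<tau>_def mult_ac)
    with t(1) show "\<exists>t. run w interval_scheduler us (correct_answers {} us) t \<and>
        real t \<le> real (length us) * \<tau> (length us)" by (auto simp: n_def)
  qed
  moreover have "\<tau> \<in> O(\<lambda>n. sqrt (real n) * ln (real n))"
  proof (rule bigoI[of _ 20000])
    show "eventually (\<lambda>n. norm (\<tau> n) \<le> 20000 * norm (sqrt (real n) * ln (real n))) at_top"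
      using eventually_ge_at_top[of 3]
    proof eventually_elim
      case (elim n)
      \<comment> \<open>From 3 on the logarithm is at least 1, so it absorbs the summand 1 at the
        price of doubling the constant.\<close>
      have "3 \<le> real n" using elim by simp
      then have "exp 1 \<le> real n" using exp_le by linarith
      then have "1 \<le> ln (real n)" using elim by (simp add: ln_ge_iff)
      then have "sqrt (real n) * (ln (real n) + 1) \<le> sqrt (real n) * (2 * ln (real n))"
        by (intro mult_left_mono) auto
      then show ?case using \<open>1 \<le> ln (real n)\<close> by (simp add: \<tau>_def abs_mult)
    qed
  qed
  ultimately show ?thesis by blast
qed

end
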